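(* Let $K$ be a field of characteristic $0$ and let $V$ be the variety of unitary algebras defined by the polynomial identities of $F=K[C_1,C_2]$. If $U$ is a proper subvariety (of unitary algebras) of $V$, then $U$ is asymptotically equivalent to either $\mathrm{var}(K)$ or $\mathrm{var}(UT_2(K))$.
   Context: All algebras are unitary associative algebras over $K$. $K\langle T\rangle$ is the free unitary associative algebra on $T=\{t_1,t_2,\dots\}$; $T(A)$ (resp. $T(U)$) is the T-ideal of all polynomial identities of an algebra $A$ (resp. of a variety $U$). $\mathrm{var}(A)$ is the variety of unitary algebras generated by $A$. $UT_2(K)$ is the algebra of upper triangular $2\times 2$ matrices over $K$. Proper polynomials are the elements of the subalgebra of $K\langle T\rangle$ generated by $1$ and all commutators of degree at least $2$ in the variables; $\Gamma_n$ is the space of proper multilinear polynomials in $t_1,\dots,t_n$. Two T-ideals $I,J$ are asymptotically equivalent if $I\cap B_n=J\cap B_n$ for all sufficiently large $n$, where $B_n$ is the space of proper polynomials of degree $n$ (since the algebras are unitary and the characteristic is $0$, $B_n$ may be replaced by $\Gamma_n$). Two varieties are asymptotically equivalent if their T-ideals of identities are. The algebra $F$: let $K[X;Y]=K[x_1,x_2,x_1',x_2']\otimes_K E(y_1,y_2,y_1',y_2')$ be the free supercommutative algebra on even (commuting, central) variables $X=\{x_1,x_2,x_1',x_2'\}$ and odd (pairwise anticommuting, square zero) variables $Y=\{y_1,y_2,y_1',y_2'\}$, where $E(y_1,y_2,y_1',y_2')$ is the Grassmann algebra on the vector space with basis $Y$. Put $C_i=\begin{pmatrix}x_i&y_i\\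 y_i'&x_i'\end{pmatrix}\in M_2(K[X;Y])$ for $i=1,2$. Then $F=K[C_1,C_2]$ is the unitary $K$-subalgebra of $M_2(K[X;Y])$ generated by $C_1$ and $C_2$. *)

theory Defs
  imports "Jordan_Normal_Form.Matrix" "HOL-Library.Poly_Mapping" "HOL-Library.Numeral_Type"
begin

section \<open>Unitary associative algebras\<close>

text \<open>The zero algebra is allowed; it belongs to every variety.\<close>

locale unital_algebra = ring A for A :: "('k::field, 'a) module" (structure) +
  assumes smult_closed: "x \<in> carrier A \<Longrightarrow> c \<odot> x \<in> carrier A"
    and smult_add_left: "x \<in> carrier A \<Longrightarrow> (c + d) \<odot> x = c \<odot> x \<oplus> d \<odot> x"
    and smult_add_right: "\<lbrakk>x \<in> carrier A; y \<in> carrier A\<rbrakk> \<Longrightarrow> c \<odot> (x \<oplus> y) = c \<odot> x \<oplus> c \<odot> y"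
    and smult_smult: "x \<in> carrier A \<Longrightarrow> (c * d) \<odot> x = c \<odot> (d \<odot> x)"
    and smult_one: "x \<in> carrier A \<Longrightarrow> 1 \<odot> x = x"
    and smult_mult_left: "\<lbrakk>x \<in> carrier A; y \<in> carrier A\<rbrakk> \<Longrightarrow> (c \<odot> x) \<otimes> y = c \<odot> (x \<otimes> y)"
    and smult_mult_right: "\<lbrakk>x \<in> carrier A; y \<in> carrier A\<rbrakk> \<Longrightarrow> x \<otimes> (c \<odot> y) = c \<odot> (x \<otimes> y)"

inductive_set generated_carrier :: "('k, 'a) module \<Rightarrow> 'a set \<Rightarrow> 'a set"
  for A :: "('k, 'a) module" and S :: "'a set" where
  one: "\<one>\<^bsub>A\<^esub> \<in> generated_carrier A S"
| base: "x \<in> S \<Longrightarrow> x \<in> generated_carrier A S"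
| add: "\<lbrakk>x \<in> generated_carrier A S; y \<in> generated_carrier A S\<rbrakk>
    \<Longrightarrow> x \<oplus>\<^bsub>A\<^esub> y \<in> generated_carrier A S"
| mult: "\<lbrakk>x \<in> generated_carrier A S; y \<in> generated_carrier A S\<rbrakk>
    \<Longrightarrow> x \<otimes>\<^bsub>A\<^esub> y \<in> generated_carrier A S"
| smult: "x \<in> generated_carrier A S \<Longrightarrow> c \<odot>\<^bsub>A\<^esub> x \<in> generated_carrier A S"

definition subalgebra_generated :: "('k, 'a) module \<Rightarrow> 'a set \<Rightarrow> ('k, 'a) module" where
  "subalgebra_generated A S = A\<lparr>carrier := generated_carrier A S\<rparr>"


section \<open>The free algebra and proper polynomials\<close>

text \<open>Words under concatenation form the free monoid, so that finitely supported functions on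
  words, with the convolution product of \<^theory>\<open>HOL-Library.Poly_Mapping\<close>, are the free algebra.\<close>

instantiation list :: (type) monoid_add
begin

definition zero_list :: "'a list" where "zero_list = []"
definition plus_list :: "'a list \<Rightarrow> 'a list \<Rightarrow> 'a list" where "plus_list = (@)"

instance
  by standard (simp_all add: zero_list_def plus_list_def)

end

type_synonym 'k free_poly = "nat list \<Rightarrow>\<^sub>0 'k"

definition free_var :: "nat \<Rightarrow> 'k::field free_poly" where
  "free_var i = Poly_Mapping.single [i] 1"

definition free_algebra :: "('k::field, 'k free_poly) module" where
  "free_algebra = \<lparr>carrier = UNIV, mult = (*), one = 1, zero = 0, add = (+),
     smult = (\<lambda>c f. Poly_Mapping.single 0 c * f)\<rparr>"

definition commutator :: "'r::ring \<Rightarrow> 'r \<Rightarrow> 'r" where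
  "commutator a b = a * b - b * a"

text \<open>Longer commutators are left-normed:
  \<open>[u\<^sub>1, \<dots>, u\<^sub>n] = [[u\<^sub>1, \<dots>, u\<^sub>n\<^sub>-\<^sub>1], u\<^sub>n]\<close>.\<close>

definition var_commutators :: "'k::field free_poly set" where
  "var_commutators =
     {foldl commutator (free_var i) (map free_var js) | i js. js \<noteq> []}"

definition proper_polys :: "'k::field free_poly set" where
  "proper_polys = carrier (subalgebra_generated free_algebra var_commutators)"

text \<open>\<open>proper_polys_deg n\<close> is the space \<open>B\<^sub>n\<close>: homogeneous of degree \<open>n\<close> (with \<open>0\<close> included), in
  any number of variables.\<close>

definition proper_polys_deg :: "nat \<Rightarrow> 'k::field free_poly set" where
  "proper_polys_deg n = {f \<in> proper_polys. \<forall>w \<in> Poly_Mapping.keys f. length w = n}"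


section \<open>Polynomial identities and varieties\<close>

definition eval_word :: "('k::field, 'a) module \<Rightarrow> (nat \<Rightarrow> 'a) \<Rightarrow> nat list \<Rightarrow> 'a" where
  "eval_word A \<rho> w = foldr (\<lambda>i a. \<rho> i \<otimes>\<^bsub>A\<^esub> a) w \<one>\<^bsub>A\<^esub>"

definition eval_poly :: "('k::field, 'a) module \<Rightarrow> (nat \<Rightarrow> 'a) \<Rightarrow> 'k free_poly \<Rightarrow> 'a" where
  "eval_poly A \<rho> f =
     (\<Oplus>\<^bsub>A\<^esub>w \<in> Poly_Mapping.keys f. Poly_Mapping.lookup f w \<odot>\<^bsub>A\<^esub> eval_word A \<rho> w)"

definition identities :: "('k::field, 'a) module \<Rightarrow> 'k free_poly set" where
  "identities A = {f. \<forall>\<rho>. range \<rho> \<subseteq> carrier A \<longrightarrow> eval_poly A \<rho> f = \<zero>\<^bsub>A\<^esub>}"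

text \<open>A variety is taken relative to a universe: it consists of the algebras with carrier in the
  type \<^typ>\<open>'a\<close>. Every countably generated algebra has a copy in \<^typ>\<open>'a\<close> as soon as \<^typ>\<open>'a\<close> is
  infinite and at least as large as the ground field, and in that case a variety is
  determined by its members in the universe.\<close>

definition variety :: "'k::field free_poly set \<Rightarrow> ('k, 'a) module set" where
  "variety S = {A. unital_algebra A \<and> S \<subseteq> identities A}"

definition is_variety :: "('k::field, 'a) module set \<Rightarrow> bool" where
  "is_variety U \<longleftrightarrow> (\<exists>S. U = variety S)"

text \<open>The generating algebra need not live in the universe of the variety.\<close>

definition var_generated :: "('k::field, 'b) module \<Rightarrow> ('k, 'a) module set" where
  "var_generated B = variety (identities B)"

definition variety_identities :: "('k::field, 'a) module set \<Rightarrow> 'k free_poly set" where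
  "variety_identities U = {f. \<forall>A \<in> U. f \<in> identities A}"

definition T_ideals_asymp_equiv :: "'k::field free_poly set \<Rightarrow> 'k free_poly set \<Rightarrow> bool" where
  "T_ideals_asymp_equiv I J \<longleftrightarrow>
     (\<exists>N. \<forall>n\<ge>N. I \<inter> proper_polys_deg n = J \<inter> proper_polys_deg n)"

definition asymp_equiv_varieties :: "('k::field, 'a) module set \<Rightarrow> ('k, 'a) module set \<Rightarrow> bool" where
  "asymp_equiv_varieties U W \<longleftrightarrow>
     T_ideals_asymp_equiv (variety_identities U) (variety_identities W)"


section \<open>Grassmann algebras\<close>

text \<open>The Grassmann algebra of a free module with finite ordered basis \<open>y\<close> indexed by \<^typ>\<open>'y\<close>,
  over a commutative ring \<^typ>\<open>'r\<close>. An element is given by its coefficients with respect to the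
  basis of increasing products \<open>y\<^sub>A\<close>, where \<open>A\<close> is a set of indices. For disjoint \<open>A\<close>, \<open>B\<close> one has
  \<open>y\<^sub>A y\<^sub>B = \<plusminus> y\<^sub>A\<^sub>\<union>\<^sub>B\<close> where the sign counts inversions; otherwise \<open>y\<^sub>A y\<^sub>B = 0\<close>.\<close>

typedef ('y, 'r) grassmann = "UNIV :: ('y set \<Rightarrow> 'r) set"
  morphisms gcoeff Grassmann ..

setup_lifting type_definition_grassmann

definition inversions :: "'y::linorder set \<Rightarrow> 'y set \<Rightarrow> ('y \<times> 'y) set" where
  "inversions A B = {(a, b) \<in> A \<times> B. b < a}"

definition gsign :: "'y::linorder set \<Rightarrow> 'y set \<Rightarrow> 'r::comm_ring_1" where
  "gsign A B = (- 1) ^ card (inversions A B)"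

lemma gsign_Un_left:
  fixes A B C :: "'y::{finite, linorder} set"
  assumes "A \<inter> B = {}"
  shows "gsign (A \<union> B) C = gsign A C * gsign B C"
proof -
  have "inversions (A \<union> B) C = inversions A C \<union> inversions B C"
    by (auto simp: inversions_def)
  moreover have "inversions A C \<inter> inversions B C = {}"
    using assms by (auto simp: inversions_def)
  ultimately show ?thesis
    by (simp add: gsign_def card_Un_disjoint power_add)
qed

lemma gsign_Un_right:
  fixes A B C :: "'y::{finite, linorder} set"
  assumes "B \<inter> C = {}"
  shows "gsign A (B \<union> C) = gsign A B * gsign A C"
proof -
  have "inversions A (B \<union> C) = inversions A B \<union> inversions A C"
    by (auto simp: inversions_def)
  moreover have "inversions A B \<inter> inversions A C = {}"
    using assms by (auto simp: inversions_def)
  ultimately show ?thesis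
    by (simp add: gsign_def card_Un_disjoint power_add)
qed

lemma gsign_empty [simp]: "gsign {} A = 1" "gsign A {} = 1"
  by (simp_all add: gsign_def inversions_def)

instantiation grassmann :: ("{finite, linorder}", comm_ring_1) ring_1
begin

lift_definition zero_grassmann :: "('a, 'b) grassmann" is "\<lambda>_. 0" .
lift_definition one_grassmann :: "('a, 'b) grassmann" is "\<lambda>S. if S = {} then 1 else 0" .
lift_definition plus_grassmann :: "('a, 'b) grassmann \<Rightarrow> ('a, 'b) grassmann \<Rightarrow> ('a, 'b) grassmann"
  is "\<lambda>f g S. f S + g S" .
lift_definition minus_grassmann :: "('a, 'b) grassmann \<Rightarrow> ('a, 'b) grassmann \<Rightarrow> ('a, 'b) grassmann"
  is "\<lambda>f g S. f S - g S" .
lift_definition uminus_grassmann :: "('a, 'b) grassmann \<Rightarrow> ('a, 'b) grassmann"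
  is "\<lambda>f S. - f S" .
lift_definition times_grassmann :: "('a, 'b) grassmann \<Rightarrow> ('a, 'b) grassmann \<Rightarrow> ('a, 'b) grassmann"
  is "\<lambda>f g S. \<Sum>A \<in> Pow S. gsign A (S - A) * f A * g (S - A)" .

instance
proof
  fix a b c :: "('a, 'b) grassmann"
  show "a + b + c = a + (b + c)" by transfer (simp add: add.assoc)
  show "a + b = b + a" by transfer (simp add: add.commute)
  show "0 + a = a" by transfer simp
  show "- a + a = 0" by transfer simp
  show "a - b = a + - b" by transfer simp
  show "(a + b) * c = a * c + b * c"
    by transfer (simp add: algebra_simps sum.distrib)
  show "a * (b + c) = a * b + a * c"
    by transfer (simp add: algebra_simps sum.distrib)
  show "(0 :: ('a, 'b) grassmann) \<noteq> 1"
    by transfer (auto simp: fun_eq_iff)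
  show "1 * a = a"
  proof (transfer, rule ext)
    fix a :: "'a set \<Rightarrow> 'b" and S :: "'a set"
    have "(\<Sum>A\<in>Pow S. gsign A (S - A) * (if A = {} then 1 else 0) * a (S - A))
        = (\<Sum>A\<in>Pow S. if A = {} then a S else 0)"
      by (intro sum.cong) auto
    then show "(\<Sum>A\<in>Pow S. gsign A (S - A) * (if A = {} then 1 else 0) * a (S - A)) = a S"
      by simp
  qed
  show "a * 1 = a"
  proof (transfer, rule ext)
    fix a :: "'a set \<Rightarrow> 'b" and S :: "'a set"
    have "(\<Sum>A\<in>Pow S. gsign A (S - A) * a A * (if S - A = {} then 1 else 0))
        = (\<Sum>A\<in>Pow S. if A = S then a S else 0)"
      by (intro sum.cong) auto
    then show "(\<Sum>A\<in>Pow S. gsign A (S - A) * a A * (if S - A = {} then 1 else 0)) = a S"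
      by simp
  qed
  show "a * b * c = a * (b * c)"
  proof (transfer, rule ext)
    fix a b c :: "'a set \<Rightarrow> 'b" and S :: "'a set"
    let ?t = "\<lambda>A B. gsign A B * gsign A (S - (A \<union> B)) * gsign B (S - (A \<union> B))
        * a A * b B * c (S - (A \<union> B)) :: 'b"
    have "(\<Sum>D\<in>Pow S. gsign D (S - D) * (\<Sum>A\<in>Pow D. gsign A (D - A) * a A * b (D - A)) * c (S - D))
        = (\<Sum>D\<in>Pow S. \<Sum>A\<in>Pow D. ?t A (D - A))"
    proof (intro sum.cong refl)
      fix D assume "D \<in> Pow S"
      have "gsign D (S - D) * (gsign A (D - A) * a A * b (D - A)) * c (S - D) = ?t A (D - A)"
        if "A \<in> Pow D" for A
      proof -
        have D: "A \<union> (D - A) = D" using that by blast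
        have "gsign D (S - D) = (gsign A (S - D) * gsign (D - A) (S - D) :: 'b)"
          using gsign_Un_left[of A "D - A" "S - D"] D by auto
        then show ?thesis unfolding D by (simp add: mult_ac)
      qed
      then show "gsign D (S - D) * (\<Sum>A\<in>Pow D. gsign A (D - A) * a A * b (D - A)) * c (S - D)
          = (\<Sum>A\<in>Pow D. ?t A (D - A))"
        by (simp add: sum_distrib_left sum_distrib_right)
    qed
    also have "\<dots> = (\<Sum>(D, A)\<in>(SIGMA D:Pow S. Pow D). ?t A (D - A))"
      by (simp add: sum.Sigma)
    also have "\<dots> = (\<Sum>(A, B)\<in>(SIGMA A:Pow S. Pow (S - A)). ?t A B)"
      by (rule sum.reindex_bij_witness[of _ "\<lambda>(A, B). (A \<union> B, A)" "\<lambda>(D, A). (A, D - A)"]) auto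
    also have "\<dots> = (\<Sum>A\<in>Pow S. \<Sum>B\<in>Pow (S - A). ?t A B)"
      by (simp add: sum.Sigma)
    also have "\<dots> = (\<Sum>A\<in>Pow S. gsign A (S - A) * a A
        * (\<Sum>B\<in>Pow (S - A). gsign B (S - A - B) * b B * c (S - A - B)))"
    proof (intro sum.cong refl)
      fix A assume "A \<in> Pow S"
      have "gsign A (S - A) * a A * (gsign B (S - A - B) * b B * c (S - A - B)) = ?t A B"
        if "B \<in> Pow (S - A)" for B
      proof -
        have D: "B \<union> (S - A - B) = S - A" and E: "S - A - B = S - (A \<union> B)" using that by blast+
        have "gsign A (S - A) = (gsign A B * gsign A (S - A - B) :: 'b)"
          using gsign_Un_right[of B "S - A - B" A] D by auto
        then show ?thesis unfolding E by (simp add: mult_ac)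
      qed
      then show "(\<Sum>B\<in>Pow (S - A). ?t A B) = gsign A (S - A) * a A
          * (\<Sum>B\<in>Pow (S - A). gsign B (S - A - B) * b B * c (S - A - B))"
        by (simp add: sum_distrib_left)
    qed
    finally show "(\<Sum>D\<in>Pow S. gsign D (S - D) * (\<Sum>A\<in>Pow D. gsign A (D - A) * a A * b (D - A)) * c (S - D))
        = (\<Sum>A\<in>Pow S. gsign A (S - A) * a A
            * (\<Sum>B\<in>Pow (S - A). gsign B (S - A - B) * b B * c (S - A - B)))" .
  qed
qed

end

lift_definition geven :: "'r \<Rightarrow> ('y::{finite, linorder}, 'r::comm_ring_1) grassmann"
  is "\<lambda>r S. if S = {} then r else 0" .

lift_definition godd :: "'y \<Rightarrow> ('y::{finite, linorder}, 'r::comm_ring_1) grassmann"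
  is "\<lambda>i S. if S = {i} then 1 else 0" .

lemma gcoeff_times:
  "gcoeff (f * g) S = (\<Sum>A \<in> Pow S. gsign A (S - A) * gcoeff f A * gcoeff g (S - A))"
  by transfer simp

lemma gcoeff_geven_times: "gcoeff (geven r * f) S = r * gcoeff f S"
proof -
  have "gcoeff (geven r * f) S = (\<Sum>A \<in> Pow S. if A = {} then r * gcoeff f S else 0)"
    unfolding gcoeff_times by (intro sum.cong) (auto simp: geven.rep_eq)
  then show ?thesis by simp
qed

lemma gcoeff_times_geven: "gcoeff (f * geven r) S = r * gcoeff f S"
proof -
  have "gcoeff (f * geven r) S = (\<Sum>A \<in> Pow S. if A = S then r * gcoeff f S else 0)"
    unfolding gcoeff_times by (intro sum.cong) (auto simp: geven.rep_eq)
  then show ?thesis by simp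
qed

lemma geven_central: "geven r * f = f * geven r"
  by (simp add: gcoeff_inject[symmetric] fun_eq_iff gcoeff_geven_times gcoeff_times_geven)

lemma gcoeff_godd_times_godd:
  "gcoeff (godd i * godd j :: ('y::{finite, linorder}, 'r::comm_ring_1) grassmann) S
     = (if i \<noteq> j \<and> S = {i, j} then gsign {i} {j} else 0)"
proof -
  have "gcoeff (godd i * godd j :: ('y, 'r) grassmann) S
      = (\<Sum>A \<in> Pow S. if A = {i} then (if S - {i} = {j} then gsign {i} {j} else 0) else 0)"
    unfolding gcoeff_times by (intro sum.cong) (auto simp: godd.rep_eq)
  also have "\<dots> = (if i \<in> S \<and> S - {i} = {j} then gsign {i} {j} else 0)"
    by simp
  also have "(i \<in> S \<and> S - {i} = {j}) \<longleftrightarrow> (i \<noteq> j \<and> S = {i, j})"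
    by auto
  finally show ?thesis .
qed

lemma godd_square: "godd i * godd i = 0"
  by (simp add: gcoeff_inject[symmetric] fun_eq_iff gcoeff_godd_times_godd zero_grassmann.rep_eq)

lemma gsign_singletons: "gsign {i} {j} = (if j < i then - 1 else 1)"
proof -
  have "inversions {i} {j} = (if j < i then {(i, j)} else {})"
    by (auto simp: inversions_def)
  then show ?thesis by (simp add: gsign_def)
qed

lemma godd_anticommute: "godd i * godd j = - (godd j * godd i)"
  by (cases i j rule: linorder_cases)
    (auto simp: gcoeff_inject[symmetric] fun_eq_iff gcoeff_godd_times_godd
      uminus_grassmann.rep_eq gsign_singletons insert_commute)


section \<open>The algebras \<open>K\<close>, \<open>UT\<^sub>2(K)\<close> and \<open>F\<close>\<close>

definition ground_algebra :: "('k::field, 'k) module" where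
  "ground_algebra = \<lparr>carrier = UNIV, mult = (*), one = 1, zero = 0, add = (+), smult = (*)\<rparr>"

text \<open>The ring of \<open>n \<times> n\<close> matrices over \<^typ>\<open>'r\<close>, as an algebra through the structure map
  \<open>\<iota>\<close> of the ground field into \<^typ>\<open>'r\<close>.\<close>

definition mat_algebra :: "('k::field \<Rightarrow> 'r::ring_1) \<Rightarrow> nat \<Rightarrow> ('k, 'r mat) module" where
  "mat_algebra \<iota> n = \<lparr>carrier = carrier_mat n n, mult = (*), one = 1\<^sub>m n, zero = 0\<^sub>m n n, add = (+),
     smult = (\<lambda>c M. \<iota> c \<cdot>\<^sub>m M)\<rparr>"

definition UT2 :: "('k::field, 'k mat) module" where
  "UT2 = (mat_algebra id 2)\<lparr>carrier := {M \<in> carrier_mat 2 2. upper_triangular M}\<rparr>"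

text \<open>\<open>K[X;Y] = K[X] \<otimes>\<^sub>K E(Y)\<close> is the Grassmann algebra on \<open>Y\<close> over the polynomial ring \<open>K[X]\<close>.
  In both alphabets, the indices \<open>0, 1, 2, 3\<close> stand for the variables with decoration
  \<open>1, 2, 1', 2'\<close>, in this order.\<close>

type_synonym 'k supercomm = "(4, (4 \<Rightarrow>\<^sub>0 nat) \<Rightarrow>\<^sub>0 'k) grassmann"

definition super_const :: "'k::field \<Rightarrow> 'k supercomm" where
  "super_const c = geven (Poly_Mapping.single 0 c)"

definition even_var :: "4 \<Rightarrow> 'k::field supercomm" where
  "even_var i = geven (Poly_Mapping.single (Poly_Mapping.single i 1) 1)"

definition odd_var :: "4 \<Rightarrow> 'k::field supercomm" where
  "odd_var i = godd i"

definition C1 :: "'k::field supercomm mat" where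
  "C1 = mat_of_rows_list 2 [[even_var 0, odd_var 0], [odd_var 2, even_var 2]]"

definition C2 :: "'k::field supercomm mat" where
  "C2 = mat_of_rows_list 2 [[even_var 1, odd_var 1], [odd_var 3, even_var 3]]"

definition F_algebra :: "('k::field, 'k supercomm mat) module" where
  "F_algebra = subalgebra_generated (mat_algebra super_const 2) {C1, C2}"


subsection \<open>These are unitary algebras\<close>

lemma unital_algebra_ground: "unital_algebra ground_algebra"
proof -
  have "\<exists>y. y + x = 0 \<and> x + y = 0" for x :: 'a
    by (rule exI[of _ "- x"]) simp
  then show ?thesis
    by unfold_locales (auto simp: ground_algebra_def algebra_simps Units_def)
qed

lemma unital_algebra_mat:
  assumes "\<And>c d. \<iota> (c + d) = \<iota> c + \<iota> d" "\<And>c d. \<iota> (c * d) = \<iota> c * \<iota> d" "\<iota> 1 = 1"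
    and central: "\<And>c r. \<iota> c * r = r * \<iota> c"
  shows "unital_algebra (mat_algebra \<iota> n)"
proof -
  have inv: "\<exists>y\<in>carrier_mat n n. y + x = 0\<^sub>m n n \<and> x + y = 0\<^sub>m n n"
    if "x \<in> carrier_mat n n" for x :: "'b mat"
    using that by (intro bexI[of _ "- x"]) auto
  have left: "(\<iota> c \<cdot>\<^sub>m A) * B = \<iota> c \<cdot>\<^sub>m (A * B)"
    if "A \<in> carrier_mat n n" "B \<in> carrier_mat n n" for c A B
    using that by (intro eq_matI) (auto simp: scalar_prod_def sum_distrib_left mult.assoc)
  have right: "A * (\<iota> c \<cdot>\<^sub>m B) = \<iota> c \<cdot>\<^sub>m (A * B)"
    if "A \<in> carrier_mat n n" "B \<in> carrier_mat n n" for c A B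
  proof -
    have "r * (\<iota> c * s) = \<iota> c * (r * s)" for r s
      by (metis central mult.assoc)
    then show ?thesis
      using that by (intro eq_matI) (auto simp: scalar_prod_def sum_distrib_left)
  qed
  show ?thesis
    using left right inv
    by unfold_locales
      (auto simp: mat_algebra_def Units_def assms(1-3) comm_add_mat assoc_add_mat[of _ n n]
        add_mult_distrib_mat[of _ n n] mult_add_distrib_mat[of _ n n] assoc_mult_mat[of _ n n _ n _ n]
        add_smult_distrib_right_mat[of _ n n] intro!: eq_matI simp: algebra_simps)
qed

lemma (in unital_algebra) unital_algebra_carrier_update:
  assumes sub: "B \<subseteq> carrier A" and one: "\<one> \<in> B"
    and add: "\<And>x y. x \<in> B \<Longrightarrow> y \<in> B \<Longrightarrow> x \<oplus> y \<in> B"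
    and mult: "\<And>x y. x \<in> B \<Longrightarrow> y \<in> B \<Longrightarrow> x \<otimes> y \<in> B"
    and smult: "\<And>c x. x \<in> B \<Longrightarrow> c \<odot> x \<in> B"
  shows "unital_algebra (A\<lparr>carrier := B\<rparr>)"
proof -
  have smult0: "0 \<odot> x = \<zero>" if "x \<in> carrier A" for x
  proof -
    have "0 \<odot> x \<oplus> 0 \<odot> x = 0 \<odot> x"
      using smult_add_left[OF that, of 0 0] by simp
    then show ?thesis
      using smult_closed[OF that, of 0] by (metis add.l_cancel_one)
  qed
  have zero: "\<zero> \<in> B"
    using smult0[of \<one>] smult[OF one, of 0] by simp
  have inv: "\<exists>y\<in>B. y \<oplus> x = \<zero> \<and> x \<oplus> y = \<zero>" if "x \<in> B" for x
  proof (intro bexI conjI)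
    have x: "x \<in> carrier A" using that sub by blast
    show "(- 1) \<odot> x \<oplus> x = \<zero>"
      using smult_add_left[OF x, of "- 1" 1] smult_one[OF x] smult0[OF x] by simp
    then show "x \<oplus> (- 1) \<odot> x = \<zero>"
      using x smult_closed[OF x] by (metis a_comm)
    show "(- 1) \<odot> x \<in> B" by (rule smult[OF that])
  qed
  have B: "x \<in> carrier A" if "x \<in> B" for x using that sub by blast
  show ?thesis
    using inv
    by unfold_locales
      (auto simp: B one zero add mult smult Units_def a_ac m_assoc l_distr r_distr
        smult_add_left smult_add_right smult_smult smult_one smult_mult_left smult_mult_right)
qed

lemma (in unital_algebra) unital_algebra_generated:
  assumes "S \<subseteq> carrier A"
  shows "unital_algebra (subalgebra_generated A S)"
proof -
  have "x \<in> carrier A" if "x \<in> generated_carrier A S" for x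
    using that by induction (use assms smult_closed in auto)
  then show ?thesis
    unfolding subalgebra_generated_def
    by (intro unital_algebra_carrier_update) (auto intro: generated_carrier.intros)
qed

lemma unital_algebra_UT2: "unital_algebra (UT2 :: ('k::field, 'k mat) module)"
proof -
  interpret unital_algebra "mat_algebra id 2 :: ('k, 'k mat) module"
    by (rule unital_algebra_mat) simp_all
  show ?thesis
    unfolding UT2_def
    by (rule unital_algebra_carrier_update)
      (auto simp: mat_algebra_def upper_triangular_def scalar_prod_def numeral_2_eq_2 less_Suc_eq)
qed

lemma super_const_hom:
  "super_const (c + d) = super_const c + super_const d"
  "super_const (c * d) = super_const c * super_const d"
  "super_const 1 = 1"
proof -
  show "super_const (c + d) = super_const c + super_const d"
    by (auto simp: super_const_def gcoeff_inject[symmetric] fun_eq_iff geven.rep_eq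
        plus_grassmann.rep_eq single_add)
  show "super_const (c * d) = super_const c * super_const d"
    by (auto simp: super_const_def gcoeff_inject[symmetric] fun_eq_iff gcoeff_geven_times
        geven.rep_eq mult_single)
  show "super_const 1 = 1"
    by (auto simp: super_const_def gcoeff_inject[symmetric] fun_eq_iff geven.rep_eq
        one_grassmann.rep_eq single_one)
qed

lemma unital_algebra_F: "unital_algebra (F_algebra :: ('k::field, 'k supercomm mat) module)"
proof -
  interpret unital_algebra "mat_algebra super_const 2 :: ('k, 'k supercomm mat) module"
    by (rule unital_algebra_mat) (simp_all add: super_const_hom, simp add: super_const_def geven_central)
  show ?thesis
    unfolding F_algebra_def
    by (rule unital_algebra_generated)
      (auto simp: mat_algebra_def C1_def C2_def mat_of_rows_list_def)
qed

end

theory Submission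
  imports Defs "HOL-Computational_Algebra.Polynomial" "HOL-Computational_Algebra.Primes"
begin

text \<open>In \<open>F\<close>, products of three commutators vanish and products of two commutators are central. Let
  \<open>I\<close> be the T-ideal of \<open>U\<close> and \<open>C\<close> the commutator ideal of the free algebra.

  If some \<open>f \<in> I\<close> is not an identity of \<open>UT\<^sub>2(K)\<close>, take upper triangular matrices with rows
  \<open>(a\<^sub>j, b\<^sub>j)\<close>, \<open>(0, d\<^sub>j)\<close> on which \<open>f\<close> does not vanish and substitute
  \<open>d\<^sub>j + (a\<^sub>j - d\<^sub>j) z + b\<^sub>j w\<close> with \<open>w \<in> C\<close> into \<open>f\<close>. The part linear in \<open>w\<close> is \<open>H(w)\<close>, where \<open>H\<close> is
  a nonzero polynomial in left and right multiplication by \<open>z\<close>. Rescaling and shifting \<open>z\<close> by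
  scalars turns \<open>H\<close> into a power of \<open>w \<mapsto> [w, z]\<close>. Hence, modulo products of two elements of \<open>C\<close>,
  long commutators lie in \<open>I\<close>, and then all proper polynomials of large degree do.

  Otherwise \<open>I\<close> consists of identities of \<open>UT\<^sub>2(K)\<close>, and it contains some \<open>f\<close> that is not an
  identity of \<open>F\<close>. The lowest terms of the entries of \<open>F\<close> show that \<open>f\<close> does not vanish on the matrices
  \<open>((a, b, t), (0, d, c), (0, 0, a))\<close> over \<open>K\<close>. The same substitution with a second summand
  \<open>c\<^sub>j w'\<close> puts all products of two commutators of large total degree into \<open>I\<close>. A proper identity of
  \<open>UT\<^sub>2(K)\<close> is a combination of such products: a homogeneous Lie element is recovered, up to its
  degree and modulo \<open>C\<^sup>2\<close>, from what it does to the first letter and to the multiset of the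
  remaining letters of each word, and this is what \<open>UT\<^sub>2(K)\<close> sees.\<close>

section \<open>Ideals and commutators\<close>

text \<open>The operators \<open>u |-> [u, z]\<close> commute only modulo \<open>C^2\<close>, which
  does not lie in \<open>I\<close>. The ideal \<open>almost_central\<close> bridges this gap: it
  contains \<open>C^2\<close>, and one further commutator, or one factor from \<open>C\<close>,
  carries it into \<open>I\<close>. Congruences modulo \<open>almost_central\<close> in low degree
  thus become congruences modulo \<open>I\<close> when letters are appended.

  The outer diagonal entries of the 3x3 matrices agree because a product of two elements of
  \<open>C\<close> is central: letters to the right of \<open>w'\<close> can be moved to the left of
  \<open>w\<close>, so both act by left multiplication, and only the letters in between multiply
  \<open>w\<close> from the right. The matrices arise from \<open>F\<close> by keeping the
  coefficients of \<open>1\<close>, \<open>y_1\<close>, \<open>y_1'\<close> and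
  \<open>y_1 y_1'\<close>.

  The recovery of a Lie element from \<open>UT2\<close> is a metabelian form of the
  Dynkin-Specht-Wever lemma: summing \<open>[x_i, x_j, ...]\<close> over all choices of the second
  letter \<open>x_j\<close> multiplies a Lie element of degree \<open>n\<close> by \<open>n\<close>,
  and \<open>n\<close> is invertible in characteristic \<open>0\<close>.\<close>

locale two_sided_ideal =
  fixes J :: "'r::ring_1 set"
  assumes zero_mem: "0 \<in> J"
    and add_mem: "a \<in> J \<Longrightarrow> b \<in> J \<Longrightarrow> a + b \<in> J"
    and mult_left_mem: "a \<in> J \<Longrightarrow> r * a \<in> J"
    and mult_right_mem: "a \<in> J \<Longrightarrow> a * r \<in> J"
begin

lemma uminus_mem: "a \<in> J \<Longrightarrow> - a \<in> J"
  using mult_left_mem[of a "- 1"] by simp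

lemma diff_mem: "a \<in> J \<Longrightarrow> b \<in> J \<Longrightarrow> a - b \<in> J"
  using add_mem[of a "- b"] uminus_mem by simp

lemma sum_mem: "(\<And>i. i \<in> S \<Longrightarrow> g i \<in> J) \<Longrightarrow> sum g S \<in> J"
  by (induction S rule: infinite_finite_induct) (auto intro: zero_mem add_mem)

lemma commutator_mem: "a \<in> J \<Longrightarrow> commutator a r \<in> J"
  unfolding commutator_def by (intro diff_mem mult_left_mem mult_right_mem)

lemma cong_mem: "a - b \<in> J \<Longrightarrow> a \<in> J \<longleftrightarrow> b \<in> J"
  using add_mem[of "a - b" b] diff_mem[of a "a - b"] by auto

lemma cong_trans: "a - b \<in> J \<Longrightarrow> b - c \<in> J \<Longrightarrow> a - c \<in> J"
  using add_mem[of "a - b" "b - c"] by simp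

end

inductive_set comm_ideal :: "'r::ring_1 set" where
  zero: "0 \<in> comm_ideal"
| add: "a \<in> comm_ideal \<Longrightarrow> b \<in> comm_ideal \<Longrightarrow> a + b \<in> comm_ideal"
| comm: "p * commutator a b * q \<in> comm_ideal"

lemma mult_comm_ideal: "a \<in> comm_ideal \<Longrightarrow> r * a * s \<in> comm_ideal"
proof (induction rule: comm_ideal.induct)
  case (comm p a b q)
  show ?case
    using comm_ideal.comm[of "r * p" a b "q * s"] by (simp add: mult.assoc)
qed (auto simp: algebra_simps intro: comm_ideal.intros)

interpretation CI: two_sided_ideal comm_ideal
proof
  fix a r :: 'a assume "a \<in> comm_ideal"
  then show "r * a \<in> comm_ideal" "a * r \<in> comm_ideal"
    using mult_comm_ideal[of a r 1] mult_comm_ideal[of a 1 r] by simp_all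
qed (auto intro: comm_ideal.intros)

lemma commutator_in_comm_ideal: "commutator a b \<in> comm_ideal"
  using comm_ideal.comm[of 1 a b 1] by simp

lemma commutator_add_left: "commutator (a + b) c = commutator a c + commutator b c"
  and commutator_add_right: "commutator a (b + c) = commutator a b + commutator a c"
  and commutator_diff_left: "commutator (a - b) c = commutator a c - commutator b c"
  and commutator_zero [simp]: "commutator 0 a = 0" "commutator a 0 = 0"
  by (simp_all add: commutator_def algebra_simps)

lemma commutator_mult_left: "commutator (a * b) c = a * commutator b c + commutator a c * b"
  by (simp add: commutator_def algebra_simps)

lemma jacobi: "commutator (commutator a b) c - commutator (commutator a c) b
    = commutator a (commutator b c)"
  by (simp add: commutator_def algebra_simps)

text \<open>Assumed for products of bare commutators only, the form in which \<open>F\<close>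
  supplies it; the lemmas below extend both conditions to all of \<open>comm_ideal\<close>.\<close>

locale mid_central_ideal = two_sided_ideal I for I :: "'r::ring_1 set" +
  assumes triple: "commutator a b * commutator c d * commutator e f \<in> I"
    and central: "commutator (commutator a b * commutator c d) e \<in> I"
begin

text \<open>Moving \<open>s\<close> to the front past \<open>[a, b]\<close> costs
  \<open>[[a, b], s]\<close>, which is again the first of three adjacent commutators.\<close>

lemma triple_gap1: "commutator a b * s * (commutator c d * commutator e f) \<in> I"
proof -
  have "commutator a b * s * (commutator c d * commutator e f)
      = s * (commutator a b * commutator c d * commutator e f)
        + commutator (commutator a b) s * commutator c d * commutator e f"
    by (simp add: commutator_def[of "commutator a b" s] algebra_simps)
  then show ?thesis by (simp add: add_mem mult_left_mem triple)
qed

lemma triple_gap2: "commutator a b * r * commutator c d * s * commutator e f \<in> I"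
proof -
  have "commutator a b * r * commutator c d * s * commutator e f
      = commutator a b * (r * s) * (commutator c d * commutator e f)
        + commutator a b * r * (commutator (commutator c d) s * commutator e f)"
    by (simp add: commutator_def[of "commutator c d" s] algebra_simps)
  then show ?thesis by (metis add_mem triple_gap1)
qed

lemma triple_comm_ideal:
  assumes "u \<in> comm_ideal" "v \<in> comm_ideal" "w \<in> comm_ideal"
  shows "u * v * w \<in> I"
  using assms(1)
proof (induction rule: comm_ideal.induct)
  case (comm p a b q)
  show ?case using assms(2)
  proof (induction rule: comm_ideal.induct)
    case (comm p' c d q')
    show ?case using assms(3)
    proof (induction rule: comm_ideal.induct)
      case (comm p'' e f q'')
      have "p * (commutator a b * (q * p') * commutator c d * (q' * p'') * commutator e f) * q'' \<in> I"
        by (intro mult_right_mem mult_left_mem triple_gap2)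
      then show ?case by (simp add: mult.assoc)
    qed (simp_all add: zero_mem add_mem distrib_left)
  qed (simp_all add: zero_mem add_mem distrib_left distrib_right)
qed (simp_all add: zero_mem add_mem distrib_right)

text \<open>With \<open>r\<close> moved to the front, \<open>[r x, z] = r [x, z] + [r, z] x\<close>
  for \<open>x = [a, b] [c, d]\<close>; the last term is a product of three commutators.\<close>

lemma central_gap: "commutator (commutator a b * r * commutator c d) z \<in> I"
proof -
  let ?x = "commutator a b * commutator c d"
  have "commutator a b * r * commutator c d = r * ?x + commutator (commutator a b) r * commutator c d"
    by (simp add: commutator_def[of "commutator a b" r] algebra_simps)
  moreover have "commutator (r * ?x) z \<in> I"
    unfolding commutator_mult_left[of r ?x z]
    by (simp add: add_mem mult_left_mem central triple flip: mult.assoc)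
  ultimately show ?thesis by (simp add: commutator_add_left add_mem central)
qed

lemma central_comm_ideal:
  assumes "u \<in> comm_ideal" "v \<in> comm_ideal"
  shows "commutator (u * v) z \<in> I"
  using assms(1)
proof (induction rule: comm_ideal.induct)
  case (comm p a b q)
  show ?case using assms(2)
  proof (induction rule: comm_ideal.induct)
    case (comm p' c d q')
    let ?y = "commutator a b * (q * p') * commutator c d"
    have "commutator (p * ?y * q') z
        = p * ?y * commutator q' z + (p * commutator ?y z + commutator p z * ?y) * q'"
      by (simp only: commutator_mult_left)
    moreover have "p * ?y * commutator q' z \<in> I"
      using triple_comm_ideal[of "p * commutator a b * (q * p')" "commutator c d" "commutator q' z"]
      by (simp add: mult.assoc commutator_in_comm_ideal CI.mult_left_mem CI.mult_right_mem)
    moreover have "commutator p z * ?y \<in> I"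
      using triple_comm_ideal[of "commutator p z" "commutator a b * (q * p')" "commutator c d"]
      by (simp add: mult.assoc commutator_in_comm_ideal CI.mult_left_mem CI.mult_right_mem)
    ultimately have "commutator (p * ?y * q') z \<in> I"
      using central_gap by (simp add: add_mem mult_left_mem mult_right_mem)
    then show ?case by (simp add: mult.assoc)
  qed (simp_all add: zero_mem add_mem distrib_left commutator_add_left)
qed (simp_all add: zero_mem add_mem distrib_right commutator_add_left)

end

lemma foldl_commutator_mem: "w \<in> comm_ideal \<Longrightarrow> foldl commutator w zs \<in> comm_ideal"
  by (induction zs arbitrary: w) (auto intro: CI.commutator_mem)

text \<open>Modulo such an ideal, the operators \<open>u \<mapsto> [u, z]\<close> commute on the commutator ideal.\<close>

locale square_ideal = two_sided_ideal J for J :: "'r::ring_1 set" +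
  assumes square: "u \<in> comm_ideal \<Longrightarrow> v \<in> comm_ideal \<Longrightarrow> u * v \<in> J"
begin

text \<open>By the Jacobi identity the difference is \<open>[u, [y, z]]\<close>, a difference of two
  products with both factors in \<open>comm_ideal\<close>.\<close>

lemma commutator_swap:
  assumes "u \<in> comm_ideal"
  shows "commutator (commutator u y) z - commutator (commutator u z) y \<in> J"
  unfolding jacobi commutator_def[of u "commutator y z"]
  by (intro diff_mem square assms commutator_in_comm_ideal)

lemma foldl_commutator_cong: "a - b \<in> J \<Longrightarrow> foldl commutator a zs - foldl commutator b zs \<in> J"
proof (induction zs arbitrary: a b)
  case (Cons z zs)
  have "commutator a z - commutator b z \<in> J"
    using commutator_mem[OF Cons.prems, of z] by (simp add: commutator_diff_left)
  then show ?case using Cons.IH by simp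
qed simp

lemma foldl_commutator_move:
  assumes "u \<in> comm_ideal"
  shows "foldl commutator (commutator u z) zs - commutator (foldl commutator u zs) z \<in> J"
  using assms
proof (induction zs arbitrary: u)
  case (Cons y zs)
  have 1: "foldl commutator (commutator (commutator u z) y) zs
      - foldl commutator (commutator (commutator u y) z) zs \<in> J"
    by (intro foldl_commutator_cong commutator_swap Cons.prems)
  have 2: "foldl commutator (commutator (commutator u y) z) zs
      - commutator (foldl commutator (commutator u y) zs) z \<in> J"
    by (intro Cons.IH CI.commutator_mem Cons.prems)
  from cong_trans[OF 1 2] show ?case by simp
qed (simp add: zero_mem)

end

section \<open>Extraction of coefficients\<close>

text \<open>Scalars act through a central homomorphism, so that the same calculations serve the
  field itself, the free algebra, polynomial rings and supermatrices.\<close>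

locale scalar_hom =
  fixes \<iota> :: "'k::field_char_0 \<Rightarrow> 'r::ring_1"
  assumes hom_add: "\<iota> (c + d) = \<iota> c + \<iota> d"
    and hom_mult: "\<iota> (c * d) = \<iota> c * \<iota> d"
    and hom_one: "\<iota> 1 = 1"
    and hom_central: "\<iota> c * r = r * \<iota> c"
begin

lemma hom_zero: "\<iota> 0 = 0"
  using hom_add[of 0 0] by simp

lemma hom_uminus: "\<iota> (- c) = - \<iota> c"
  using hom_add[of c "- c"] hom_zero by (simp add: eq_neg_iff_add_eq_0 add.commute)

lemma hom_diff: "\<iota> (c - d) = \<iota> c - \<iota> d"
  using hom_add[of c "- d"] by (simp add: hom_uminus)

lemma hom_sum: "\<iota> (sum g S) = (\<Sum>i\<in>S. \<iota> (g i))"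
  by (induction S rule: infinite_finite_induct) (simp_all add: hom_zero hom_add)

lemma hom_left_commute: "a * (\<iota> c * b) = \<iota> c * (a * b)"
  by (metis hom_central mult.assoc)

lemma commutator_scalar_left: "commutator (\<iota> c * a) b = \<iota> c * commutator a b"
  by (simp add: commutator_def hom_left_commute right_diff_distrib mult.assoc)

lemma commutator_scalar_right: "commutator a (\<iota> c * b) = \<iota> c * commutator a b"
  by (simp add: commutator_def hom_left_commute right_diff_distrib mult.assoc)

lemma commutator_of_scalar: "commutator a (\<iota> c) = 0"
  by (simp add: commutator_def hom_central)

end

locale scalar_ideal = scalar_hom \<iota> + two_sided_ideal J
  for \<iota> :: "'k::field_char_0 \<Rightarrow> 'r::ring_1" and J :: "'r set"
begin

lemma scalar_cancel:
  assumes "\<iota> c * a \<in> J" "c \<noteq> 0"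
  shows "a \<in> J"
proof -
  have "\<iota> (inverse c) * (\<iota> c * a) = a"
    using assms(2) by (simp flip: mult.assoc hom_mult add: hom_one)
  then show ?thesis using mult_left_mem[OF assms(1), of "\<iota> (inverse c)"] by simp
qed

text \<open>Comparing the values at \<open>2t\<close> and \<open>t\<close> eliminates the leading coefficient.\<close>

lemma coeff_extract:
  assumes "\<And>t. (\<Sum>i\<le>n. \<iota> (t ^ i) * p i) \<in> J" "i \<le> n"
  shows "p i \<in> J"
  using assms
proof (induction n arbitrary: p i)
  case 0
  then show ?case using 0(1)[of 0] by (simp add: hom_one)
next
  case (Suc n)
  have small: "p i \<in> J" if i: "i \<le> n" for i
  proof -
    have "(\<Sum>i\<le>n. \<iota> (t ^ i) * (\<iota> (2 ^ i - 2 ^ Suc n) * p i)) \<in> J" for t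
    proof -
      have "(\<Sum>i\<le>n. \<iota> (t ^ i) * (\<iota> (2 ^ i - 2 ^ Suc n) * p i))
          = (\<Sum>i\<le>Suc n. \<iota> (t ^ i) * (\<iota> (2 ^ i - 2 ^ Suc n) * p i))"
        by (simp only: sum.atMost_Suc diff_self hom_zero mult_zero_left mult_zero_right add_0_right)
      also have "\<dots> = (\<Sum>i\<le>Suc n. \<iota> ((2 * t) ^ i) * p i)
          - \<iota> (2 ^ Suc n) * (\<Sum>i\<le>Suc n. \<iota> (t ^ i) * p i)"
        unfolding sum_distrib_left sum_subtractf[symmetric]
      proof (intro sum.cong refl)
        fix i
        have "\<iota> (t ^ i) * \<iota> (2 ^ i - 2 ^ Suc n) = \<iota> ((2 * t) ^ i) - \<iota> (2 ^ Suc n) * \<iota> (t ^ i)"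
          unfolding hom_mult[symmetric] hom_diff[symmetric]
          by (rule arg_cong[of _ _ \<iota>]) (simp add: algebra_simps power_mult_distrib)
        then show "\<iota> (t ^ i) * (\<iota> (2 ^ i - 2 ^ Suc n) * p i)
            = \<iota> ((2 * t) ^ i) * p i - \<iota> (2 ^ Suc n) * (\<iota> (t ^ i) * p i)"
          by (simp only: mult.assoc[symmetric] left_diff_distrib)
      qed
      moreover have "\<dots> \<in> J" by (intro diff_mem mult_left_mem Suc.prems(1))
      ultimately show ?thesis by simp
    qed
    then have "\<iota> (2 ^ i - 2 ^ Suc n) * p i \<in> J"
      using Suc.IH[of "\<lambda>i. \<iota> (2 ^ i - 2 ^ Suc n) * p i" i] i by blast
    \<comment> \<open>Powers of \<open>2\<close> are distinct in characteristic \<open>0\<close>, so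
      the factor left on \<open>p i\<close> is invertible.\<close>
    moreover have "(2::'k) ^ i \<noteq> 2 ^ Suc n"
    proof
      assume "(2::'k) ^ i = 2 ^ Suc n"
      then have "of_nat (2 ^ i) = (of_nat (2 ^ Suc n) :: 'k)" by simp
      then have "(2::nat) ^ i = 2 ^ Suc n" by (simp only: of_nat_eq_iff)
      then show False using i by (simp del: power_Suc)
    qed
    ultimately show ?thesis using scalar_cancel by simp
  qed
  moreover have "p (Suc n) = (\<Sum>i\<le>Suc n. \<iota> (1 ^ i) * p i) - (\<Sum>i\<le>n. p i)"
    by (simp add: hom_one)
  ultimately have "p (Suc n) \<in> J"
    using Suc.prems(1)[of 1] by (metis atMost_iff diff_mem sum_mem)
  with small Suc.prems(2) show ?case by (cases "i = Suc n") auto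
qed

end

locale scalar_square_ideal = scalar_ideal \<iota> J + square_ideal J
  for \<iota> :: "'k::field_char_0 \<Rightarrow> 'r::ring_1" and J :: "'r set"
begin

text \<open>The coefficient of \<open>t\<close> is a sum of \<open>Suc j\<close> terms, one for each
  position of \<open>y\<close>; they agree modulo \<open>J\<close> because the operators commute
  there. The coefficient \<open>p 0\<close> is carried along because it feeds \<open>p 1\<close> in
  the induction.\<close>

lemma power_commutator_expand:
  assumes "u \<in> comm_ideal"
  shows "\<exists>p. (\<forall>t. ((\<lambda>x. commutator x (z + \<iota> t * y)) ^^ Suc j) u = (\<Sum>k\<le>Suc j. \<iota> (t ^ k) * p k))
    \<and> p 0 = ((\<lambda>x. commutator x z) ^^ Suc j) u
    \<and> p 1 - of_nat (Suc j) * ((\<lambda>x. commutator x z) ^^ j) (commutator u y) \<in> J"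
proof (induction j)
  case 0
  show ?case
    by (rule exI[of _ "\<lambda>k. if k = 0 then commutator u z else commutator u y"])
      (simp add: hom_one commutator_add_right commutator_scalar_right zero_mem)
next
  case (Suc j)
  let ?D = "\<lambda>x. commutator x z"
  obtain p where p: "\<And>t. ((\<lambda>x. commutator x (z + \<iota> t * y)) ^^ Suc j) u
        = (\<Sum>k\<le>Suc j. \<iota> (t ^ k) * p k)"
    and p0: "p 0 = (?D ^^ Suc j) u"
    and p1: "p 1 - of_nat (Suc j) * (?D ^^ j) (commutator u y) \<in> J"
    using Suc.IH by blast
  define q where "q k = (if k \<le> Suc j then commutator (p k) z else 0)
      + (if k = 0 then 0 else commutator (p (k - 1)) y)" for k
  have D: "commutator (sum g S) x = (\<Sum>i\<in>S. commutator (g i) x)" for g :: "nat \<Rightarrow> 'r" and S x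
    by (induction S rule: infinite_finite_induct) (simp_all add: commutator_add_left)
  have "((\<lambda>x. commutator x (z + \<iota> t * y)) ^^ Suc (Suc j)) u
      = (\<Sum>k\<le>Suc (Suc j). \<iota> (t ^ k) * q k)" for t
  proof -
    have "((\<lambda>x. commutator x (z + \<iota> t * y)) ^^ Suc (Suc j)) u
       = commutator (\<Sum>k\<le>Suc j. \<iota> (t ^ k) * p k) (z + \<iota> t * y)"
      using p[of t] by simp
    also have "\<dots> = (\<Sum>k\<le>Suc j. \<iota> (t ^ k) * commutator (p k) z)
        + (\<Sum>k\<le>Suc j. \<iota> (t ^ Suc k) * commutator (p k) y)"
      unfolding D sum.distrib[symmetric] commutator_scalar_left
      by (simp only: commutator_add_right commutator_scalar_right distrib_left power_Suc2
          hom_mult mult.assoc)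
    also have "(\<Sum>k\<le>Suc j. \<iota> (t ^ k) * commutator (p k) z)
        = (\<Sum>k\<le>Suc (Suc j). \<iota> (t ^ k) * (if k \<le> Suc j then commutator (p k) z else 0))"
      by simp
    also have "(\<Sum>k\<le>Suc j. \<iota> (t ^ Suc k) * commutator (p k) y)
        = (\<Sum>k\<le>Suc (Suc j). \<iota> (t ^ k) * (if k = 0 then 0 else commutator (p (k - 1)) y))"
      unfolding sum.atMost_Suc_shift[of _ "Suc j"] by simp
    finally show ?thesis unfolding q_def distrib_left sum.distrib .
  qed
  moreover have "q 0 = (?D ^^ Suc (Suc j)) u" by (simp add: q_def p0)
  moreover have "q 1 - of_nat (Suc (Suc j)) * (?D ^^ Suc j) (commutator u y) \<in> J"
  proof -
    let ?e = "(?D ^^ j) (commutator u y)"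
    have foldl: "(?D ^^ n) x = foldl commutator x (replicate n z)" for n x
      by (induction n arbitrary: x) (simp_all add: funpow_Suc_right del: funpow.simps(2))
    have "foldl commutator (commutator u y) (replicate (Suc j) z)
        - commutator (foldl commutator u (replicate (Suc j) z)) y \<in> J"
      by (rule foldl_commutator_move[OF assms])
    then have a: "commutator (p 0) y - commutator ?e z \<in> J"
      unfolding p0 foldl[symmetric] using uminus_mem by fastforce
    have "commutator (p 1 - of_nat (Suc j) * ?e) z = commutator (p 1) z - of_nat (Suc j) * commutator ?e z"
      by (simp add: commutator_def algebra_simps mult_of_nat_commute)
    then have b: "commutator (p 1) z - of_nat (Suc j) * commutator ?e z \<in> J"
      using commutator_mem[OF p1, of z] by simp
    have "q 1 - of_nat (Suc (Suc j)) * commutator ?e z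
       = (commutator (p 1) z - of_nat (Suc j) * commutator ?e z) + (commutator (p 0) y - commutator ?e z)"
      by (simp add: q_def algebra_simps)
    then show ?thesis using add_mem[OF b a] by simp
  qed
  ultimately show ?case by blast
qed

text \<open>Linearization: replacing \<open>z\<close> by \<open>z + t y\<close> and taking the
  coefficient of \<open>t\<close> turns one factor of a power into a free letter
  \<open>y\<close>.\<close>

lemma polarize:
  assumes pow: "\<And>z w. w \<in> comm_ideal \<Longrightarrow> ((\<lambda>x. commutator x z) ^^ m) w \<in> J"
    and w: "w \<in> comm_ideal" and "length zs = m"
  shows "foldl commutator w zs \<in> J"
proof -
  \<comment> \<open>This interpolates between the hypothesis (\<open>zs\<close> empty,
    \<open>j = m\<close>) and the claim (\<open>j = 0\<close>); each step trades one factor of the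
    power for the last letter of the list.\<close>
  have "((\<lambda>x. commutator x z) ^^ j) (foldl commutator w zs) \<in> J"
    if "length zs + j = m" for z zs j
    using that
  proof (induction zs arbitrary: j z rule: rev_induct)
    case Nil
    then show ?case using pow w by simp
  next
    case (snoc y zs)
    let ?u = "foldl commutator w zs"
    have u: "?u \<in> comm_ideal" using w by (rule foldl_commutator_mem)
    obtain p where p: "\<And>t. ((\<lambda>x. commutator x (z + \<iota> t * y)) ^^ Suc j) ?u
        = (\<Sum>k\<le>Suc j. \<iota> (t ^ k) * p k)"
      and p1: "p 1 - of_nat (Suc j) * ((\<lambda>x. commutator x z) ^^ j) (commutator ?u y) \<in> J"
      using power_commutator_expand[OF u] by blast
    have "p 1 \<in> J"
    proof (rule coeff_extract)
      show "(\<Sum>k\<le>Suc j. \<iota> (t ^ k) * p k) \<in> J" for t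
        using snoc.IH[of "Suc j" "z + \<iota> t * y"] snoc.prems unfolding p by simp
    qed simp
    then have "of_nat (Suc j) * ((\<lambda>x. commutator x z) ^^ j) (commutator ?u y) \<in> J"
      using cong_mem[OF p1] by blast
    moreover have "\<iota> (of_nat n) = of_nat n" for n
      by (induction n) (simp_all add: hom_zero hom_add hom_one)
    ultimately have "((\<lambda>x. commutator x z) ^^ j) (commutator ?u y) \<in> J"
      by (metis scalar_cancel of_nat_neq_0)
    then show ?case by simp
  qed
  from this[of zs 0] show ?thesis using assms(3) by simp
qed

end

section \<open>Two-variable polynomials acting on the commutator ideal\<close>

text \<open>The outer variable \<open>\<alpha>\<close> acts as left multiplication by \<open>z\<close> and the inner variable \<open>s\<close> as
  \<open>u \<mapsto> [u, z]\<close>, so that right multiplication by \<open>z\<close> is \<open>\<alpha> + s\<close>.\<close>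

context scalar_hom
begin

definition inner_act :: "'r \<Rightarrow> 'k poly \<Rightarrow> 'r \<Rightarrow> 'r" where
  "inner_act z q w = (\<Sum>i\<le>degree q. \<iota> (coeff q i) * ((\<lambda>u. commutator u z) ^^ i) w)"

definition act :: "'r \<Rightarrow> 'k poly poly \<Rightarrow> 'r \<Rightarrow> 'r" where
  "act z H w = (\<Sum>l\<le>degree H. z ^ l * inner_act z (coeff H l) w)"

lemma inner_act_bound:
  assumes "degree q \<le> n"
  shows "inner_act z q w = (\<Sum>i\<le>n. \<iota> (coeff q i) * ((\<lambda>u. commutator u z) ^^ i) w)"
  unfolding inner_act_def using assms
  by (intro sum.mono_neutral_left) (auto simp: coeff_eq_0 hom_zero)

lemma inner_act_0 [simp]: "inner_act z 0 w = 0"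
  by (simp add: inner_act_def hom_zero)

lemma act_bound:
  assumes "degree H \<le> n"
  shows "act z H w = (\<Sum>l\<le>n. z ^ l * inner_act z (coeff H l) w)"
  unfolding act_def using assms
  by (intro sum.mono_neutral_left) (auto simp: coeff_eq_0)

lemma commutator_sum_left: "commutator (sum g S) x = (\<Sum>i\<in>S. commutator (g i) x)"
  by (induction S rule: infinite_finite_induct) (simp_all add: commutator_add_left)

lemma inner_act_pCons: "inner_act z (pCons c q) w = \<iota> c * w + commutator (inner_act z q w) z"
proof -
  have "inner_act z (pCons c q) w
      = (\<Sum>i\<le>Suc (degree q). \<iota> (coeff (pCons c q) i) * ((\<lambda>u. commutator u z) ^^ i) w)"
    by (rule inner_act_bound) (rule degree_pCons_le)
  then show ?thesis
    unfolding sum.atMost_Suc_shift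
    by (simp add: inner_act_def commutator_sum_left commutator_scalar_left)
qed

lemma act_pCons: "act z (pCons q H) w = inner_act z q w + z * act z H w"
proof -
  have "act z (pCons q H) w = (\<Sum>l\<le>Suc (degree H). z ^ l * inner_act z (coeff (pCons q H) l) w)"
    by (rule act_bound) (rule degree_pCons_le)
  then show ?thesis
    unfolding sum.atMost_Suc_shift by (simp add: act_def sum_distrib_left mult.assoc)
qed

lemma act_0 [simp]: "act z 0 w = 0"
  by (simp add: act_def)

lemma inner_act_add: "inner_act z (p + q) w = inner_act z p w + inner_act z q w"
  by (induction p q rule: poly_induct2)
    (simp_all add: inner_act_pCons hom_add algebra_simps commutator_add_left)

lemma act_add: "act z (G + H) w = act z G w + act z H w"
  by (induction G H rule: poly_induct2)
    (simp_all add: act_pCons inner_act_add algebra_simps)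

lemma inner_act_smult: "inner_act z (smult c q) w = \<iota> c * inner_act z q w"
  by (induction q)
    (simp_all add: inner_act_pCons hom_mult mult.assoc distrib_left commutator_scalar_left)

text \<open>Left and right multiplication by \<open>z\<close> commute with
  \<open>u |-> [u, z]\<close> exactly, so the calculus of \<open>act\<close> involves no
  congruences.\<close>

lemma inner_act_left: "inner_act z q (z * w) = z * inner_act z q w"
proof (induction q)
  case (pCons c q)
  have "commutator (z * u) z = z * commutator u z" for u
    by (simp add: commutator_def algebra_simps)
  with pCons show ?case by (simp add: inner_act_pCons distrib_left hom_left_commute)
qed simp

lemma inner_act_right: "inner_act z q (w * z) = inner_act z q w * z"
proof (induction q)
  case (pCons c q)
  have "commutator (u * z) z = commutator u z * z" for u
    by (simp add: commutator_def algebra_simps)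
  with pCons show ?case by (simp add: inner_act_pCons distrib_right mult.assoc)
qed simp

lemma act_left: "act z H (z * w) = z * act z H w"
  by (induction H) (simp_all add: act_pCons inner_act_left distrib_left)

lemma act_right: "act z H (w * z) = act z H w * z"
  by (induction H) (simp_all add: act_pCons inner_act_right distrib_right mult.assoc)

lemma act_smult_const: "act z (smult [:c:] H) w = \<iota> c * act z H w"
  by (induction H) (simp_all add: act_pCons inner_act_smult distrib_left hom_left_commute)

lemma act_smult_inner: "act z (smult [:0, 1:] H) w = commutator (act z H w) z"
proof (induction H)
  case (pCons q H)
  have "commutator (z * u) z = z * commutator u z" for u
    by (simp add: commutator_def algebra_simps)
  with pCons show ?case by (simp add: act_pCons inner_act_pCons commutator_add_left hom_zero)
qed simp

lemma inner_act_add_arg: "inner_act z q (v + w) = inner_act z q v + inner_act z q w"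
  by (induction q) (simp_all add: inner_act_pCons commutator_add_left algebra_simps)

lemma inner_act_scalar_arg: "inner_act z q (\<iota> c * w) = \<iota> c * inner_act z q w"
proof (induction q)
  case (pCons d q)
  have "\<iota> d * (\<iota> c * w) = \<iota> c * (\<iota> d * w)" by (rule hom_left_commute)
  with pCons show ?case by (simp add: inner_act_pCons commutator_scalar_left distrib_left)
qed simp

lemma act_add_arg: "act z H (v + w) = act z H v + act z H w"
  by (induction H) (simp_all add: act_pCons inner_act_add_arg algebra_simps)

lemma act_scalar_arg: "act z H (\<iota> c * w) = \<iota> c * act z H w"
  by (induction H) (simp_all add: act_pCons inner_act_scalar_arg distrib_left hom_left_commute)

definition line :: "'r \<Rightarrow> 'k \<Rightarrow> 'k \<Rightarrow> 'r" where
  "line z l m = \<iota> l + \<iota> m * z"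

definition left_line :: "'k \<Rightarrow> 'k \<Rightarrow> 'k poly poly" where
  "left_line l m = [:[:l:], [:m:]:]"

text \<open>This is \<open>l + m (\<alpha> + s)\<close>, as right multiplication by \<open>z\<close>
  is \<open>\<alpha> + s\<close>.\<close>

definition right_line :: "'k \<Rightarrow> 'k \<Rightarrow> 'k poly poly" where
  "right_line l m = [:[:l, m:], [:m:]:]"

lemma act_left_line: "act z (left_line l m * H) w = line z l m * act z H w"
proof -
  have "left_line l m * H = smult [:l:] H + pCons 0 (smult [:m:] H)"
    by (simp add: left_line_def)
  then show ?thesis
    by (simp add: act_add act_smult_const act_pCons line_def distrib_right mult.assoc hom_left_commute)
qed

lemma act_right_line': "act z H (w * line z l m) = act z H w * line z l m"
proof -
  have "w * line z l m = \<iota> l * w + \<iota> m * (w * z)" for w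
    unfolding line_def distrib_left by (simp add: hom_central mult.assoc flip: hom_left_commute)
  then show ?thesis by (simp add: act_add_arg act_scalar_arg act_right)
qed

text \<open>The factor is placed on the argument because \<open>second_order_terms_aux\<close>
  absorbs letters into \<open>u\<close> before the operator acts.\<close>

lemma act_right_line: "act z (right_line l m * H) w = act z H (w * line z l m)"
proof -
  have "right_line l m * H = smult [:l:] H + smult [:m:] (smult [:0, 1:] H) + pCons 0 (smult [:m:] H)"
    by (simp add: right_line_def flip: smult_add_left)
  then have "act z (right_line l m * H) w
      = \<iota> l * act z H w + \<iota> m * commutator (act z H w) z + z * (\<iota> m * act z H w)"
    by (simp only: act_add act_smult_const act_smult_inner act_pCons inner_act_0 add_0_left)
  also have "\<dots> = act z H w * line z l m"
    by (simp add: commutator_def line_def hom_left_commute[of z] hom_central[of l]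
        hom_left_commute[of _ m z] algebra_simps)
  finally show ?thesis by (simp add: act_right_line')
qed

end

context scalar_square_ideal
begin

text \<open>The power \<open>u^n\<close> comes only from \<open>(z + u)^n\<close>, so its
  coefficient is \<open>r n\<close>, free of \<open>z\<close>.\<close>

lemma shift_top:
  "\<exists>p. (\<forall>u. (\<Sum>l\<le>n. (z + \<iota> u) ^ l * r l) = (\<Sum>k\<le>n. \<iota> (u ^ k) * p k)) \<and> p n = r n"
proof (induction n arbitrary: r)
  case 0
  show ?case by (rule exI[of _ r]) (simp add: hom_one)
next
  case (Suc n)
  obtain p where p: "\<And>u. (\<Sum>l\<le>n. (z + \<iota> u) ^ l * r (Suc l)) = (\<Sum>k\<le>n. \<iota> (u ^ k) * p k)"
    and pn: "p n = r (Suc n)"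
    using Suc.IH[of "\<lambda>l. r (Suc l)"] by blast
  define q where "q k = (if k = 0 then r 0 else 0) + (if k \<le> n then z * p k else 0)
      + (if k = 0 then 0 else p (k - 1))" for k
  have "(\<Sum>l\<le>Suc n. (z + \<iota> u) ^ l * r l) = (\<Sum>k\<le>Suc n. \<iota> (u ^ k) * q k)" for u
  proof -
    have "(\<Sum>l\<le>Suc n. (z + \<iota> u) ^ l * r l)
        = r 0 + (z + \<iota> u) * (\<Sum>l\<le>n. (z + \<iota> u) ^ l * r (Suc l))"
      unfolding sum.atMost_Suc_shift by (simp add: sum_distrib_left mult.assoc)
    also have "\<dots> = r 0 + (\<Sum>k\<le>n. \<iota> (u ^ k) * (z * p k)) + (\<Sum>k\<le>n. \<iota> (u ^ Suc k) * p k)"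
      unfolding p distrib_right sum_distrib_left
      by (simp add: hom_left_commute[of z] hom_mult mult.assoc sum.distrib)
    also have "(\<Sum>k\<le>n. \<iota> (u ^ k) * (z * p k))
        = (\<Sum>k\<le>Suc n. \<iota> (u ^ k) * (if k \<le> n then z * p k else 0))" by simp
    also have "(\<Sum>k\<le>n. \<iota> (u ^ Suc k) * p k)
        = (\<Sum>k\<le>Suc n. \<iota> (u ^ k) * (if k = 0 then 0 else p (k - 1)))"
      unfolding sum.atMost_Suc_shift[of _ n] by simp
    also have "r 0 = (\<Sum>k\<le>Suc n. \<iota> (u ^ k) * (if k = 0 then r 0 else 0))"
      unfolding sum.atMost_Suc_shift[of _ n] by (simp add: hom_one)
    finally show ?thesis unfolding q_def distrib_left sum.distrib .
  qed
  moreover have "q (Suc n) = r (Suc n)" by (simp add: q_def pn)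
  ultimately show ?case by blast
qed

text \<open>Replacing \<open>z\<close> by \<open>z + u\<close> with \<open>u\<close> a scalar isolates the leading coefficient in \<open>\<alpha>\<close>; replacing
  \<open>z\<close> by \<open>t z\<close> then isolates a power of \<open>s\<close>.\<close>

lemma long_commutators_mem:
  assumes H: "\<And>z w. w \<in> comm_ideal \<Longrightarrow> act z H w \<in> J" and "H \<noteq> 0"
  obtains m where "\<And>w zs. w \<in> comm_ideal \<Longrightarrow> length zs = m \<Longrightarrow> foldl commutator w zs \<in> J"
proof
  define q where "q = lead_coeff H"
  have "q \<noteq> 0" using assms(2) by (simp add: q_def)
  have inner: "inner_act z q w \<in> J" if w: "w \<in> comm_ideal" for z w
  proof -
    \<comment> \<open>A scalar shift of \<open>z\<close> does not change the operator
      \<open>[., z]\<close>, hence no inner action.\<close>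
    have D: "(\<lambda>x. commutator x (z + \<iota> u)) = (\<lambda>x. commutator x z)" for u
      by (simp add: commutator_add_right commutator_of_scalar)
    obtain p where p: "\<And>u. (\<Sum>l\<le>degree H. (z + \<iota> u) ^ l * inner_act z (coeff H l) w)
          = (\<Sum>k\<le>degree H. \<iota> (u ^ k) * p k)"
      and "p (degree H) = inner_act z q w"
      using shift_top[where n = "degree H" and z = z and r = "\<lambda>l. inner_act z (coeff H l) w"] unfolding q_def by blast
    moreover have "p (degree H) \<in> J"
    proof (rule coeff_extract)
      show "(\<Sum>k\<le>degree H. \<iota> (u ^ k) * p k) \<in> J" for u
        using H[OF w, of "z + \<iota> u"] unfolding act_def inner_act_def D p[symmetric] .
    qed simp
    ultimately show ?thesis by simp
  qed
  have power: "((\<lambda>x. commutator x z) ^^ degree q) w \<in> J" if w: "w \<in> comm_ideal" for z w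
  proof -
    have pow: "((\<lambda>x. commutator x (\<iota> t * z)) ^^ i) w = \<iota> (t ^ i) * ((\<lambda>x. commutator x z) ^^ i) w" for t i
      by (induction i)
        (simp_all add: hom_one commutator_scalar_right commutator_scalar_left hom_mult mult.assoc)
    have "\<iota> (coeff q (degree q)) * ((\<lambda>x. commutator x z) ^^ degree q) w \<in> J"
    proof (rule coeff_extract[where n = "degree q" and i = "degree q" and p = "\<lambda>i. \<iota> (coeff q i) * ((\<lambda>x. commutator x z) ^^ i) w"])
      show "(\<Sum>i\<le>degree q. \<iota> (t ^ i) * (\<iota> (coeff q i) * ((\<lambda>x. commutator x z) ^^ i) w)) \<in> J" for t
        using inner[OF w, of "\<iota> t * z"] unfolding inner_act_def pow
        by (subst hom_left_commute)
    qed simp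
    then show ?thesis using \<open>q \<noteq> 0\<close> by (metis leading_coeff_0_iff scalar_cancel)
  qed
  show "foldl commutator w zs \<in> J" if "w \<in> comm_ideal" "length zs = degree q" for w zs
    by (rule polarize[OF power]) (use that in auto)
qed

end

section \<open>First- and second-order terms of a substitution\<close>

text \<open>Entries of a product of upper triangular matrices: \<open>path1\<close> is the entry \<open>(1,2)\<close> for the
  matrices \<open>((a, b), (0, d))\<close>, and \<open>path2\<close> is the entry \<open>(1,3)\<close> for the matrices
  \<open>((a, b, 0), (0, d, c), (0, 0, e))\<close>.\<close>

primrec path1 :: "(nat \<Rightarrow> 'r::comm_ring_1) \<Rightarrow> (nat \<Rightarrow> 'r) \<Rightarrow> (nat \<Rightarrow> 'r) \<Rightarrow> nat list \<Rightarrow> 'r" where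
  "path1 a b d [] = 0"
| "path1 a b d (j # v) = a j * path1 a b d v + b j * prod_list (map d v)"

primrec path2 :: "(nat \<Rightarrow> 'r::comm_ring_1) \<Rightarrow> (nat \<Rightarrow> 'r) \<Rightarrow> (nat \<Rightarrow> 'r) \<Rightarrow> (nat \<Rightarrow> 'r) \<Rightarrow> (nat \<Rightarrow> 'r)
    \<Rightarrow> nat list \<Rightarrow> 'r" where
  "path2 a b d c e [] = 0"
| "path2 a b d c e (j # v) = a j * path2 a b d c e v + b j * path1 d c e v"

lemma prod_list_diff_mem:
  assumes "\<And>j. x j - y j \<in> comm_ideal"
  shows "prod_list (map x v) - prod_list (map y v) \<in> comm_ideal"
proof (induction v)
  case (Cons j v)
  have "prod_list (map x (j # v)) - prod_list (map y (j # v))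
      = x j * (prod_list (map x v) - prod_list (map y v)) + (x j - y j) * prod_list (map y v)"
    by (simp add: algebra_simps)
  then show ?case using Cons assms by (metis CI.add_mem CI.mult_left_mem CI.mult_right_mem)
qed (simp add: comm_ideal.zero)

context scalar_hom
begin

lemma act_1: "act z 1 w = w"
  by (simp add: one_pCons act_pCons inner_act_pCons hom_one)

lemma act_left_lines:
  "act z (prod_list (map (\<lambda>j. left_line (l j) (m j)) v)) w = prod_list (map (\<lambda>j. line z (l j) (m j)) v) * w"
  by (induction v) (simp_all add: act_1 act_left_line mult.assoc)

lemma act_right_lines:
  "act z (prod_list (map (\<lambda>j. right_line (l j) (m j)) v)) w = w * prod_list (map (\<lambda>j. line z (l j) (m j)) v)"
  by (induction v arbitrary: w) (simp_all add: act_1 act_right_line mult.assoc)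

lemma scalar_comm_ideal: "w \<in> comm_ideal \<Longrightarrow> \<iota> c * w \<in> comm_ideal"
  by (rule CI.mult_left_mem)

end

text \<open>Letters before \<open>w\<close> act from the left and letters after it from the right,
  as in the \<open>(1,2)\<close> entry of a triangular product. Peeling off a letter leaves the
  error \<open>b_j w (P - Q)\<close> with \<open>P - Q\<close> in \<open>comm_ideal\<close>, which
  lies in \<open>J\<close>.\<close>

lemma (in scalar_square_ideal) first_order_terms:
  fixes z :: 'r and l m b :: "nat \<Rightarrow> 'k"
  assumes w: "w \<in> comm_ideal"
  defines "\<zeta> \<equiv> \<lambda>j. line z (l j) (m j)"
  shows "prod_list (map (\<lambda>j. \<zeta> j + \<iota> (b j) * w) v) - prod_list (map \<zeta> v)
    - act z (path1 (\<lambda>j. left_line (l j) (m j)) (\<lambda>j. [:[:b j:]:]) (\<lambda>j. right_line (l j) (m j)) v) w \<in> J"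
proof (induction v)
  case (Cons j v)
  let ?P = "prod_list (map (\<lambda>j. \<zeta> j + \<iota> (b j) * w) v)" and ?Q = "prod_list (map \<zeta> v)"
  let ?X = "path1 (\<lambda>j. left_line (l j) (m j)) (\<lambda>j. [:[:b j:]:]) (\<lambda>j. right_line (l j) (m j)) v"
  let ?d = "prod_list (map (\<lambda>j. right_line (l j) (m j)) v)"
  have "?P - ?Q \<in> comm_ideal"
    by (rule prod_list_diff_mem) (simp add: w scalar_comm_ideal)
  then have "\<iota> (b j) * (w * (?P - ?Q)) \<in> J"
    by (intro mult_left_mem square w)
  then have "\<zeta> j * (?P - ?Q - act z ?X w) + \<iota> (b j) * (w * (?P - ?Q)) \<in> J"
    by (rule add_mem[OF mult_left_mem[OF Cons.IH]])
  moreover have "act z (left_line (l j) (m j) * ?X + [:[:b j:]:] * ?d) w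
      = \<zeta> j * act z ?X w + \<iota> (b j) * (w * ?Q)"
    by (simp add: act_add act_left_line act_smult_const act_right_lines \<zeta>_def)
  ultimately show ?case by (simp add: algebra_simps)
qed (simp add: zero_mem)

locale scalar_mid_central_ideal = scalar_hom \<iota> + mid_central_ideal I
  for \<iota> :: "'k::field_char_0 \<Rightarrow> 'r::ring_1" and I :: "'r set"
begin

text \<open>Letters between \<open>u\<close> and \<open>w'\<close> multiply \<open>u\<close> from
  the right; letters after \<open>w'\<close> are carried to the front of the central product
  \<open>u w'\<close> and become left multiplications. \<open>u\<close> is arbitrary so that each
  letter passed over can be absorbed into it.\<close>

lemma second_order_terms_aux:
  fixes z :: 'r and l m b c :: "nat \<Rightarrow> 'k"
  assumes w: "w \<in> comm_ideal" "w' \<in> comm_ideal" and u: "u \<in> comm_ideal"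
  defines "\<zeta> \<equiv> \<lambda>j. line z (l j) (m j)"
  shows "u * (prod_list (map (\<lambda>j. \<zeta> j + \<iota> (b j) * w + \<iota> (c j) * w') v)
      - prod_list (map (\<lambda>j. \<zeta> j + \<iota> (b j) * w) v))
    - act z (path1 (\<lambda>j. right_line (l j) (m j)) (\<lambda>j. [:[:c j:]:]) (\<lambda>j. left_line (l j) (m j)) v) u * w' \<in> I"
  using u
proof (induction v arbitrary: u)
  case (Cons j v)
  let ?P = "prod_list (map (\<lambda>j. \<zeta> j + \<iota> (b j) * w + \<iota> (c j) * w') v)"
  let ?Q = "prod_list (map (\<lambda>j. \<zeta> j + \<iota> (b j) * w) v)" and ?R = "prod_list (map \<zeta> v)"
  let ?X = "path1 (\<lambda>j. right_line (l j) (m j)) (\<lambda>j. [:[:c j:]:]) (\<lambda>j. left_line (l j) (m j)) v"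
  let ?d = "prod_list (map (\<lambda>j. left_line (l j) (m j)) v)"
  have PQ: "?P - ?Q \<in> comm_ideal"
    by (rule prod_list_diff_mem) (simp add: w scalar_comm_ideal)
  have PR: "?P - ?R \<in> comm_ideal"
    by (rule prod_list_diff_mem) (simp add: w scalar_comm_ideal CI.add_mem add.assoc)
  have 1: "(u * \<zeta> j) * (?P - ?Q) - act z ?X (u * \<zeta> j) * w' \<in> I"
    by (intro Cons.IH CI.mult_right_mem Cons.prems)
  have 2: "\<iota> (b j) * (u * w * (?P - ?Q)) \<in> I"
    by (intro mult_left_mem triple_comm_ideal Cons.prems w PQ)
  have 3: "\<iota> (c j) * (u * w' * (?P - ?R)) \<in> I"
    by (intro mult_left_mem triple_comm_ideal Cons.prems w PR)
  have 4: "\<iota> (c j) * commutator (u * w') ?R \<in> I"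
    by (intro mult_left_mem central_comm_ideal Cons.prems w)
  have "act z (right_line (l j) (m j) * ?X + [:[:c j:]:] * ?d) u
      = act z ?X (u * \<zeta> j) + \<iota> (c j) * (?R * u)"
    by (simp add: act_add act_right_line act_smult_const act_left_lines \<zeta>_def)
  moreover have "u * ((\<zeta> j + \<iota> (b j) * w + \<iota> (c j) * w') * ?P - (\<zeta> j + \<iota> (b j) * w) * ?Q)
      - (act z ?X (u * \<zeta> j) + \<iota> (c j) * (?R * u)) * w'
    = ((u * \<zeta> j) * (?P - ?Q) - act z ?X (u * \<zeta> j) * w') + \<iota> (b j) * (u * w * (?P - ?Q))
      + \<iota> (c j) * (u * w' * (?P - ?R)) + \<iota> (c j) * commutator (u * w') ?R"
    by (simp add: commutator_def hom_left_commute[of u] algebra_simps)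
  ultimately show ?case using 1 2 3 4 by (simp add: add_mem)
qed (simp add: zero_mem)

text \<open>The alternating sum removes everything that does not involve both \<open>w\<close> and
  \<open>w'\<close>, and products of three elements of \<open>comm_ideal\<close> vanish modulo
  \<open>I\<close>. The two summands are the two orders in which \<open>w\<close> and
  \<open>w'\<close> occur.\<close>

lemma second_order_terms:
  fixes z :: 'r and l m b c :: "nat \<Rightarrow> 'k"
  assumes w: "w \<in> comm_ideal" "w' \<in> comm_ideal"
  defines "\<zeta> \<equiv> \<lambda>j. line z (l j) (m j)"
    and "L \<equiv> \<lambda>j. left_line (l j) (m j)" and "R \<equiv> \<lambda>j. right_line (l j) (m j)"
    and "B \<equiv> \<lambda>j. [:[:b j:]:]" and "C \<equiv> \<lambda>j. [:[:c j:]:]"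
  shows "prod_list (map (\<lambda>j. \<zeta> j + \<iota> (b j) * w + \<iota> (c j) * w') v)
      - prod_list (map (\<lambda>j. \<zeta> j + \<iota> (b j) * w) v)
      - prod_list (map (\<lambda>j. \<zeta> j + \<iota> (c j) * w') v) + prod_list (map \<zeta> v)
    - (act z (path2 L B R C L v) w * w' + act z (path2 L C R B L v) w' * w) \<in> I"
proof (induction v)
  case (Cons j v)
  let ?P = "prod_list (map (\<lambda>j. \<zeta> j + \<iota> (b j) * w + \<iota> (c j) * w') v)"
  let ?Qb = "prod_list (map (\<lambda>j. \<zeta> j + \<iota> (b j) * w) v)"
  let ?Qc = "prod_list (map (\<lambda>j. \<zeta> j + \<iota> (c j) * w') v)" and ?R = "prod_list (map \<zeta> v)"
  let ?Y = "path2 L B R C L v" and ?Y' = "path2 L C R B L v"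
  have 1: "\<zeta> j * (?P - ?Qb - ?Qc + ?R - (act z ?Y w * w' + act z ?Y' w' * w)) \<in> I"
    by (intro mult_left_mem Cons.IH)
  have 2: "\<iota> (b j) * (w * (?P - ?Qb) - act z (path1 R C L v) w * w') \<in> I"
    unfolding \<zeta>_def L_def R_def C_def by (intro mult_left_mem second_order_terms_aux w)
  have "?P = prod_list (map (\<lambda>j. \<zeta> j + \<iota> (c j) * w' + \<iota> (b j) * w) v)"
    by (simp add: add.assoc add.commute[of "\<iota> (b _) * w"])
  then have 3: "\<iota> (c j) * (w' * (?P - ?Qc) - act z (path1 R B L v) w' * w) \<in> I"
    using second_order_terms_aux[OF w(2,1,2), of z l m c b v]
    unfolding \<zeta>_def L_def R_def B_def by (simp add: mult_left_mem)
  have "act z (path2 L B R C L (j # v)) w = \<zeta> j * act z ?Y w + \<iota> (b j) * act z (path1 R C L v) w"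
    "act z (path2 L C R B L (j # v)) w' = \<zeta> j * act z ?Y' w' + \<iota> (c j) * act z (path1 R B L v) w'"
    by (simp_all add: B_def C_def act_add act_smult_const)
      (simp_all add: L_def \<zeta>_def act_left_line)
  moreover have "(\<zeta> j + \<iota> (b j) * w + \<iota> (c j) * w') * ?P - (\<zeta> j + \<iota> (b j) * w) * ?Qb
       - (\<zeta> j + \<iota> (c j) * w') * ?Qc + \<zeta> j * ?R
       - ((\<zeta> j * act z ?Y w + \<iota> (b j) * act z (path1 R C L v) w) * w'
         + (\<zeta> j * act z ?Y' w' + \<iota> (c j) * act z (path1 R B L v) w') * w)
     = \<zeta> j * (?P - ?Qb - ?Qc + ?R - (act z ?Y w * w' + act z ?Y' w' * w))
       + \<iota> (b j) * (w * (?P - ?Qb) - act z (path1 R C L v) w * w')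
       + \<iota> (c j) * (w' * (?P - ?Qc) - act z (path1 R B L v) w' * w)"
    by (simp add: algebra_simps)
  ultimately show ?case using add_mem[OF add_mem[OF 1 2] 3] by simp
qed (simp add: zero_mem)

end

section \<open>The free algebra\<close>

lemma free_poly_induct [case_names single add]:
  fixes f :: "'b \<Rightarrow>\<^sub>0 'k::comm_monoid_add"
  assumes "\<And>w c. P (Poly_Mapping.single w c)" and "\<And>f g. P f \<Longrightarrow> P g \<Longrightarrow> P (f + g)"
  shows "P f"
proof (induction f rule: update_induct)
  case const
  show ?case using assms(1)[of undefined 0] by simp
next
  case (update f a b)
  have "Poly_Mapping.update a b f = Poly_Mapping.single a b + f"
    using update.hyps(1)
    by (intro poly_mapping_eqI) (auto simp: lookup_update lookup_add lookup_single in_keys_iff when_def)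
  then show ?case using assms update.IH by simp
qed

context scalar_hom
begin

definition lin :: "('b \<Rightarrow> 'r) \<Rightarrow> ('b \<Rightarrow>\<^sub>0 'k) \<Rightarrow> 'r" where
  "lin E f = (\<Sum>w\<in>Poly_Mapping.keys f. \<iota> (Poly_Mapping.lookup f w) * E w)"

lemma lin_single [simp]: "lin E (Poly_Mapping.single w c) = \<iota> c * E w"
  by (auto simp: lin_def hom_zero)

lemma lin_add: "lin E (f + g) = lin E f + lin E g"
  unfolding lin_def
  by (rule setsum_keys_plus_distrib) (simp_all add: hom_zero hom_add distrib_right)

lemma lin_zero [simp]: "lin E 0 = 0"
  by (simp add: lin_def)

lemma lin_uminus: "lin E (- f) = - lin E f"
  using lin_add[of E f "- f"] by (simp add: eq_neg_iff_add_eq_0 add.commute)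

lemma lin_diff: "lin E (f - g) = lin E f - lin E g"
  using lin_add[of E f "- g"] by (simp add: lin_uminus)

lemma lin_sum: "lin E (sum g S) = (\<Sum>i\<in>S. lin E (g i))"
  by (induction S rule: infinite_finite_induct) (simp_all add: lin_add)

lemma lin_cong: "(\<And>w. w \<in> Poly_Mapping.keys f \<Longrightarrow> E w = E' w) \<Longrightarrow> lin E f = lin E' f"
  by (simp add: lin_def)

lemma lin_fun_add: "lin (\<lambda>w. E w + E' w) f = lin E f + lin E' f"
  by (simp add: lin_def distrib_left sum.distrib)

lemma lin_fun_diff: "lin (\<lambda>w. E w - E' w) f = lin E f - lin E' f"
  by (simp add: lin_def right_diff_distrib sum_subtractf)

lemma lin_mult_right: "lin (\<lambda>w. E w * r) f = lin E f * r"
  by (simp add: lin_def sum_distrib_right mult.assoc)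

lemma lin_mult_left: "lin (\<lambda>w. r * E w) f = r * lin E f"
  by (simp add: lin_def sum_distrib_left hom_left_commute)

lemma lin_scale: "lin E (Poly_Mapping.single 0 c * f) = \<iota> c * lin E f"
  for E :: "'b::monoid_add \<Rightarrow> 'r"
  by (induction f rule: free_poly_induct)
    (simp_all add: mult_single hom_mult mult.assoc lin_add distrib_left)

lemma lin_times:
  fixes E :: "'b::monoid_add \<Rightarrow> 'r"
  assumes "\<And>u v. E (u + v) = E u * E v"
  shows "lin E (f * g) = lin E f * lin E g"
proof (induction f rule: free_poly_induct)
  case (single u c)
  show ?case
  proof (induction g rule: free_poly_induct)
    case (single v d)
    have "\<iota> c * \<iota> d * (E u * E v) = \<iota> c * E u * (\<iota> d * E v)"
      by (simp add: mult.assoc hom_left_commute[of "E u"])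
    then show ?case by (simp add: mult_single hom_mult assms)
  qed (simp_all add: lin_add distrib_left)
qed (simp_all add: lin_add distrib_right)

lemma lin_one: "lin E 1 = E 0" for E :: "'b::monoid_add \<Rightarrow> 'r"
  using lin_single[of E 0 1] by (simp add: hom_one del: lin_single)

end

lemma (in two_sided_ideal) lin_mem:
  fixes \<iota> :: "'k::field_char_0 \<Rightarrow> 'r"
  assumes "scalar_hom \<iota>" "\<And>w. w \<in> Poly_Mapping.keys f \<Longrightarrow> E w \<in> J"
  shows "scalar_hom.lin \<iota> E f \<in> J"
  unfolding scalar_hom.lin_def[OF assms(1)] by (intro sum_mem mult_left_mem assms(2))

abbreviation cst :: "'k::field \<Rightarrow> 'k free_poly" where
  "cst \<equiv> Poly_Mapping.single 0"

lemma cst_central: "cst c * f = f * cst c"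
  by (induction f rule: free_poly_induct) (simp_all add: mult_single distrib_left distrib_right mult.commute)

interpretation cst: scalar_hom "cst :: 'k::field_char_0 \<Rightarrow> 'k free_poly"
  by standard (simp_all add: single_add mult_single cst_central)

interpretation id_hom: scalar_hom "\<lambda>c :: 'k::field_char_0. c"
  by standard simp_all

interpretation poly_hom: scalar_hom "\<lambda>c :: 'k::field_char_0. [:[:c:]:]"
  by standard (simp_all add: one_pCons)

definition subst :: "(nat \<Rightarrow> 'k free_poly) \<Rightarrow> 'k::field_char_0 free_poly \<Rightarrow> 'k free_poly" where
  "subst \<sigma> = cst.lin (\<lambda>v. prod_list (map \<sigma> v))"

lemma free_poly_eq_lin: "cst.lin (\<lambda>v. Poly_Mapping.single v 1) f = f"
  by (induction f rule: free_poly_induct) (simp_all add: cst.lin_add mult_single)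

locale T_ideal = two_sided_ideal I for I :: "'k::field_char_0 free_poly set" +
  assumes subst_mem: "f \<in> I \<Longrightarrow> subst \<sigma> f \<in> I"

section \<open>Evaluation in an algebra\<close>

context unital_algebra
begin

lemma smult_zero: "x \<in> carrier A \<Longrightarrow> 0 \<odot> x = \<zero>"
  using smult_add_left[of x 0 0] smult_closed[of x 0] by (metis add.l_cancel_one add_0)

lemma smult_zero_right: "c \<odot> \<zero> = \<zero>"
  using smult_add_right[of \<zero> \<zero> c] smult_closed[of \<zero> c] by (metis add.l_cancel_one l_zero zero_closed)

lemma eval_word_closed: "range \<rho> \<subseteq> carrier A \<Longrightarrow> eval_word A \<rho> w \<in> carrier A"
  by (induction w) (auto simp: eval_word_def)

lemma eval_word_append:
  "range \<rho> \<subseteq> carrier A \<Longrightarrow> eval_word A \<rho> (u @ v) = eval_word A \<rho> u \<otimes> eval_word A \<rho> v"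
proof (induction u)
  case (Cons i u)
  then have "\<rho> i \<in> carrier A" by auto
  with Cons show ?case
    using eval_word_closed[of \<rho> u] eval_word_closed[of \<rho> v] by (simp add: eval_word_def m_assoc)
qed (use eval_word_closed in \<open>simp add: eval_word_def\<close>)

lemma eval_poly_bound:
  assumes "range \<rho> \<subseteq> carrier A" "finite S" "Poly_Mapping.keys f \<subseteq> S"
  shows "eval_poly A \<rho> f = (\<Oplus>w\<in>S. Poly_Mapping.lookup f w \<odot> eval_word A \<rho> w)"
  unfolding eval_poly_def
  by (rule add.finprod_mono_neutral_cong_left)
    (use assms in \<open>auto simp: in_keys_iff smult_zero eval_word_closed smult_closed\<close>)

lemma eval_poly_closed: "range \<rho> \<subseteq> carrier A \<Longrightarrow> eval_poly A \<rho> f \<in> carrier A"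
  unfolding eval_poly_def by (rule finsum_closed) (auto simp: eval_word_closed smult_closed)

lemma eval_poly_single:
  assumes "range \<rho> \<subseteq> carrier A"
  shows "eval_poly A \<rho> (Poly_Mapping.single w c) = c \<odot> eval_word A \<rho> w"
  using assms eval_poly_bound[OF assms, of "{w}" "Poly_Mapping.single w c"]
  by (auto simp: eval_word_closed smult_closed finsum_insert)

lemma eval_poly_zero: "eval_poly A \<rho> 0 = \<zero>"
  by (simp add: eval_poly_def)

lemma eval_poly_add:
  assumes \<rho>: "range \<rho> \<subseteq> carrier A"
  shows "eval_poly A \<rho> (f + g) = eval_poly A \<rho> f \<oplus> eval_poly A \<rho> g"
proof -
  let ?S = "Poly_Mapping.keys f \<union> Poly_Mapping.keys g"
  have "Poly_Mapping.keys (f + g) \<subseteq> ?S" by (rule keys_add)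
  then have "eval_poly A \<rho> (f + g) = (\<Oplus>w\<in>?S. Poly_Mapping.lookup (f + g) w \<odot> eval_word A \<rho> w)"
    by (intro eval_poly_bound[OF \<rho>]) simp_all
  also have "\<dots> = (\<Oplus>w\<in>?S. Poly_Mapping.lookup f w \<odot> eval_word A \<rho> w
      \<oplus> Poly_Mapping.lookup g w \<odot> eval_word A \<rho> w)"
    by (intro finsum_cong') (auto simp: lookup_add smult_add_left eval_word_closed[OF \<rho>] smult_closed)
  also have "\<dots> = (\<Oplus>w\<in>?S. Poly_Mapping.lookup f w \<odot> eval_word A \<rho> w)
      \<oplus> (\<Oplus>w\<in>?S. Poly_Mapping.lookup g w \<odot> eval_word A \<rho> w)"
    by (intro finsum_addf) (auto simp: eval_word_closed[OF \<rho>] smult_closed)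
  also have "\<dots> = eval_poly A \<rho> f \<oplus> eval_poly A \<rho> g"
    by (simp add: eval_poly_bound[OF \<rho>, of ?S f] eval_poly_bound[OF \<rho>, of ?S g])
  finally show ?thesis .
qed

lemma eval_poly_mult:
  assumes \<rho>: "range \<rho> \<subseteq> carrier A"
  shows "eval_poly A \<rho> (f * g) = eval_poly A \<rho> f \<otimes> eval_poly A \<rho> g"
proof (induction f rule: free_poly_induct)
  case (single u c)
  show ?case
  proof (induction g rule: free_poly_induct)
    case (single v d)
    show ?case
      using eval_word_closed[OF \<rho>, of u] eval_word_closed[OF \<rho>, of v]
      by (simp add: eval_poly_single[OF \<rho>] mult_single plus_list_def eval_word_append[OF \<rho>]
          smult_mult_left smult_mult_right smult_smult[symmetric] smult_closed mult.commute)
  qed (simp add: distrib_left eval_poly_add[OF \<rho>] eval_poly_closed[OF \<rho>] r_distr)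
qed (simp add: distrib_right eval_poly_add[OF \<rho>] eval_poly_closed[OF \<rho>] l_distr)

lemma eval_poly_cst: "range \<rho> \<subseteq> carrier A \<Longrightarrow> eval_poly A \<rho> (cst c) = c \<odot> \<one>"
  by (simp add: eval_poly_single eval_word_def zero_list_def)

lemma eval_poly_one: "range \<rho> \<subseteq> carrier A \<Longrightarrow> eval_poly A \<rho> 1 = \<one>"
  using eval_poly_cst[of \<rho> 1] smult_one[of \<one>] by simp

lemma eval_poly_uminus:
  assumes \<rho>: "range \<rho> \<subseteq> carrier A"
  shows "eval_poly A \<rho> (- f) = \<ominus> eval_poly A \<rho> f"
proof -
  have "eval_poly A \<rho> (- f) \<oplus> eval_poly A \<rho> f = \<zero>"
    by (simp add: eval_poly_zero flip: eval_poly_add[OF \<rho>])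
  then show ?thesis by (metis minus_equality eval_poly_closed[OF \<rho>])
qed

lemma eval_poly_diff:
  "range \<rho> \<subseteq> carrier A \<Longrightarrow> eval_poly A \<rho> (f - g) = eval_poly A \<rho> f \<ominus> eval_poly A \<rho> g"
  using eval_poly_add[of \<rho> f "- g"] by (simp add: eval_poly_uminus a_minus_def)

end

lemma eval_poly_subst:
  fixes A :: "('k::field_char_0, 'a) module"
  assumes "unital_algebra A" and \<rho>: "range \<rho> \<subseteq> carrier A"
  shows "eval_poly A \<rho> (subst \<sigma> f) = eval_poly A (\<lambda>i. eval_poly A \<rho> (\<sigma> i)) f"
proof -
  interpret unital_algebra A by fact
  let ?\<rho>' = "\<lambda>i. eval_poly A \<rho> (\<sigma> i)"
  have \<rho>': "range ?\<rho>' \<subseteq> carrier A" using eval_poly_closed[OF \<rho>] by auto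
  have word: "eval_poly A \<rho> (prod_list (map \<sigma> v)) = eval_word A ?\<rho>' v" for v
    by (induction v) (simp_all add: eval_poly_one[OF \<rho>] eval_poly_mult[OF \<rho>] eval_word_def)
  show ?thesis
  proof (induction f rule: free_poly_induct)
    case (single w c)
    show ?case using eval_word_closed[OF \<rho>', of w]
      by (simp add: subst_def eval_poly_mult[OF \<rho>] eval_poly_cst[OF \<rho>] word smult_mult_left
          eval_poly_single[OF \<rho>'])
  qed (simp add: subst_def cst.lin_add eval_poly_add[OF \<rho>] eval_poly_add[OF \<rho>'])
qed

lemma T_ideal_identities:
  fixes A :: "('k::field_char_0, 'a) module"
  assumes "unital_algebra A"
  shows "T_ideal (identities A)"
proof -
  interpret unital_algebra A by fact
  show ?thesis
  proof
    show "0 \<in> identities A" by (simp add: identities_def eval_poly_zero)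
    show "f + g \<in> identities A" if "f \<in> identities A" "g \<in> identities A" for f g
      using that by (simp add: identities_def eval_poly_add)
    show "r * f \<in> identities A" "f * r \<in> identities A" if "f \<in> identities A" for f r
      using that by (simp_all add: identities_def eval_poly_mult eval_poly_closed)
    show "subst \<sigma> f \<in> identities A" if "f \<in> identities A" for f \<sigma>
      using that eval_poly_closed
      by (auto simp: identities_def eval_poly_subst[OF assms] image_subset_iff)
  qed
qed

lemma T_ideal_variety_identities:
  fixes S :: "'k::field_char_0 free_poly set" and U :: "('k, 'a) module set"
  assumes "U = variety S"
  shows "T_ideal (variety_identities U)"
proof -
  have "T_ideal (identities A)" if "A \<in> U" for A
    using that assms by (simp add: variety_def T_ideal_identities)
  note T = this[unfolded T_ideal_def two_sided_ideal_def T_ideal_axioms_def]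
  show ?thesis
    unfolding T_ideal_def two_sided_ideal_def T_ideal_axioms_def variety_identities_def
    using T by blast
qed

section \<open>Copies of an algebra\<close>

text \<open>Transport of structure, by which \<open>UT2\<close> is placed in the universe of the
  variety.\<close>

definition copy_algebra :: "('a \<Rightarrow> 'b) \<Rightarrow> ('k, 'a) module \<Rightarrow> ('k, 'b) module" where
  "copy_algebra g A = (let h = inv_into (carrier A) g in
     \<lparr>carrier = g ` carrier A, mult = (\<lambda>x y. g (h x \<otimes>\<^bsub>A\<^esub> h y)), one = g \<one>\<^bsub>A\<^esub>, zero = g \<zero>\<^bsub>A\<^esub>,
      add = (\<lambda>x y. g (h x \<oplus>\<^bsub>A\<^esub> h y)), module.smult = (\<lambda>c x. g (c \<odot>\<^bsub>A\<^esub> h x))\<rparr>)"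

context unital_algebra
begin

lemma copy_algebra_simps:
  assumes "inj_on g (carrier A)"
  shows "carrier (copy_algebra g A) = g ` carrier A"
    "\<lbrakk>x \<in> carrier A; y \<in> carrier A\<rbrakk> \<Longrightarrow> g x \<otimes>\<^bsub>copy_algebra g A\<^esub> g y = g (x \<otimes> y)"
    "\<lbrakk>x \<in> carrier A; y \<in> carrier A\<rbrakk> \<Longrightarrow> g x \<oplus>\<^bsub>copy_algebra g A\<^esub> g y = g (x \<oplus> y)"
    "x \<in> carrier A \<Longrightarrow> c \<odot>\<^bsub>copy_algebra g A\<^esub> g x = g (c \<odot> x)"
    "\<one>\<^bsub>copy_algebra g A\<^esub> = g \<one>" "\<zero>\<^bsub>copy_algebra g A\<^esub> = g \<zero>"
  using assms by (simp_all add: copy_algebra_def Let_def)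

lemma unital_algebra_copy:
  assumes inj: "inj_on g (carrier A)"
  shows "unital_algebra (copy_algebra g A)"
proof -
  note [simp] = copy_algebra_simps[OF inj] smult_closed
  have inv: "\<exists>y\<in>carrier A. y \<oplus> x = \<zero> \<and> x \<oplus> y = \<zero>" if "x \<in> carrier A" for x
    using that by (intro bexI[of _ "\<ominus> x"]) (simp_all add: l_neg r_neg)
  have Units: "carrier (add_monoid (copy_algebra g A)) \<subseteq> Units (add_monoid (copy_algebra g A))"
  proof
    fix x assume "x \<in> carrier (add_monoid (copy_algebra g A))"
    then obtain x' where x': "x' \<in> carrier A" "x = g x'" by auto
    with inv obtain y where "y \<in> carrier A" "y \<oplus> x' = \<zero>" "x' \<oplus> y = \<zero>" by blast
    with x' show "x \<in> Units (add_monoid (copy_algebra g A))"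
      unfolding Units_def by (auto intro!: bexI[of _ y])
  qed
  show ?thesis
    by (unfold_locales; (rule Units)?;
        clarsimp simp: a_ac m_assoc l_distr r_distr smult_add_left smult_add_right
          smult_smult smult_one smult_mult_left smult_mult_right)
qed

lemma eval_poly_copy:
  assumes inj: "inj_on g (carrier A)" and \<rho>: "range \<rho> \<subseteq> carrier A"
  shows "eval_poly (copy_algebra g A) (g \<circ> \<rho>) f = g (eval_poly A \<rho> f)"
proof -
  interpret B: unital_algebra "copy_algebra g A" by (rule unital_algebra_copy[OF inj])
  note [simp] = copy_algebra_simps[OF inj]
  have \<rho>': "range (g \<circ> \<rho>) \<subseteq> carrier (copy_algebra g A)" using \<rho> by auto
  have word: "eval_word (copy_algebra g A) (g \<circ> \<rho>) w = g (eval_word A \<rho> w)" for w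
  proof (induction w)
    case (Cons i w)
    have "\<rho> i \<in> carrier A" using \<rho> by auto
    with Cons eval_word_closed[OF \<rho>, of w] show ?case by (simp add: eval_word_def)
  qed (simp add: eval_word_def)
  show ?thesis
  proof (induction f rule: free_poly_induct)
    case (single w c)
    show ?case using eval_word_closed[OF \<rho>, of w]
      unfolding B.eval_poly_single[OF \<rho>'] eval_poly_single[OF \<rho>] word by simp
  next
    case (add f h)
    then show ?case using eval_poly_closed[OF \<rho>]
      unfolding B.eval_poly_add[OF \<rho>'] eval_poly_add[OF \<rho>] by (simp add: o_def)
  qed
qed

lemma identities_copy:
  assumes inj: "inj_on g (carrier A)"
  shows "identities (copy_algebra g A) = identities A"
proof -
  note [simp] = copy_algebra_simps[OF inj]
  have "eval_poly A \<rho> f = \<zero>" if "f \<in> identities (copy_algebra g A)" "range \<rho> \<subseteq> carrier A" for f \<rho>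
  proof -
    have "range (g \<circ> \<rho>) \<subseteq> carrier (copy_algebra g A)" using that(2) by auto
    then have "g (eval_poly A \<rho> f) = g \<zero>"
      using that eval_poly_copy[OF inj that(2), of f] by (simp add: identities_def)
    then show ?thesis using inj eval_poly_closed[OF that(2)] by (auto dest: inj_onD)
  qed
  moreover have "eval_poly (copy_algebra g A) \<rho> f = g \<zero>"
    if "f \<in> identities A" "range \<rho> \<subseteq> g ` carrier A" for f \<rho>
  proof -
    define \<rho>' where "\<rho>' i = inv_into (carrier A) g (\<rho> i)" for i
    have *: "\<rho> i \<in> g ` carrier A" for i using that(2) by auto
    then have "range \<rho>' \<subseteq> carrier A" unfolding \<rho>'_def by (auto intro: inv_into_into)
    moreover have "g \<circ> \<rho>' = \<rho>"
      using * by (auto simp: \<rho>'_def f_inv_into_f)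
    ultimately show ?thesis using eval_poly_copy[OF inj, of \<rho>' f] that(1) by (simp add: identities_def)
  qed
  ultimately show ?thesis by (auto simp: identities_def)
qed

end

section \<open>Exponential sums\<close>

text \<open>Combining the power sums with the coefficients of \<open>p\<close> evaluates
  \<open>p\<close> at the nodes, and \<open>p\<close> vanishes at every value of \<open>x\<close>
  other than \<open>y\<close>.\<close>

lemma exp_sum_eq_0:
  fixes x :: "'b \<Rightarrow> 'k::field"
  assumes "finite S" and zero: "\<And>t. (\<Sum>v\<in>S. c v * x v ^ t) = 0"
  shows "(\<Sum>v | v \<in> S \<and> x v = y. c v) = 0"
proof -
  define X where "X = x ` S - {y}"
  have "finite X" using assms(1) by (simp add: X_def)
  define p where "p = (\<Prod>z\<in>X. [:- z, 1:])"
  have "(\<Sum>v\<in>S. c v * poly p (x v)) = (\<Sum>i\<le>degree p. coeff p i * (\<Sum>v\<in>S. c v * x v ^ i))"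
    unfolding poly_altdef sum_distrib_left
    by (subst sum.swap) (simp add: mult.left_commute mult.commute)
  also have "\<dots> = 0" by (simp add: zero)
  finally have "(\<Sum>v\<in>S. c v * poly p (x v)) = 0" .
  moreover have "(\<Sum>v\<in>S. c v * poly p (x v)) = (\<Sum>v | v \<in> S \<and> x v = y. c v * poly p y)"
    using assms(1) \<open>finite X\<close>
    by (intro sum.mono_neutral_cong_right) (auto simp: p_def poly_prod X_def)
  ultimately have "(\<Sum>v | v \<in> S \<and> x v = y. c v) * poly p y = 0"
    by (simp add: sum_distrib_right)
  moreover have "poly p y \<noteq> 0" using \<open>finite X\<close> by (auto simp: p_def poly_prod X_def)
  ultimately show ?thesis by simp
qed

lemma ex_inj_primes: "\<exists>p :: nat \<Rightarrow> nat. inj p \<and> (\<forall>i. prime (p i))"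
  using infinite_countable_subset[OF primes_infinite] by blast

text \<open>Unique factorization encodes multisets as distinct numbers; these stay distinct in
  characteristic \<open>0\<close> and can serve as nodes of an exponential sum.\<close>

lemma prod_mset_primes_inj:
  fixes p :: "'b \<Rightarrow> nat"
  assumes "inj p" "\<And>i. prime (p i)" "prod_mset (image_mset p M) = prod_mset (image_mset p N)"
  shows "M = N"
proof -
  have "prime_factorization (prod_mset (image_mset p M)) = image_mset p M" for M
    by (rule prime_factorization_prod_mset_primes) (use assms(2) in auto)
  then have "image_mset p M = image_mset p N" using assms(3) by metis
  then show ?thesis using multiset.inj_map[OF assms(1)] by (simp add: inj_eq)
qed

section \<open>Identities of \<open>UT\<^sub>2(K)\<close>\<close>

definition m2 :: "'r::ring_1 \<Rightarrow> 'r \<Rightarrow> 'r \<Rightarrow> 'r \<Rightarrow> 'r mat" where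
  "m2 a b c d = mat_of_rows_list 2 [[a, b], [c, d]]"

lemma dim_m2 [simp]: "dim_row (m2 a b c d) = 2" "dim_col (m2 a b c d) = 2"
  by (simp_all add: m2_def mat_of_rows_list_def)

lemma m2_carrier [simp]: "m2 a b c d \<in> carrier_mat 2 2"
  by (rule carrier_matI) simp_all

lemma m2_index [simp]:
  "m2 a b c d $$ (0, 0) = a" "m2 a b c d $$ (0, Suc 0) = b"
  "m2 a b c d $$ (Suc 0, 0) = c" "m2 a b c d $$ (Suc 0, Suc 0) = d"
  by (simp_all add: m2_def mat_of_rows_list_def)

lemma mat2_eqI:
  assumes "A \<in> carrier_mat 2 2" "B \<in> carrier_mat 2 2"
    and "A $$ (0, 0) = B $$ (0, 0)" "A $$ (0, Suc 0) = B $$ (0, Suc 0)"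
    and "A $$ (Suc 0, 0) = B $$ (Suc 0, 0)" "A $$ (Suc 0, Suc 0) = B $$ (Suc 0, Suc 0)"
  shows "A = B"
proof (rule eq_matI)
  fix i j assume "i < dim_row B" "j < dim_col B"
  then have "i = 0 \<or> i = Suc 0" "j = 0 \<or> j = Suc 0" using assms(2) by auto
  then show "A $$ (i, j) = B $$ (i, j)" using assms(3-) by auto
qed (use assms in auto)

lemma m2_inject: "m2 a b c d = m2 a' b' c' d' \<longleftrightarrow> a = a' \<and> b = b' \<and> c = c' \<and> d = d'"
proof
  assume "m2 a b c d = m2 a' b' c' d'"
  from arg_cong[OF this, of "\<lambda>A. (A $$ (0, 0), A $$ (0, Suc 0), A $$ (Suc 0, 0), A $$ (Suc 0, Suc 0))"]
  show "a = a' \<and> b = b' \<and> c = c' \<and> d = d'" by simp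
qed simp

lemma m2_eta: "M \<in> carrier_mat 2 2
    \<Longrightarrow> M = m2 (M $$ (0, 0)) (M $$ (0, Suc 0)) (M $$ (Suc 0, 0)) (M $$ (Suc 0, Suc 0))"
  by (rule mat2_eqI) simp_all

lemma m2_mult: "m2 a b c d * m2 a' b' c' d'
    = m2 (a * a' + b * c') (a * b' + b * d') (c * a' + d * c') (c * b' + d * d')"
  by (rule mat2_eqI, rule mult_carrier_mat[OF m2_carrier m2_carrier], rule m2_carrier)
    (simp_all add: scalar_prod_def numeral_2_eq_2)

lemma m2_add: "m2 a b c d + m2 a' b' c' d' = m2 (a + a') (b + b') (c + c') (d + d')"
  by (rule mat2_eqI) simp_all

lemma m2_smult: "r \<cdot>\<^sub>m m2 a b c d = m2 (r * a) (r * b) (r * c) (r * d)"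
  by (rule mat2_eqI) simp_all

lemma m2_one: "1\<^sub>m 2 = m2 1 0 0 1"
  by (rule mat2_eqI) simp_all

lemma m2_zero: "0\<^sub>m 2 2 = m2 0 0 0 0"
  by (rule mat2_eqI) simp_all

lemma UT2_simps:
  "carrier UT2 = {m2 a b 0 d | a b d :: 'k::field. True}"
  "m2 a b c d \<otimes>\<^bsub>UT2\<^esub> m2 a' b' c' d' = m2 a b c d * m2 a' b' c' (d'::'k)"
  "m2 a b c d \<oplus>\<^bsub>UT2\<^esub> m2 a' b' c' d' = m2 a b c d + m2 a' b' c' (d'::'k)"
  "r \<odot>\<^bsub>UT2\<^esub> m2 a b c d = m2 (r * a) (r * b) (r * c) (r * (d::'k))"
  "\<one>\<^bsub>UT2\<^esub> = m2 1 0 0 (1::'k)" "\<zero>\<^bsub>UT2\<^esub> = m2 0 0 0 (0::'k)"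
proof -
  have "M \<in> {m2 a b 0 d | a b d :: 'k. True}" if "M \<in> carrier_mat 2 2" "upper_triangular M" for M
  proof -
    have "M $$ (Suc 0, 0) = 0" using that by (auto simp: upper_triangular_def)
    then show ?thesis using m2_eta[OF that(1)] by auto
  qed
  moreover have "upper_triangular (m2 a b 0 (d::'k))" for a b d
    by (auto simp: upper_triangular_def less_Suc_eq numeral_2_eq_2)
  ultimately show "carrier UT2 = {m2 a b 0 d | a b d :: 'k. True}"
    by (auto simp: UT2_def mat_algebra_def)
qed (simp_all add: UT2_def mat_algebra_def m2_smult m2_one m2_zero)

lemma eval_poly_UT2:
  fixes f :: "'k::field_char_0 free_poly"
  shows "eval_poly UT2 (\<lambda>i. m2 (a i) (b i) 0 (d i)) f
    = m2 (id_hom.lin (\<lambda>v. prod_list (map a v)) f) (id_hom.lin (path1 a b d) f) 0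
        (id_hom.lin (\<lambda>v. prod_list (map d v)) f)"
proof -
  interpret unital_algebra "UT2 :: ('k, 'k mat) module" by (rule unital_algebra_UT2)
  let ?\<rho> = "\<lambda>i. m2 (a i) (b i) 0 (d i)"
  have \<rho>: "range ?\<rho> \<subseteq> carrier UT2" by (auto simp: UT2_simps)
  have word: "eval_word UT2 ?\<rho> w = m2 (prod_list (map a w)) (path1 a b d w) 0 (prod_list (map d w))" for w
    by (induction w) (simp_all add: eval_word_def UT2_simps m2_mult)
  show ?thesis
  proof (induction f rule: free_poly_induct)
    case (single w c)
    show ?case unfolding eval_poly_single[OF \<rho>] word by (simp add: UT2_simps)
  next
    case (add f g)
    then show ?case unfolding eval_poly_add[OF \<rho>] by (simp add: UT2_simps m2_add id_hom.lin_add)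
  qed
qed

lemma identities_UT2_iff:
  fixes f :: "'k::field_char_0 free_poly"
  shows "f \<in> identities UT2 \<longleftrightarrow>
    (\<forall>a b d. id_hom.lin (\<lambda>v. prod_list (map a v)) f = 0 \<and> id_hom.lin (path1 a b d) f = 0)"
proof
  assume f: "f \<in> identities UT2"
  show "\<forall>a b d. id_hom.lin (\<lambda>v. prod_list (map a v)) f = 0 \<and> id_hom.lin (path1 a b d) f = 0"
  proof (intro allI)
    fix a b d :: "nat \<Rightarrow> 'k"
    have "range (\<lambda>i. m2 (a i) (b i) 0 (d i)) \<subseteq> carrier UT2" by (auto simp: UT2_simps)
    then have "eval_poly UT2 (\<lambda>i. m2 (a i) (b i) 0 (d i)) f = \<zero>\<^bsub>UT2\<^esub>"
      using f by (simp add: identities_def)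
    then show "id_hom.lin (\<lambda>v. prod_list (map a v)) f = 0 \<and> id_hom.lin (path1 a b d) f = 0"
      unfolding eval_poly_UT2 by (simp add: UT2_simps m2_inject)
  qed
next
  assume zero: "\<forall>a b d. id_hom.lin (\<lambda>v. prod_list (map a v)) f = 0 \<and> id_hom.lin (path1 a b d) f = 0"
  have "eval_poly UT2 \<rho> f = \<zero>\<^bsub>UT2\<^esub>" if "range \<rho> \<subseteq> carrier UT2" for \<rho>
  proof -
    have "\<rho> i \<in> carrier UT2" for i using that by blast
    then have "\<forall>i. \<exists>a b d. \<rho> i = m2 a b 0 d" by (simp add: UT2_simps)
    then obtain a b d where "\<rho> = (\<lambda>i. m2 (a i) (b i) 0 (d i))" by metis
    then show ?thesis using zero by (simp add: eval_poly_UT2) (simp add: UT2_simps)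
  qed
  then show "f \<in> identities UT2" by (simp add: identities_def)
qed

text \<open>The identities of \<open>UT\<^sub>2(K)\<close> see a word only through its first letter and the multiset of the
  remaining letters (take \<open>a = 0\<close>).\<close>

lemma lin_first_letter_eq_0:
  fixes f :: "'k::field_char_0 free_poly" and e :: "nat \<Rightarrow> nat multiset \<Rightarrow> 'k free_poly"
  assumes f: "f \<in> identities UT2"
  shows "cst.lin (\<lambda>v. case v of [] \<Rightarrow> 0 | i # r \<Rightarrow> e i (mset r)) f = 0"
proof -
  obtain p :: "nat \<Rightarrow> nat" where p: "inj p" "\<And>i. prime (p i)" using ex_inj_primes by blast
  define N where "N r = prod_mset (image_mset p (mset r))" for r
  define S where "S = Poly_Mapping.keys f - {[]}"
  define \<kappa> where "\<kappa> v = (hd v, mset (tl v))" for v :: "nat list"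
  have fin: "finite S" by (simp add: S_def)
  have class_sum: "(\<Sum>v | v \<in> S \<and> \<kappa> v = (i, M). Poly_Mapping.lookup f v) = 0"
    if "v0 \<in> S" "\<kappa> v0 = (i, M)" for i M v0
  proof -
    let ?S = "{v \<in> S. hd v = i}"
    have "(\<Sum>v\<in>?S. Poly_Mapping.lookup f v * of_nat (N (tl v)) ^ t) = 0" for t
    proof -
      \<comment> \<open>With \<open>a = 0\<close> only the product of \<open>b\<close> at the first
        letter and \<open>d\<close> at the others survives: \<open>?b\<close> selects the first
        letter \<open>i\<close>, and \<open>?d\<close> turns the tail \<open>r\<close> into
        \<open>N r ^ t\<close>.\<close>
      let ?b = "\<lambda>j. if j = i then 1 else 0 :: 'k" and ?d = "\<lambda>j. of_nat (p j) ^ t :: 'k"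
      have d: "prod_list (map ?d r) = of_nat (N r) ^ t" for r
        by (induction r) (simp_all add: N_def power_mult_distrib)
      have "path1 (\<lambda>_. 0) ?b ?d v = (if v \<noteq> [] \<and> hd v = i then of_nat (N (tl v)) ^ t else 0)" for v
        by (cases v) (simp_all add: d)
      then have "0 = (\<Sum>v\<in>Poly_Mapping.keys f. Poly_Mapping.lookup f v
          * (if v \<noteq> [] \<and> hd v = i then of_nat (N (tl v)) ^ t else 0))"
        using f[unfolded identities_UT2_iff, rule_format, of "\<lambda>_. 0" "\<lambda>_. 0" ?d]
          f[unfolded identities_UT2_iff, rule_format, of "\<lambda>_. 0" ?b ?d]
        by (simp add: id_hom.lin_def)
      also have "\<dots> = (\<Sum>v\<in>?S. Poly_Mapping.lookup f v * of_nat (N (tl v)) ^ t)"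
        by (rule sum.mono_neutral_cong_right) (auto simp: S_def)
      finally show ?thesis by simp
    qed
    then have "(\<Sum>v | v \<in> ?S \<and> of_nat (N (tl v)) = (of_nat (N (tl v0)) :: 'k). Poly_Mapping.lookup f v) = 0"
      by (intro exp_sum_eq_0) (simp_all add: fin)
    moreover have "N r = N r' \<longleftrightarrow> mset r = mset r'" for r r'
      using prod_mset_primes_inj[OF p] by (auto simp: N_def)
    ultimately show ?thesis using that(2) by (simp add: \<kappa>_def conj_assoc)
  qed
  let ?h = "\<lambda>v. cst (Poly_Mapping.lookup f v) * e (hd v) (mset (tl v))"
  have "cst.lin (\<lambda>v. case v of [] \<Rightarrow> 0 | i # r \<Rightarrow> e i (mset r)) f = sum ?h S"
    unfolding cst.lin_def S_def by (rule sum.mono_neutral_cong_right) (auto split: list.splits)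
  also have "\<dots> = (\<Sum>y\<in>\<kappa> ` S. \<Sum>v | v \<in> S \<and> \<kappa> v = y. ?h v)"
    by (rule sum.image_gen[OF fin])
  also have "\<dots> = 0"
  proof (rule sum.neutral, rule ballI)
    fix y assume "y \<in> \<kappa> ` S"
    then obtain v0 where v0: "v0 \<in> S" "\<kappa> v0 = y" by auto
    obtain i M where y: "y = (i, M)" by (cases y)
    have "(\<Sum>v | v \<in> S \<and> \<kappa> v = y. ?h v) = (\<Sum>v | v \<in> S \<and> \<kappa> v = y. cst (Poly_Mapping.lookup f v) * e i M)"
      by (rule sum.cong) (auto simp: y \<kappa>_def)
    also have "\<dots> = cst (\<Sum>v | v \<in> S \<and> \<kappa> v = y. Poly_Mapping.lookup f v) * e i M"
      by (simp add: sum_distrib_right cst.hom_sum)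
    also have "\<dots> = 0" using class_sum[OF v0(1), of i M] v0(2) by (simp add: y)
    finally show "(\<Sum>v | v \<in> S \<and> \<kappa> v = y. ?h v) = 0" .
  qed
  finally show ?thesis .
qed

section \<open>Proper polynomials\<close>

definition chain :: "nat \<Rightarrow> nat list \<Rightarrow> 'k::field free_poly" where
  "chain i js = foldl commutator (free_var i) (map free_var js)"

lemma chain_append: "chain i (js @ ks) = foldl commutator (chain i js) (map free_var ks)"
  by (simp add: chain_def)

lemma chain_Cons: "chain i (j # js) = foldl commutator (commutator (free_var i) (free_var j)) (map free_var js)"
  by (simp add: chain_def)

lemma chain_comm_ideal: "js \<noteq> [] \<Longrightarrow> chain i js \<in> comm_ideal"
  by (cases js) (simp_all add: chain_Cons foldl_commutator_mem commutator_in_comm_ideal)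

abbreviation multihom :: "nat multiset \<Rightarrow> 'k::field free_poly \<Rightarrow> bool" where
  "multihom M f \<equiv> (\<forall>v\<in>Poly_Mapping.keys f. mset v = M)"

lemma multihom_diff: "multihom M f \<Longrightarrow> multihom M g \<Longrightarrow> multihom M (f - g)"
  using keys_diff[of f g] by blast

lemma multihom_mult: "multihom M f \<Longrightarrow> multihom N g \<Longrightarrow> multihom (M + N) (f * g)"
  using keys_mult[of f g] by (fastforce simp: plus_list_def)

lemma multihom_chain: "multihom (add_mset i (mset js)) (chain i js :: 'k::field free_poly)"
proof (induction js rule: rev_induct)
  case (snoc j js)
  have j: "multihom {#j#} (free_var j :: 'k free_poly)" by (simp add: free_var_def)
  have "multihom (add_mset i (mset js) + {#j#}) (commutator (chain i js) (free_var j) :: 'k free_poly)"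
    unfolding commutator_def
    using multihom_diff[OF multihom_mult[OF snoc j] multihom_mult[OF j snoc, unfolded add.commute[of "{#j#}"]]] .
  then show ?case by (simp add: chain_append)
qed (simp add: chain_def free_var_def)

definition chain_degree :: "(nat \<times> nat list) list \<Rightarrow> nat" where
  "chain_degree ps = (\<Sum>(i, js)\<leftarrow>ps. Suc (length js))"

definition chain_prod :: "(nat \<times> nat list) list \<Rightarrow> 'k::field free_poly" where
  "chain_prod ps = prod_list (map (\<lambda>(i, js). chain i js) ps)"

lemma chain_prod_simps [simp]:
  "chain_prod [] = 1" "chain_prod ((i, js) # ps) = chain i js * chain_prod ps"
  by (simp_all add: chain_prod_def)

lemma multihom_chain_prod:
  "\<exists>M. multihom M (chain_prod ps :: 'k::field free_poly) \<and> size M = chain_degree ps"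
proof (induction ps)
  case Nil
  show ?case by (rule exI[of _ "{#}"]) (simp add: chain_degree_def zero_list_def)
next
  case (Cons p ps)
  obtain i js where p: "p = (i, js)" by (cases p)
  obtain M where M: "multihom M (chain_prod ps :: 'k free_poly)" "size M = chain_degree ps"
    using Cons by blast
  have "multihom (add_mset i (mset js) + M) (chain_prod (p # ps) :: 'k free_poly)"
    unfolding p chain_prod_simps by (rule multihom_mult[OF multihom_chain M(1)])
  then show ?case using M(2) by (intro exI[of _ "add_mset i (mset js) + M"]) (simp add: p chain_degree_def)
qed

inductive_set chain_span :: "'k::field free_poly set" where
  prod: "\<forall>(i, js)\<in>set ps. js \<noteq> [] \<Longrightarrow> cst c * chain_prod ps \<in> chain_span"
| add: "f \<in> chain_span \<Longrightarrow> g \<in> chain_span \<Longrightarrow> f + g \<in> chain_span"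

lemma chain_span_mult_prod:
  fixes f :: "'k::field_char_0 free_poly"
  assumes "f \<in> chain_span" "\<forall>(i, js)\<in>set ps. js \<noteq> []"
  shows "cst c * chain_prod ps * f \<in> chain_span"
  using assms(1)
proof (induction rule: chain_span.induct)
  case (prod qs d)
  have "cst c * chain_prod ps * (cst d * chain_prod qs) = cst (c * d) * chain_prod (ps @ qs)"
    by (simp add: chain_prod_def cst.hom_mult cst.hom_left_commute[of "prod_list _" d] mult.assoc
        del: mult_single)
  then show ?case using chain_span.prod[of "ps @ qs" "c * d"] prod assms(2) by auto
qed (auto simp: distrib_left intro: chain_span.add)

lemma chain_span_mult: "f \<in> chain_span \<Longrightarrow> g \<in> chain_span \<Longrightarrow> f * g \<in> chain_span"
  for f :: "'k::field_char_0 free_poly"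
  by (induction f rule: chain_span.induct)
    (auto simp: distrib_right intro: chain_span.add chain_span_mult_prod)

lemma proper_polys_chain_span: "f \<in> proper_polys \<Longrightarrow> f \<in> chain_span"
  for f :: "'k::field_char_0 free_poly"
proof -
  assume "f \<in> proper_polys"
  then have "f \<in> generated_carrier free_algebra var_commutators"
    by (simp add: proper_polys_def subalgebra_generated_def)
  then show ?thesis
  proof (induction rule: generated_carrier.induct)
    case one
    show ?case using chain_span.prod[of "[]" 1] by (simp add: free_algebra_def)
  next
    case (base x)
    then obtain i js where "x = chain i js" "js \<noteq> []"
      by (auto simp: var_commutators_def chain_def)
    then show ?case using chain_span.prod[of "[(i, js)]" 1] by simp
  next
    case (smult x c)
    then show ?case using chain_span_mult_prod[of x "[]" c] by (simp add: free_algebra_def)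
  qed (simp_all add: free_algebra_def chain_span.add chain_span_mult)
qed

text \<open>The projection \<open>h\<close> to degree \<open>n\<close> fixes \<open>f\<close> and
  acts termwise on an expression of \<open>f\<close> by products of chains. Products of other
  degrees are left with coefficient \<open>0\<close>, hence the alternative
  \<open>c = 0\<close>.\<close>

lemma proper_polys_deg_induct [consumes 1, case_names add prod]:
  fixes f :: "'k::field_char_0 free_poly"
  assumes f: "f \<in> proper_polys_deg n"
    and add: "\<And>f g. P f \<Longrightarrow> P g \<Longrightarrow> P (f + g)"
    and prod: "\<And>c ps. \<forall>(i, js)\<in>set ps. js \<noteq> [] \<Longrightarrow> chain_degree ps = n \<or> c = 0 \<Longrightarrow> P (cst c * chain_prod ps)"
  shows "P f"
proof -
  define h :: "'k free_poly \<Rightarrow> 'k free_poly"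
    where "h = cst.lin (\<lambda>v. if length v = n then Poly_Mapping.single v 1 else 0)"
  have "h f = cst.lin (\<lambda>v. Poly_Mapping.single v 1) f"
    unfolding h_def using f by (intro cst.lin_cong) (simp add: proper_polys_deg_def)
  then have "h f = f" by (simp add: free_poly_eq_lin)
  moreover have "P (h f)"
  proof -
    have "f \<in> chain_span" using f by (simp add: proper_polys_deg_def proper_polys_chain_span)
    then show ?thesis
    proof (induction rule: chain_span.induct)
      case (prod ps c)
      obtain M where M: "multihom M (chain_prod ps :: 'k free_poly)" "size M = chain_degree ps"
        using multihom_chain_prod by blast
      have "h (chain_prod ps) = (if chain_degree ps = n then chain_prod ps else 0)"
      proof (cases "chain_degree ps = n")
        case True
        have "h (chain_prod ps) = cst.lin (\<lambda>v. Poly_Mapping.single v 1) (chain_prod ps)"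
          unfolding h_def using M True by (intro cst.lin_cong) (metis size_mset)
        then show ?thesis by (simp add: True free_poly_eq_lin)
      next
        case False
        have "h (chain_prod ps) = cst.lin (\<lambda>v. 0) (chain_prod ps)"
          unfolding h_def using M False by (intro cst.lin_cong) (metis size_mset)
        then show ?thesis by (simp add: False cst.lin_def)
      qed
      then have "h (cst c * chain_prod ps) = cst (if chain_degree ps = n then c else 0) * chain_prod ps"
        unfolding h_def cst.lin_scale by simp
      then show ?case using assms(3)[OF prod] by simp
    qed (simp add: h_def cst.lin_add add)
  qed
  ultimately show ?thesis by simp
qed

section \<open>Lie elements modulo the identities of \<open>UT\<^sub>2(K)\<close>\<close>

context scalar_hom
begin

lemma lin_single_mult:
  "lin E (Poly_Mapping.single u c * f) = \<iota> c * lin (\<lambda>v. E (u + v)) f" for E :: "'b::monoid_add \<Rightarrow> 'r"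
  by (induction f rule: free_poly_induct)
    (simp_all add: mult_single hom_mult mult.assoc lin_add distrib_left)

lemma lin_mult_single_one:
  "lin E (f * Poly_Mapping.single u 1) = lin (\<lambda>v. E (v + u)) f" for E :: "'b::monoid_add \<Rightarrow> 'r"
  by (induction f rule: free_poly_induct) (simp_all add: mult_single lin_add distrib_right)

lemma lin_commutator: "lin (\<lambda>v. commutator (E v) x) f = commutator (lin E f) x"
  by (simp add: commutator_def lin_fun_diff lin_mult_right lin_mult_left)

end

text \<open>Evaluation with every variable equal to \<open>1\<close>, so commutators are
  killed.\<close>

abbreviation augmentation :: "'k::field_char_0 free_poly \<Rightarrow> 'k" where
  "augmentation \<equiv> id_hom.lin (\<lambda>_. 1)"

lemma lin_const: "cst.lin (\<lambda>_. r) f = cst (augmentation f) * r"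
  by (induction f rule: free_poly_induct) (simp_all add: cst.lin_add id_hom.lin_add single_add distrib_right)

lemma augmentation_mult: "augmentation (f * g) = augmentation f * augmentation g"
  by (rule id_hom.lin_times) simp

lemma augmentation_commutator: "augmentation (commutator f g) = 0"
  by (simp add: commutator_def id_hom.lin_diff augmentation_mult)

lemma augmentation_chain: "js \<noteq> [] \<Longrightarrow> augmentation (chain i js) = 0"
  by (cases js rule: rev_cases) (simp_all add: chain_append augmentation_commutator)

definition first_letter :: "(nat \<Rightarrow> nat multiset \<Rightarrow> 'k::field_char_0 free_poly) \<Rightarrow> nat list \<Rightarrow> 'k free_poly" where
  "first_letter e v = (case v of [] \<Rightarrow> 0 | i # r \<Rightarrow> e i (mset r))"

lemma first_letter_simps [simp]:
  "first_letter e [] = 0" "first_letter e (i # r) = e i (mset r)"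
  by (simp_all add: first_letter_def)

text \<open>All words of \<open>u g\<close> share the first letter and the multiset of the others,
  so the value is a multiple of the augmentation of \<open>g\<close>. This makes products of several
  chains invisible.\<close>

lemma lin_first_letter_single_mult:
  assumes "multihom M g" "augmentation g = 0" "u \<noteq> []"
  shows "cst.lin (first_letter e) (Poly_Mapping.single u c * g) = 0"
proof -
  obtain i r where u: "u = i # r" using assms(3) by (cases u) auto
  have "cst.lin (\<lambda>v. first_letter e (u + v)) g = cst.lin (\<lambda>_. e i (mset r + M)) g"
    using assms(1) by (intro cst.lin_cong) (simp add: u plus_list_def)
  then show ?thesis by (simp add: cst.lin_single_mult lin_const assms(2))
qed

lemma lin_first_letter_mult:
  assumes "multihom M g" "augmentation g = 0" "[] \<notin> Poly_Mapping.keys h"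
  shows "cst.lin (first_letter e) (h * g) = 0"
proof -
  have "h * g = (\<Sum>u\<in>Poly_Mapping.keys h. Poly_Mapping.single u (Poly_Mapping.lookup h u) * g)"
    using free_poly_eq_lin[of h] by (simp add: cst.lin_def mult_single flip: sum_distrib_right)
  moreover have "cst.lin (first_letter e) (Poly_Mapping.single u (Poly_Mapping.lookup h u) * g) = 0"
    if "u \<in> Poly_Mapping.keys h" for u
    using that assms by (intro lin_first_letter_single_mult) auto
  ultimately show ?thesis by (simp add: cst.lin_sum)
qed

lemma chain_Cons_snoc: "chain i (j # js @ [k]) = commutator (chain i (j # js)) (free_var k)"
  using chain_append[of i "j # js" "[k]"] by simp

text \<open>On a chain \<open>f\<close> its linear extension acts like \<open>f |-> [f, x_m]\<close>
  up to neglected terms. Sorting only fixes one order of the letters after the second, which may be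
  permuted up to such terms.\<close>

definition chain_next :: "nat \<Rightarrow> nat \<Rightarrow> nat multiset \<Rightarrow> 'k::field_char_0 free_poly" where
  "chain_next m i M = chain i (m # sorted_list_of_multiset M)"

text \<open>The Dynkin operator brackets a word in its given order; since only the multiset of the
  later letters is available here, every letter takes its turn in second place. As in Euler's
  formula for homogeneous functions, the eigenvalue is the degree.\<close>

definition euler :: "nat \<Rightarrow> nat multiset \<Rightarrow> 'k::field_char_0 free_poly" where
  "euler i M = (\<Sum>j\<in>#M. chain_next j i (M - {#j#}))"

lemma euler_add_mset:
  "euler i (add_mset k M) = chain_next k i M + (\<Sum>j\<in>#M. chain_next j i (add_mset k (M - {#j#})))"
proof -
  have "(\<Sum>j\<in>#M. chain_next j i (add_mset k M - {#j#})) = (\<Sum>j\<in>#M. chain_next j i (add_mset k (M - {#j#})))"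
    by (intro arg_cong[of _ _ sum_mset] image_mset_cong) simp
  then show ?thesis by (simp add: euler_def)
qed

lemma foldl_commutator_diff:
  "foldl commutator (a - b) zs = foldl commutator a zs - foldl commutator b zs"
  by (induction zs arbitrary: a b) (simp_all add: commutator_diff_left)

text \<open>\<open>T n\<close> consists of elements of degree \<open>n\<close> that are to be neglected.\<close>

locale graded_congruence =
  fixes T :: "nat \<Rightarrow> 'k::field_char_0 free_poly set"
  assumes zero_T: "0 \<in> T n"
    and add_T: "a \<in> T n \<Longrightarrow> b \<in> T n \<Longrightarrow> a + b \<in> T n"
    and scale_T: "a \<in> T n \<Longrightarrow> cst c * a \<in> T n"
    and commutator_T: "a \<in> T n \<Longrightarrow> commutator a (free_var k) \<in> T (Suc n)"
    and swap_T: "js \<noteq> [] \<Longrightarrow>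
      commutator (chain i js) (commutator (free_var y) (free_var z)) \<in> T (length js + 3)"
begin

lemma diff_T: "a \<in> T n \<Longrightarrow> b \<in> T n \<Longrightarrow> a - b \<in> T n"
  using add_T[of a n "cst (- 1) * b"] scale_T[of b n "- 1"] by (simp add: single_uminus)

lemma trans_T: "a - b \<in> T n \<Longrightarrow> b - c \<in> T n \<Longrightarrow> a - c \<in> T n"
  using add_T[of "a - b" n "b - c"] by simp

lemma lin_T: "(\<And>w. w \<in> Poly_Mapping.keys f \<Longrightarrow> E w \<in> T n) \<Longrightarrow> cst.lin E f \<in> T n"
proof -
  assume E: "\<And>w. w \<in> Poly_Mapping.keys f \<Longrightarrow> E w \<in> T n"
  have "(\<Sum>w\<in>S. cst (Poly_Mapping.lookup f w) * E w) \<in> T n" if "S \<subseteq> Poly_Mapping.keys f" for S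
    using that
    by (induction S rule: infinite_finite_induct) (auto intro: zero_T add_T scale_T E)
  then show ?thesis by (simp add: cst.lin_def)
qed

lemma foldl_T: "a \<in> T n \<Longrightarrow> foldl commutator a (map free_var zs) \<in> T (n + length zs)"
  by (induction zs arbitrary: a n) (use commutator_T in fastforce)+

text \<open>By the Jacobi identity the difference is \<open>[[x_i, js], [y, z]]\<close> followed by
  \<open>vs\<close>. For empty \<open>js\<close> this would be a genuine Lie element, so the second
  letter of a chain has to stay in place.\<close>

lemma chain_swap:
  assumes "js \<noteq> []"
  shows "chain i (js @ y # z # vs) - chain i (js @ z # y # vs) \<in> T (length js + 3 + length vs)"
  using foldl_T[OF swap_T[OF assms]]
  by (simp add: chain_append flip: foldl_commutator_diff jacobi)

lemma chain_move:
  assumes "js \<noteq> []"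
  shows "chain i (js @ y # vs) - chain i (js @ vs @ [y]) \<in> T (length js + 2 + length vs)"
  using assms
proof (induction vs arbitrary: js)
  case (Cons z vs)
  have "chain i (js @ y # z # vs) - chain i (js @ z # y # vs) \<in> T (length js + 2 + length (z # vs))"
    using chain_swap[OF Cons.prems, of i y z vs] by (simp add: eval_nat_numeral)
  moreover have "chain i (js @ z # y # vs) - chain i (js @ (z # vs) @ [y]) \<in> T (length js + 2 + length (z # vs))"
    using Cons.IH[of "js @ [z]"] by simp
  ultimately show ?case by (rule trans_T)
qed (simp add: zero_T)

lemma chain_perm:
  "mset xs = mset ys \<Longrightarrow> chain i (j # xs) - chain i (j # ys) \<in> T (length xs + 2)"
proof (induction xs arbitrary: ys rule: rev_induct)
  case (snoc x xs)
  obtain as bs where ys: "ys = as @ x # bs"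
    using snoc.prems by (metis in_set_conv_decomp mset_eq_setD)
  have len: "length xs = length as + length bs"
    using snoc.prems[THEN arg_cong[of _ _ size]] by (simp add: ys)
  have "chain i (j # xs) - chain i (j # as @ bs) \<in> T (length xs + 2)"
    using snoc by (simp add: ys)
  from commutator_T[OF this, of x]
  have "chain i (j # xs @ [x]) - chain i (j # as @ bs @ [x]) \<in> T (length (xs @ [x]) + 2)"
    using chain_Cons_snoc[of i j xs x, where 'a = 'k] chain_Cons_snoc[of i j "as @ bs" x, where 'a = 'k]
    by (simp add: commutator_diff_left eval_nat_numeral)
  moreover have "chain i ((j # as) @ bs @ [x]) - chain i ((j # as) @ x # bs) \<in> T (length (xs @ [x]) + 2)"
    using diff_T[OF zero_T chain_move[of "j # as" i x bs]] by (simp add: len)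
  ultimately show ?case unfolding ys using trans_T by simp
qed (simp add: zero_T)

lemma chain_next_add_mset:
  "chain_next j i (add_mset k M) - commutator (chain_next j i M) (free_var k) \<in> T (size M + 3)"
proof -
  have "mset (sorted_list_of_multiset (add_mset k M)) = mset (sorted_list_of_multiset M @ [k])" by simp
  from chain_perm[OF this, of i j] show ?thesis
    using size_mset[of "sorted_list_of_multiset (add_mset k M)"]
    by (simp add: chain_next_def chain_Cons_snoc eval_nat_numeral del: size_mset)
qed

lemma first_letter_chain_next_snoc:
  assumes "v \<noteq> []"
  shows "first_letter (chain_next m) (v @ [k]) - commutator (first_letter (chain_next m) v) (free_var k)
    \<in> T (length v + 2)"
  using chain_next_add_mset[of m "hd v" k "mset (tl v)"] assms
  by (cases v) (simp_all add: eval_nat_numeral)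

text \<open>Appending \<open>k\<close> offers one new choice of second letter, \<open>k\<close>
  itself, which gives \<open>chain_next k\<close>; the old choices get \<open>k\<close> appended at
  the end, up to reordering.\<close>

lemma first_letter_euler_snoc:
  assumes "v \<noteq> []"
  shows "first_letter euler (v @ [k]) - (first_letter (chain_next k) v
      + commutator (first_letter euler v) (free_var k)) \<in> T (Suc (length v))"
proof -
  obtain i r where v: "v = i # r" using assms by (cases v) auto
  have "(\<Sum>j\<in>#N. chain_next j i (add_mset k (M - {#j#})))
      - commutator (\<Sum>j\<in>#N. chain_next j i (M - {#j#})) (free_var k) \<in> T (size M + 2)"
    if "N \<subseteq># M" for M N
    using that
  proof (induction N)
    case (add j N)
    have j: "j \<in># M" using add.prems by (meson mset_subset_eqD union_single_eq_member)
    have N: "N \<subseteq># M" using add.prems by (meson subset_mset.dual_order.trans mset_subset_eq_insertD subset_mset.less_imp_le)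
    have "size (M - {#j#}) + 3 = size M + 2"
      using j by (cases M) (auto simp: size_Diff_singleton)
    then have "chain_next j i (add_mset k (M - {#j#})) - commutator (chain_next j i (M - {#j#})) (free_var k)
        \<in> T (size M + 2)"
      using chain_next_add_mset[of j i k "M - {#j#}"] by (simp only:)
    from add_T[OF this add.IH[OF N]] show ?case
      by (simp add: commutator_add_left algebra_simps)
  qed (simp add: zero_T)
  from this[of "mset r" "mset r"] show ?thesis
    by (simp add: v euler_add_mset) (simp add: euler_def)
qed

text \<open>Both parts are proved together: when \<open>k\<close> is appended to a chain
  \<open>f\<close> of degree \<open>n\<close>, the Euler operator yields \<open>n [f, x_k]\<close>
  from the second part and one more \<open>[f, x_k]\<close> from the first with
  \<open>m = k\<close>. The words of \<open>x_k f\<close> contribute nothing, since \<open>f\<close>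
  has augmentation \<open>0\<close>.\<close>

lemma chain_euler:
  assumes "js \<noteq> []"
  shows "cst.lin (first_letter (chain_next m)) (chain i js) - commutator (chain i js) (free_var m)
      \<in> T (length js + 2)"
    and "cst.lin (first_letter euler) (chain i js) - of_nat (length js + 1) * chain i js \<in> T (length js + 1)"
proof -
  have "(\<forall>m. cst.lin (first_letter (chain_next m)) (chain i js) - commutator (chain i js) (free_var m)
      \<in> T (length js + 2))
    \<and> cst.lin (first_letter euler) (chain i js) - of_nat (length js + 1) * chain i js \<in> T (length js + 1)"
    using assms
  proof (induction js rule: rev_nonempty_induct)
    case (single j)
    have c: "chain i [j] = Poly_Mapping.single [i, j] 1 - Poly_Mapping.single [j, i] (1::'k)"
      by (simp add: chain_def commutator_def free_var_def mult_single plus_list_def)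
    have e: "chain_next m k {#l#} = commutator (chain k [m]) (free_var l :: 'k free_poly)"
      "euler k {#l#} = (chain k [l] :: 'k free_poly)" for m k l
      by (simp_all add: chain_next_def chain_def euler_def)
    have "commutator (chain i [m]) (free_var j) - commutator (chain j [m]) (free_var i)
        = commutator (chain i [j]) (free_var m :: 'k free_poly)" for m
      by (simp add: chain_def commutator_def algebra_simps)
    moreover have "chain j [i] = - (chain i [j] :: 'k free_poly)"
      by (simp add: chain_def commutator_def)
    moreover have "cst.lin (first_letter h) (chain i [j]) = h i {#j#} - h j {#i#}" for h :: "nat \<Rightarrow> nat multiset \<Rightarrow> 'k free_poly"
      by (simp add: c cst.lin_diff)
    ultimately show ?case by (simp add: e zero_T mult_2)
  next
    case (snoc k js)
    let ?f = "chain i js :: 'k free_poly" and ?x = "\<lambda>k. free_var k :: 'k free_poly"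
    have f': "chain i (js @ [k]) = ?f * Poly_Mapping.single [k] 1 - Poly_Mapping.single [k] 1 * ?f"
      by (simp add: chain_append commutator_def free_var_def)
    have len: "length v = length js + 1" if "v \<in> Poly_Mapping.keys ?f" for v
      using multihom_chain[of i js, where 'k = 'k] that by (metis size_mset size_add_mset Suc_eq_plus1)
    then have ne: "v \<noteq> []" if "v \<in> Poly_Mapping.keys ?f" for v using that by fastforce
    have lin: "cst.lin (first_letter e) (chain i (js @ [k])) = cst.lin (\<lambda>v. first_letter e (v @ [k])) ?f" for e
      unfolding f' cst.lin_diff cst.lin_mult_single_one
      by (simp add: lin_first_letter_single_mult[OF multihom_chain augmentation_chain[OF snoc.hyps(1)]]
          plus_list_def)
    have IH: "cst.lin (first_letter (chain_next m)) ?f - commutator ?f (?x m) \<in> T (length js + 2)"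
      "cst.lin (first_letter euler) ?f - of_nat (length js + 1) * ?f \<in> T (length js + 1)" for m
      using snoc.IH by blast+
    have "cst.lin (first_letter (chain_next m)) (chain i (js @ [k])) - commutator (chain i (js @ [k])) (?x m)
        \<in> T (length (js @ [k]) + 2)" for m
    proof -
      have "cst.lin (\<lambda>v. first_letter (chain_next m) (v @ [k]) - commutator (first_letter (chain_next m) v) (?x k)) ?f
          \<in> T (length js + 3)"
        using first_letter_chain_next_snoc[OF ne, of _ m k] by (intro lin_T) (auto simp: len numeral_3_eq_3)
      then have 1: "cst.lin (first_letter (chain_next m)) (chain i (js @ [k]))
          - commutator (cst.lin (first_letter (chain_next m)) ?f) (?x k) \<in> T (length js + 3)"
        by (simp add: lin cst.lin_fun_diff cst.lin_commutator)
      have 2: "commutator (cst.lin (first_letter (chain_next m)) ?f) (?x k)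
          - commutator (commutator ?f (?x m)) (?x k) \<in> T (length js + 3)"
        using commutator_T[OF IH(1)] by (simp add: commutator_diff_left numeral_3_eq_3)
      have 3: "commutator (commutator ?f (?x m)) (?x k) - commutator (chain i (js @ [k])) (?x m)
          \<in> T (length js + 3)"
        using chain_swap[OF snoc.hyps(1), of i m k "[]"] by (simp add: chain_append)
      show ?thesis using trans_T[OF trans_T[OF 1 2] 3] by (simp add: numeral_3_eq_3)
    qed
    moreover have "cst.lin (first_letter euler) (chain i (js @ [k]))
        - of_nat (length (js @ [k]) + 1) * chain i (js @ [k]) \<in> T (length (js @ [k]) + 1)"
    proof -
      let ?c = "commutator ?f (?x k)"
      have "cst.lin (\<lambda>v. first_letter euler (v @ [k]) - (first_letter (chain_next k) v
          + commutator (first_letter euler v) (?x k))) ?f \<in> T (length js + 2)"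
        using first_letter_euler_snoc[OF ne] by (intro lin_T) (auto simp: len)
      then have 1: "cst.lin (first_letter euler) (chain i (js @ [k]))
          - (cst.lin (first_letter (chain_next k)) ?f + commutator (cst.lin (first_letter euler) ?f) (?x k))
          \<in> T (length js + 2)"
        by (simp add: lin cst.lin_fun_diff cst.lin_fun_add cst.lin_commutator)
      have 2: "(cst.lin (first_letter (chain_next k)) ?f - ?c)
          + (commutator (cst.lin (first_letter euler) ?f) (?x k) - of_nat (length js + 1) * ?c) \<in> T (length js + 2)"
      proof (rule add_T[OF IH(1)])
        have "commutator (of_nat n * ?f) (?x k) = of_nat n * ?c" for n
          by (simp add: commutator_def algebra_simps mult_of_nat_commute)
        from commutator_T[OF IH(2), of k, unfolded commutator_diff_left this]
        show "commutator (cst.lin (first_letter euler) ?f) (?x k) - of_nat (length js + 1) * ?c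
            \<in> T (length js + 2)" by simp
      qed
      show ?thesis
        using add_T[OF 1 2] by (simp add: chain_append algebra_simps)
    qed
    ultimately show ?case by blast
  qed
  then show "cst.lin (first_letter (chain_next m)) (chain i js) - commutator (chain i js) (free_var m)
      \<in> T (length js + 2)"
    "cst.lin (first_letter euler) (chain i js) - of_nat (length js + 1) * chain i js \<in> T (length js + 1)"
    by blast+
qed

end

section \<open>T-ideals with central products of two commutators\<close>

locale mid_central_T_ideal = T_ideal I + mid_central_ideal I
  for I :: "'k::field_char_0 free_poly set"
begin

sublocale scalar_mid_central_ideal cst I ..

text \<open>Centrality alone does not give an ideal; the annihilation conditions do, as
  \<open>[r a, z] = r [a, z] + [r, z] a\<close>.\<close>

definition almost_central :: "'k free_poly set" where
  "almost_central = {r. (\<forall>z. commutator r z \<in> I) \<and> (\<forall>w\<in>comm_ideal. r * w \<in> I \<and> w * r \<in> I)}"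

lemma scalar_square_ideal_almost_central: "scalar_square_ideal cst almost_central"
proof
  show "0 \<in> almost_central" by (simp add: almost_central_def zero_mem)
  show "a + b \<in> almost_central" if "a \<in> almost_central" "b \<in> almost_central" for a b
    using that by (simp add: almost_central_def commutator_add_left distrib_left distrib_right add_mem)
  show "r * a \<in> almost_central" "a * r \<in> almost_central" if a: "a \<in> almost_central" for a r
  proof -
    have c: "commutator r z * a \<in> I" "a * commutator r z \<in> I" "commutator a z \<in> I" for z
      using a by (simp_all add: almost_central_def commutator_in_comm_ideal)
    have w: "r * (a * w) \<in> I" "(w * r) * a \<in> I" "a * (r * w) \<in> I" "(w * a) * r \<in> I"
      if "w \<in> comm_ideal" for w
      using a that
      by (simp_all add: almost_central_def mult_left_mem mult_right_mem CI.mult_left_mem CI.mult_right_mem)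
    show "r * a \<in> almost_central" "a * r \<in> almost_central"
      using c w by (simp_all add: almost_central_def commutator_mult_left mult.assoc
          add_mem mult_left_mem mult_right_mem)
  qed
  show "u * v \<in> almost_central" if "u \<in> comm_ideal" "v \<in> comm_ideal" for u v
    using that by (auto simp: almost_central_def central_comm_ideal triple_comm_ideal
        simp flip: mult.assoc intro: triple_comm_ideal)
qed

lemma I_subset_almost_central: "I \<subseteq> almost_central"
  by (auto simp: almost_central_def commutator_mem mult_left_mem mult_right_mem)

definition long_products_vanish :: "nat \<Rightarrow> bool" where
  "long_products_vanish m \<longleftrightarrow> (\<forall>w\<in>comm_ideal. \<forall>w'\<in>comm_ideal. \<forall>zs. length zs = m \<longrightarrow>
     foldl commutator w zs * w' \<in> I)"

text \<open>Since \<open>u v\<close> is central, \<open>u [v, z]\<close> is congruent to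
  \<open>- [u, z] v\<close>: letters pass from the second factor to the first, and only their total
  number matters.\<close>

lemma long_products_mem:
  assumes m: "long_products_vanish m" and w: "w \<in> comm_ideal" "w' \<in> comm_ideal"
    and "length zs + length zs' \<ge> m"
  shows "foldl commutator w zs * foldl commutator w' zs' \<in> I"
  using assms(4)
proof (induction zs' arbitrary: zs rule: rev_induct)
  case Nil
  have "foldl commutator (foldl commutator w (take (length zs - m) zs)) (drop (length zs - m) zs) * w' \<in> I"
    using m w Nil by (auto simp: long_products_vanish_def foldl_commutator_mem)
  then show ?case by (simp flip: foldl_append)
next
  case (snoc z zs')
  let ?a = "foldl commutator w zs" and ?b = "foldl commutator w' zs'"
  have "?a * commutator ?b z = commutator (?a * ?b) z - commutator ?a z * ?b"
    by (simp add: commutator_mult_left)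
  moreover have "commutator ?a z * ?b \<in> I" using snoc.IH[of "zs @ [z]"] snoc.prems by simp
  ultimately show ?case
    using diff_mem[OF central_comm_ideal[OF foldl_commutator_mem[OF w(1)] foldl_commutator_mem[OF w(2)]]]
    by simp
qed

text \<open>The \<open>2\<close> accounts for the first letters of \<open>js\<close> and
  \<open>js'\<close>, used up by the innermost commutators. In terms of total degree the bound is
  \<open>m + 4\<close>.\<close>

lemma chain_mult_mem:
  assumes m: "long_products_vanish m" and "js \<noteq> []" "js' \<noteq> []" "length js + length js' \<ge> m + 2"
  shows "chain i js * chain i' js' \<in> I"
proof -
  obtain j l where js: "js = j # l" using assms(2) by (cases js) auto
  obtain j' l' where js': "js' = j' # l'" using assms(3) by (cases js') auto
  show ?thesis unfolding js js' chain_Cons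
    using assms(4) by (intro long_products_mem[OF m] commutator_in_comm_ideal) (simp add: js js')
qed

lemma chain_prod_mem:
  assumes m: "long_products_vanish m" and "\<forall>(i, js)\<in>set ps. js \<noteq> []"
    and "chain_degree ps \<ge> m + 4" "length ps \<noteq> 1"
  shows "chain_prod ps \<in> I"
proof -
  consider "ps = []" | p where "ps = [p]" | p q where "ps = [p, q]" | p q r qs where "ps = p # q # r # qs"
    by (metis neq_Nil_conv)
  then show ?thesis
  proof cases
    case 1 with assms(3) show ?thesis by (simp add: chain_degree_def)
  next
    case 2 with assms(4) show ?thesis by simp
  next
    case 3
    obtain i js i' js' where "p = (i, js)" "q = (i', js')" by (metis surj_pair)
    then show ?thesis using assms(2,3) chain_mult_mem[OF m, of js js' i i'] by (simp add: 3 chain_degree_def)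
  next
    case 4
    obtain i js i' js' i'' js'' where "p = (i, js)" "q = (i', js')" "r = (i'', js'')" by (metis surj_pair)
    then show ?thesis
      using assms(2) mult_right_mem[OF triple_comm_ideal[OF chain_comm_ideal chain_comm_ideal chain_comm_ideal], of js js' js'']
      by (simp add: 4 mult.assoc)
  qed
qed

text \<open>Crossing the threshold is harmless because commutators carry
  \<open>almost_central\<close> into \<open>I\<close>. Above it, a swap changes a chain by products
  of two chains long enough to lie in \<open>I\<close>; below it, by products of two elements of
  \<open>comm_ideal\<close>.\<close>

lemma graded_congruence_I:
  assumes m: "long_products_vanish m"
  shows "graded_congruence (\<lambda>n. if n \<ge> m + 4 then I else almost_central)"
proof -
  interpret C: scalar_square_ideal cst almost_central by (rule scalar_square_ideal_almost_central)
  show ?thesis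
  proof
    fix n a b c k i y z and js :: "nat list"
    let ?T = "\<lambda>n. if n \<ge> m + 4 then I else almost_central"
    show "0 \<in> ?T n" by (simp add: zero_mem C.zero_mem)
    show "a \<in> ?T n \<Longrightarrow> b \<in> ?T n \<Longrightarrow> a + b \<in> ?T n" by (simp add: add_mem C.add_mem split: if_splits)
    show "a \<in> ?T n \<Longrightarrow> cst c * a \<in> ?T n" by (simp add: mult_left_mem C.mult_left_mem split: if_splits)
    have "commutator a (free_var k) \<in> I" if "a \<in> almost_central"
      using that by (simp add: almost_central_def)
    then show "a \<in> ?T n \<Longrightarrow> commutator a (free_var k) \<in> ?T (Suc n)"
      using I_subset_almost_central by (auto split: if_splits)
    let ?c = "commutator (free_var y) (free_var z)"
    assume js: "js \<noteq> []"
    show "commutator (chain i js) ?c \<in> ?T (length js + 3)"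
    proof (cases "length js + 3 \<ge> m + 4")
      case True
      have c: "?c = (chain y [z] :: 'k free_poly)" by (simp add: chain_def)
      have "commutator (chain i js) ?c \<in> I"
        unfolding commutator_def[of "chain i js"] c using True js
        by (intro diff_mem chain_mult_mem[OF m]) simp_all
      with True show ?thesis by simp
    next
      case False
      have "commutator (chain i js) ?c \<in> almost_central"
        unfolding commutator_def[of "chain i js"]
        by (intro C.diff_mem C.square chain_comm_ideal js commutator_in_comm_ideal)
      then show ?thesis using False by simp
    qed
  qed
qed

lemma of_nat_cancel: "of_nat n * a \<in> I \<Longrightarrow> n \<noteq> 0 \<Longrightarrow> a \<in> I"
proof -
  interpret scalar_ideal cst I ..
  show "of_nat n * a \<in> I \<Longrightarrow> n \<noteq> 0 \<Longrightarrow> a \<in> I"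
    using scalar_cancel[of "of_nat n" a] by simp
qed

text \<open>Modulo \<open>I\<close> the Euler operator is multiplication by \<open>n\<close> on
  proper polynomials of degree \<open>n\<close>: on single chains by \<open>chain_euler\<close>,
  while a product of several chains is killed by it and lies in \<open>I\<close> anyway. On
  identities of \<open>UT2\<close> the operator is zero.\<close>

lemma proper_UT2_identity_mem:
  assumes m: "long_products_vanish m" and n: "n \<ge> m + 4"
    and f: "f \<in> proper_polys_deg n" "f \<in> identities UT2"
  shows "f \<in> I"
proof -
  interpret graded_congruence "\<lambda>n. if n \<ge> m + 4 then I else almost_central"
    by (rule graded_congruence_I[OF m])
  have "cst.lin (first_letter euler) f - of_nat n * f \<in> I"
    using f(1)
  proof (induction rule: proper_polys_deg_induct)
    case (add f g)
    then show ?case using add_mem[OF add] by (simp add: cst.lin_add algebra_simps)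
  next
    case (prod c ps)
    show ?case
    proof (cases "c = 0")
      case False
      then have deg: "chain_degree ps = n" using prod by simp
      have "cst.lin (first_letter euler) (chain_prod ps) - of_nat n * chain_prod ps \<in> I"
      proof (cases "length ps = 1")
        case True
        then obtain i js where ps: "ps = [(i, js)]" by (metis One_nat_def length_0_conv length_Suc_conv surj_pair)
        then have "js \<noteq> []" "length js + 1 = n" using prod(1) deg by (simp_all add: chain_degree_def)
        then show ?thesis using chain_euler(2)[of js i] n by (simp add: ps)
      next
        case False
        have mem: "chain_prod ps \<in> I"
          using chain_prod_mem[OF m prod(1)] False deg n by simp
        obtain i js q qs where ps: "ps = (i, js) # q # qs"
          using False deg n by (cases ps; cases "tl ps") (auto simp: chain_degree_def)
        obtain i' js' where q: "q = (i', js')" by (cases q)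
        obtain M where M: "multihom M (chain_prod (q # qs) :: 'k free_poly)"
          using multihom_chain_prod by blast
        have "augmentation (chain_prod (q # qs)) = 0"
          using prod(1) by (simp add: ps q augmentation_mult augmentation_chain)
        moreover have "[] \<notin> Poly_Mapping.keys (chain i js :: 'k free_poly)"
          using multihom_chain[of i js, where 'k = 'k] by fastforce
        ultimately have "cst.lin (first_letter euler) (chain_prod ps) = (0 :: 'k free_poly)"
          using lin_first_letter_mult[OF M] by (simp add: ps)
        then show ?thesis using mult_left_mem[OF uminus_mem[OF mem]] by simp
      qed
      from mult_left_mem[OF this, of "cst c"] show ?thesis
        by (simp add: cst.lin_scale right_diff_distrib mult_of_nat_commute mult.assoc)
    qed (simp add: zero_mem)
  qed
  moreover have "cst.lin (first_letter euler) f = 0"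
    unfolding first_letter_def by (rule lin_first_letter_eq_0[OF f(2)])
  ultimately have "- (of_nat n * f) \<in> I" by simp
  from uminus_mem[OF this] have "of_nat n * f \<in> I" by simp
  moreover have "n \<noteq> 0" using n by simp
  ultimately show ?thesis by (rule of_nat_cancel)
qed

end

section \<open>Consequences of one identity\<close>

lemma lin_act: "cst.lin (\<lambda>v. cst.act z (X v) w) f = cst.act z (poly_hom.lin X f) w"
proof (induction f rule: free_poly_induct)
  case (single v c)
  show ?case using cst.act_smult_const[of z c "X v" w] by simp
qed (simp add: cst.lin_add poly_hom.lin_add cst.act_add)

text \<open>At \<open>\<alpha> = 1\<close> and \<open>s = -1\<close>, left multiplication by \<open>z\<close> becomes \<open>1\<close> and right multiplication
  becomes \<open>0\<close>.\<close>

definition corner :: "'k::field_char_0 poly poly \<Rightarrow> 'k" where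
  "corner H = poly (poly H 1) (- 1)"

lemma corner_simps [simp]:
  "corner 0 = 0" "corner 1 = 1" "corner (G + H) = corner G + corner H"
  "corner (G * H) = corner G * corner H" "corner [:[:c:]:] = c"
  "corner (cst.left_line d (a - d)) = a" "corner (cst.right_line d (a - d)) = d"
  by (simp_all add: corner_def cst.left_line_def cst.right_line_def)

lemma corner_lin: "corner (poly_hom.lin X f) = id_hom.lin (\<lambda>v. corner (X v)) f"
proof (induction f rule: free_poly_induct)
  case (single v c)
  show ?case by (simp del: mult_pCons_left)
qed (simp add: poly_hom.lin_add id_hom.lin_add)

lemma corner_prod_list: "corner (prod_list (map x v)) = prod_list (map (\<lambda>j. corner (x j)) v)"
  by (induction v) simp_all

lemma corner_path1: "corner (path1 a b d v) = path1 (\<lambda>j. corner (a j)) (\<lambda>j. corner (b j)) (\<lambda>j. corner (d j)) v"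
  by (induction v) (simp_all add: corner_prod_list)

lemma corner_path2:
  "corner (path2 a b d c e v) = path2 (\<lambda>j. corner (a j)) (\<lambda>j. corner (b j)) (\<lambda>j. corner (d j))
     (\<lambda>j. corner (c j)) (\<lambda>j. corner (e j)) v"
  by (induction v) (simp_all add: corner_path1)

context mid_central_T_ideal
begin

lemma not_UT2_identity:
  assumes f: "f \<in> I" "f \<notin> identities UT2"
  shows "\<exists>N. \<forall>n\<ge>N. proper_polys_deg n \<subseteq> I"
proof -
  interpret S: scalar_ideal cst I ..
  interpret C: scalar_square_ideal cst almost_central by (rule scalar_square_ideal_almost_central)
  consider a where "id_hom.lin (\<lambda>v. prod_list (map a v)) f \<noteq> 0" | a b d where "id_hom.lin (path1 a b d) f \<noteq> 0"
    using f(2) unfolding identities_UT2_iff by blast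
  then show ?thesis
  proof cases
    \<comment> \<open>Here \<open>f\<close> is not even an identity of \<open>K\<close>:
      substituting scalars yields a nonzero constant, and \<open>I\<close> is the whole free
      algebra.\<close>
    case 1
    have "prod_list (map (\<lambda>j. cst (a j)) v) = cst (prod_list (map a v))" for v
      by (induction v) (simp_all add: cst.hom_mult)
    then have "subst (\<lambda>j. cst (a j)) f = cst (id_hom.lin (\<lambda>v. prod_list (map a v)) f)"
      by (simp add: subst_def cst.lin_def id_hom.lin_def cst.hom_sum cst.hom_mult)
    then have "1 \<in> I"
      using subst_mem[OF f(1), of "\<lambda>j. cst (a j)"] S.scalar_cancel[OF _ 1, of 1] by simp
    then have "g \<in> I" for g using mult_left_mem[of 1 g] by simp
    then show ?thesis by blast
  next
    case 2
    \<comment> \<open>With these coefficients \<open>corner\<close> sends the left line to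
      \<open>a j\<close> and the right line to \<open>d j\<close>, so it recovers the nonzero entry
      of \<open>f\<close> and shows that \<open>H\<close> is not zero.\<close>
    let ?l = d and ?m = "\<lambda>j. a j - d j"
    define X where "X = path1 (\<lambda>j. cst.left_line (?l j) (?m j)) (\<lambda>j. [:[:b j:]:]) (\<lambda>j. cst.right_line (?l j) (?m j))"
    define H where "H = poly_hom.lin X f"
    have "corner H \<noteq> 0" using 2 by (simp add: H_def X_def corner_lin corner_path1)
    then have "H \<noteq> 0" by auto
    have act: "cst.act z H w \<in> almost_central" if w: "w \<in> comm_ideal" for z w
    proof -
      define \<zeta> where "\<zeta> j = cst.line z (?l j) (?m j)" for j
      have "cst.lin (\<lambda>v. prod_list (map (\<lambda>j. \<zeta> j + cst (b j) * w) v) - prod_list (map \<zeta> v)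
          - cst.act z (X v) w) f \<in> almost_central"
        unfolding X_def \<zeta>_def
        by (intro C.lin_mem cst.scalar_hom_axioms C.first_order_terms w)
      then have "subst (\<lambda>j. \<zeta> j + cst (b j) * w) f - subst \<zeta> f - cst.act z H w \<in> almost_central"
        by (simp add: cst.lin_fun_diff lin_act subst_def H_def)
      moreover have "subst (\<lambda>j. \<zeta> j + cst (b j) * w) f - subst \<zeta> f \<in> almost_central"
        using I_subset_almost_central by (auto intro: diff_mem subst_mem f)
      ultimately show ?thesis using C.cong_mem by blast
    qed
    obtain m where m: "\<And>w zs. w \<in> comm_ideal \<Longrightarrow> length zs = m \<Longrightarrow> foldl commutator w zs \<in> almost_central"
      using C.long_commutators_mem[OF act \<open>H \<noteq> 0\<close>] by blast
    then have long: "long_products_vanish m"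
      by (auto simp: long_products_vanish_def almost_central_def)
    \<comment> \<open>The first \<open>m\<close> letters lead into \<open>almost_central\<close>,
      the next one into \<open>I\<close>.\<close>
    have comm: "foldl commutator w zs \<in> I" if w: "w \<in> comm_ideal" and len: "length zs > m" for w zs
    proof -
      obtain z zs' where zs: "drop m zs = z # zs'" using len by (metis Cons_nth_drop_Suc)
      have "commutator (foldl commutator w (take m zs)) z \<in> I"
        using m[OF w, of "take m zs"] len by (simp add: almost_central_def)
      moreover have "a \<in> I \<Longrightarrow> foldl commutator a ys \<in> I" for a ys
        by (induction ys arbitrary: a) (auto intro: commutator_mem)
      ultimately have "foldl commutator (foldl commutator w (take m zs)) (drop m zs) \<in> I"
        by (simp add: zs)
      then show ?thesis by (simp flip: foldl_append)
    qed
    have "g \<in> I" if n: "n \<ge> m + 4" and g: "g \<in> proper_polys_deg n" for n g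
      using g
    proof (induction rule: proper_polys_deg_induct)
      case (prod c ps)
      show ?case
      proof (cases "c = 0")
        case False
        then have deg: "chain_degree ps = n" using prod by simp
        have "chain_prod ps \<in> I"
        proof (cases "length ps = 1")
          case True
          then obtain i js where ps: "ps = [(i, js)]"
            by (metis One_nat_def length_0_conv length_Suc_conv surj_pair)
          then obtain j l where "js = j # l" "length l > m"
            using prod(1) deg n by (cases js) (auto simp: chain_degree_def)
          then show ?thesis
            by (simp add: ps chain_Cons comm commutator_in_comm_ideal)
        next
          case False
          then show ?thesis using chain_prod_mem[OF long prod(1)] deg n by simp
        qed
        then show ?thesis by (rule mult_left_mem)
      qed (simp add: zero_mem)
    qed (rule add_mem)
    then show ?thesis by blast
  qed
qed

text \<open>The part of a substitution that is bilinear in \<open>w\<close>, \<open>w'\<close> has the form \<open>G(w) w' + H(w') w\<close>.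
  Since products of two elements of the commutator ideal are central, replacing \<open>w'\<close> by \<open>z w'\<close>
  and subtracting \<open>z\<close> times the original eliminates \<open>H\<close>.\<close>

lemma second_order_consequence:
  assumes f: "f \<in> I" and nonzero: "id_hom.lin (path2 a b d c a) f \<noteq> 0"
  shows "\<exists>m. long_products_vanish m"
proof -
  \<comment> \<open>Membership of long commutators in this left annihilator of
    \<open>comm_ideal\<close> modulo \<open>I\<close> is exactly
    \<open>long_products_vanish\<close>.\<close>
  define J where "J = {r. \<forall>w\<in>comm_ideal. r * w \<in> I}"
  interpret J: scalar_square_ideal cst J
  proof
    show "u * v \<in> J" if "u \<in> comm_ideal" "v \<in> comm_ideal" for u v
      using that by (simp add: J_def triple_comm_ideal)
  qed (auto simp: J_def zero_mem distrib_right mult.assoc intro: add_mem mult_left_mem CI.mult_left_mem)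
  let ?l = d and ?m = "\<lambda>j. a j - d j"
  define L where "L j = cst.left_line (?l j) (?m j)" for j
  define R where "R j = cst.right_line (?l j) (?m j)" for j
  define Y where "Y b c = poly_hom.lin (path2 L (\<lambda>j. [:[:b j:]:]) R (\<lambda>j. [:[:c j:]:]) L) f" for b c
  have "corner (Y b c) \<noteq> 0" using nonzero by (simp add: Y_def L_def R_def corner_lin corner_path2)
  then have "Y b c \<noteq> 0" by auto
  have bilinear: "cst.act z (Y b c) w * w' + cst.act z (Y c b) w' * w \<in> I"
    if w: "w \<in> comm_ideal" "w' \<in> comm_ideal" for z w w'
  proof -
    define \<zeta> where "\<zeta> j = cst.line z (?l j) (?m j)" for j
    let ?s = "subst (\<lambda>j. \<zeta> j + cst (b j) * w + cst (c j) * w') f - subst (\<lambda>j. \<zeta> j + cst (b j) * w) f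
      - subst (\<lambda>j. \<zeta> j + cst (c j) * w') f + subst \<zeta> f"
    have "cst.lin (\<lambda>v. prod_list (map (\<lambda>j. \<zeta> j + cst (b j) * w + cst (c j) * w') v)
      - prod_list (map (\<lambda>j. \<zeta> j + cst (b j) * w) v)
      - prod_list (map (\<lambda>j. \<zeta> j + cst (c j) * w') v) + prod_list (map \<zeta> v)
      - (cst.act z (path2 L (\<lambda>j. [:[:b j:]:]) R (\<lambda>j. [:[:c j:]:]) L v) w * w'
         + cst.act z (path2 L (\<lambda>j. [:[:c j:]:]) R (\<lambda>j. [:[:b j:]:]) L v) w' * w)) f \<in> I"
      unfolding \<zeta>_def L_def R_def
      by (intro lin_mem cst.scalar_hom_axioms second_order_terms w)
    then have "?s - (cst.act z (Y b c) w * w' + cst.act z (Y c b) w' * w) \<in> I"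
      by (simp add: cst.lin_fun_diff cst.lin_fun_add cst.lin_mult_right lin_act subst_def Y_def)
    moreover have "?s \<in> I" by (intro add_mem diff_mem subst_mem f)
    ultimately show ?thesis using cong_mem by blast
  qed
  \<comment> \<open>The elimination leaves \<open>[G(w), z] w'\<close>, so \<open>G\<close> is
    multiplied by the inner variable.\<close>
  define H where "H = Polynomial.smult [:0, 1:] (Y b c)"
  have "H \<noteq> 0" using \<open>Y b c \<noteq> 0\<close> by (simp add: H_def)
  have "cst.act z H w * w' \<in> I" if w: "w \<in> comm_ideal" "w' \<in> comm_ideal" for z w w'
  proof -
    have "cst.act z H w * w' = (cst.act z (Y b c) w * (z * w') + cst.act z (Y c b) (z * w') * w)
        - z * (cst.act z (Y b c) w * w' + cst.act z (Y c b) w' * w)"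
      unfolding H_def cst.act_smult_inner cst.act_left by (simp add: commutator_def algebra_simps)
    moreover have "\<dots> \<in> I"
      by (intro diff_mem mult_left_mem bilinear w CI.mult_left_mem)
    ultimately show ?thesis by simp
  qed
  then have "cst.act z H w \<in> J" if "w \<in> comm_ideal" for z w
    using that by (simp add: J_def)
  then obtain m where "\<And>w zs. w \<in> comm_ideal \<Longrightarrow> length zs = m \<Longrightarrow> foldl commutator w zs \<in> J"
    using J.long_commutators_mem[OF _ \<open>H \<noteq> 0\<close>] by blast
  then show ?thesis by (auto simp: long_products_vanish_def J_def)
qed

end

section \<open>Parity and order in a Grassmann algebra\<close>

text \<open>Each pair of \<open>A x B\<close> is an inversion of \<open>(A, B)\<close> or, swapped,
  of \<open>(B, A)\<close>.\<close>

lemma gsign_flip: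
  fixes A B :: "'y::{finite, linorder} set"
  assumes "A \<inter> B = {}"
  shows "gsign A B = ((- 1) ^ (card A * card B) * gsign B A :: 'r::comm_ring_1)"
proof -
  have "A \<times> B = inversions A B \<union> prod.swap ` inversions B A"
    using assms by (force simp: inversions_def)
  moreover have "inversions A B \<inter> prod.swap ` inversions B A = {}"
    by (auto simp: inversions_def)
  ultimately have "card (A \<times> B) = card (inversions A B) + card (prod.swap ` inversions B A)"
    by (simp add: card_Un_disjoint)
  then have n: "card A * card B = card (inversions A B) + card (inversions B A)"
    by (simp add: card_cartesian_product card_image)
  show ?thesis unfolding n gsign_def by (simp add: power_add mult.assoc flip: power_mult_distrib)
qed

text \<open>\<open>True\<close> stands for even, so that a product has parity
  \<open>p = q\<close>.\<close>

definition gparity :: "bool \<Rightarrow> ('y::{finite, linorder}, 'r::comm_ring_1) grassmann \<Rightarrow> bool" where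
  "gparity p f \<longleftrightarrow> (\<forall>S. even (card S) \<noteq> p \<longrightarrow> gcoeff f S = 0)"

lemma gparity_zero [simp]: "gparity p 0"
  by (simp add: gparity_def zero_grassmann.rep_eq)

lemma gparity_add: "gparity p f \<Longrightarrow> gparity p g \<Longrightarrow> gparity p (f + g)"
  by (simp add: gparity_def plus_grassmann.rep_eq)

lemma gparity_diff: "gparity p f \<Longrightarrow> gparity p g \<Longrightarrow> gparity p (f - g)"
  by (simp add: gparity_def minus_grassmann.rep_eq)

lemma gparity_geven [simp]: "gparity True (geven r)"
  by (auto simp: gparity_def geven.rep_eq)

lemma gparity_one [simp]: "gparity True 1"
  by (auto simp: gparity_def one_grassmann.rep_eq)

lemma gparity_godd [simp]: "gparity False (godd i)"
  by (auto simp: gparity_def godd.rep_eq)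

lemma gparity_mult:
  assumes "gparity p f" "gparity q g"
  shows "gparity (p = q) (f * g)"
  unfolding gparity_def
proof (intro allI impI)
  fix S :: "'a set" assume S: "even (card S) \<noteq> (p = q)"
  have "gsign A (S - A) * gcoeff f A * gcoeff g (S - A) = 0" if "A \<in> Pow S" for A
  proof -
    have "card S = card A + card (S - A)"
      using that by (metis Pow_iff card_Diff_subset card_mono finite le_add_diff_inverse)
    then have "even (card A) \<noteq> p \<or> even (card (S - A)) \<noteq> q" using S by auto
    then show ?thesis using assms by (auto simp: gparity_def)
  qed
  then show "gcoeff (f * g) S = 0" by (simp add: gcoeff_times)
qed

lemma gparity_mults:
  "gparity True f \<Longrightarrow> gparity True g \<Longrightarrow> gparity True (f * g)"
  "gparity True f \<Longrightarrow> gparity False g \<Longrightarrow> gparity False (f * g)"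
  "gparity False f \<Longrightarrow> gparity True g \<Longrightarrow> gparity False (f * g)"
  "gparity False f \<Longrightarrow> gparity False g \<Longrightarrow> gparity True (f * g)"
  by (drule (1) gparity_mult, simp)+

lemma supercommute:
  assumes "gparity p f" "gparity q g"
  shows "f * g = (if p \<or> q then g * f else - (g * f))"
proof -
  have "gcoeff (f * g) S = (if p \<or> q then 1 else - 1) * gcoeff (g * f) S" for S
  proof -
    have "gcoeff (f * g) S = (\<Sum>A\<in>Pow S. gsign (S - A) A * gcoeff f (S - A) * gcoeff g A)"
      unfolding gcoeff_times
      by (rule sum.reindex_bij_witness[of _ "\<lambda>A. S - A" "\<lambda>A. S - A"])
        (auto simp: double_diff)
    also have "\<dots> = (\<Sum>A\<in>Pow S. (if p \<or> q then 1 else - 1) * (gsign A (S - A) * gcoeff g A * gcoeff f (S - A)))"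
    proof (rule sum.cong[OF refl])
      fix A assume "A \<in> Pow S"
      have sgn: "gsign (S - A) A = ((- 1) ^ (card (S - A) * card A) * gsign A (S - A) :: 'b)"
        by (rule gsign_flip) auto
      show "gsign (S - A) A * gcoeff f (S - A) * gcoeff g A
          = (if p \<or> q then 1 else - 1) * (gsign A (S - A) * gcoeff g A * gcoeff f (S - A))"
      proof (cases "even (card (S - A)) = p \<and> even (card A) = q")
        case True
        then have "(- 1) ^ (card (S - A) * card A) = (if p \<or> q then 1 else - 1 :: 'b)"
          by (auto simp: power_minus_odd)
        then show ?thesis unfolding sgn by (simp add: mult_ac)
      qed (use assms in \<open>auto simp: gparity_def\<close>)
    qed
    finally show ?thesis by (simp add: gcoeff_times sum_distrib_left)
  qed
  then show ?thesis
    by (auto simp: gcoeff_inject[symmetric] fun_eq_iff uminus_grassmann.rep_eq)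
qed

text \<open>Counting odd variables replaces explicit computation where an arbitrary odd factor
  occurs: over four odd generators, order above \<open>4\<close> forces \<open>0\<close>.\<close>

definition gorder :: "nat \<Rightarrow> ('y::{finite, linorder}, 'r::comm_ring_1) grassmann \<Rightarrow> bool" where
  "gorder k f \<longleftrightarrow> (\<forall>S. card S < k \<longrightarrow> gcoeff f S = 0)"

lemma gorder_diff: "gorder k f \<Longrightarrow> gorder k g \<Longrightarrow> gorder k (f - g)"
  by (simp add: gorder_def minus_grassmann.rep_eq)

lemma gorder_mult:
  assumes "gorder k f" "gorder l g"
  shows "gorder (k + l) (f * g)"
  unfolding gorder_def
proof (intro allI impI)
  fix S :: "'a set" assume S: "card S < k + l"
  have "gsign A (S - A) * gcoeff f A * gcoeff g (S - A) = 0" if "A \<in> Pow S" for A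
  proof -
    have "card S = card A + card (S - A)"
      using that by (metis Pow_iff card_Diff_subset card_mono finite le_add_diff_inverse)
    then have "card A < k \<or> card (S - A) < l" using S by auto
    then show ?thesis using assms by (auto simp: gorder_def)
  qed
  then show "gcoeff (f * g) S = 0" by (simp add: gcoeff_times)
qed

lemma gorder_0 [simp]: "gorder 0 f"
  by (simp add: gorder_def)

lemma gorder_odd: "gparity False f \<Longrightarrow> gorder (Suc 0) f"
  by (auto simp: gorder_def gparity_def)

lemma gorder_vanish:
  fixes f :: "('y::{finite, linorder}, 'r::comm_ring_1) grassmann"
  assumes "gorder k f" "CARD('y) < k"
  shows "f = 0"
proof -
  have "card S < k" for S :: "'y set"
    using card_mono[of UNIV S] assms(2) by simp
  then show ?thesis
    using assms(1) by (auto simp: gorder_def gcoeff_inject[symmetric] fun_eq_iff zero_grassmann.rep_eq)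
qed

section \<open>Two generic supermatrices\<close>

text \<open>Only the commutation rules of the entries are kept, so that the matrix identities reduce
  to rewriting into a normal form. Indices \<open>2\<close> and \<open>3\<close> belong to the
  primed variables.\<close>

locale generic_entries =
  fixes x0 x1 x2 x3 y0 y1 y2 y3 :: "'r::ring_1"
  assumes x0: "\<And>r. r * x0 = x0 * r" and x1: "\<And>r. r * x1 = x1 * r"
    and x2: "\<And>r. r * x2 = x2 * r" and x3: "\<And>r. r * x3 = x3 * r"
    and sq: "y0 * y0 = 0" "y1 * y1 = 0" "y2 * y2 = 0" "y3 * y3 = 0"
    and anti: "y1 * y0 = - (y0 * y1)" "y2 * y0 = - (y0 * y2)" "y3 * y0 = - (y0 * y3)"
      "y2 * y1 = - (y1 * y2)" "y3 * y1 = - (y1 * y3)" "y3 * y2 = - (y2 * y3)"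
begin

lemma sq': "y0 * (y0 * r) = 0" "y1 * (y1 * r) = 0" "y2 * (y2 * r) = 0" "y3 * (y3 * r) = 0"
  by (simp_all add: sq flip: mult.assoc)

lemma anti': "y1 * (y0 * r) = - (y0 * (y1 * r))" "y2 * (y0 * r) = - (y0 * (y2 * r))"
  "y3 * (y0 * r) = - (y0 * (y3 * r))" "y2 * (y1 * r) = - (y1 * (y2 * r))"
  "y3 * (y1 * r) = - (y1 * (y3 * r))" "y3 * (y2 * r) = - (y2 * (y3 * r))"
  by (simp_all add: anti flip: mult.assoc)

lemma xy: "y0 * x0 = x0 * y0" "y1 * x0 = x0 * y1" "y2 * x0 = x0 * y2" "y3 * x0 = x0 * y3"
  "y0 * x1 = x1 * y0" "y1 * x1 = x1 * y1" "y2 * x1 = x1 * y2" "y3 * x1 = x1 * y3"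
  "y0 * x2 = x2 * y0" "y1 * x2 = x2 * y1" "y2 * x2 = x2 * y2" "y3 * x2 = x2 * y3"
  "y0 * x3 = x3 * y0" "y1 * x3 = x3 * y1" "y2 * x3 = x3 * y2" "y3 * x3 = x3 * y3"
  "x1 * x0 = x0 * x1" "x2 * x0 = x0 * x2" "x3 * x0 = x0 * x3" "x2 * x1 = x1 * x2"
  "x3 * x1 = x1 * x3" "x3 * x2 = x2 * x3"
  by (rule x0 x1 x2 x3)+

lemma xy': "y0 * (x0 * r) = x0 * (y0 * r)" "y1 * (x0 * r) = x0 * (y1 * r)" "y2 * (x0 * r) = x0 * (y2 * r)"
  "y3 * (x0 * r) = x0 * (y3 * r)" "y0 * (x1 * r) = x1 * (y0 * r)" "y1 * (x1 * r) = x1 * (y1 * r)"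
  "y2 * (x1 * r) = x1 * (y2 * r)" "y3 * (x1 * r) = x1 * (y3 * r)" "y0 * (x2 * r) = x2 * (y0 * r)"
  "y1 * (x2 * r) = x2 * (y1 * r)" "y2 * (x2 * r) = x2 * (y2 * r)" "y3 * (x2 * r) = x2 * (y3 * r)"
  "y0 * (x3 * r) = x3 * (y0 * r)" "y1 * (x3 * r) = x3 * (y1 * r)" "y2 * (x3 * r) = x3 * (y2 * r)"
  "y3 * (x3 * r) = x3 * (y3 * r)" "x1 * (x0 * r) = x0 * (x1 * r)" "x2 * (x0 * r) = x0 * (x2 * r)"
  "x3 * (x0 * r) = x0 * (x3 * r)" "x2 * (x1 * r) = x1 * (x2 * r)" "x3 * (x1 * r) = x1 * (x3 * r)"
  "x3 * (x2 * r) = x2 * (x3 * r)"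
  by (simp_all add: xy flip: mult.assoc)

lemmas normalize = sq sq' anti anti' xy xy' algebra_simps

text \<open>With \<open>\<omega>\<close> and \<open>\<omega>'\<close>, the entries of the commutator
  of the two generic matrices (\<open>g12_eq\<close>).\<close>

definition "\<epsilon> = y0 * y3 - y1 * y2"
definition "\<omega> = (x0 - x2) * y1 - (x1 - x3) * y0"
definition "\<omega>' = (x1 - x3) * y2 - (x0 - x2) * y3"

text \<open>\<open>pure1\<close>, \<open>pure2\<close> and \<open>pure3\<close> are the entrywise
  conditions for \<open>g12 E11 g12\<close> to commute with both generators; \<open>pure4\<close>
  gives those for \<open>g12 E22 g12\<close>.\<close>

lemma pure1: "\<epsilon> * \<omega> * y2 = y0 * (\<omega>' * \<epsilon>)" "\<epsilon> * \<omega> * y3 = y1 * (\<omega>' * \<epsilon>)"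
   "\<omega>' * \<epsilon> * y0 = y2 * (\<epsilon> * \<omega>)" "\<omega>' * \<epsilon> * y1 = y3 * (\<epsilon> * \<omega>)"
  by (simp_all add: \<epsilon>_def \<omega>_def \<omega>'_def normalize)

lemma pure2: "\<epsilon> * \<epsilon> * y0 + x2 * (\<epsilon> * \<omega>) = x0 * (\<epsilon> * \<omega>) + y0 * (\<omega>' * \<omega>)"
   "\<epsilon> * \<epsilon> * y1 + x3 * (\<epsilon> * \<omega>) = x1 * (\<epsilon> * \<omega>) + y1 * (\<omega>' * \<omega>)"
  by (simp_all add: \<epsilon>_def \<omega>_def \<omega>'_def normalize)

lemma cube: "\<epsilon> * \<epsilon> * \<epsilon> = 0" "\<epsilon> * \<omega> * \<omega>' = 0" "\<omega>' * \<epsilon> * \<omega> = 0" "\<epsilon> * \<epsilon> * \<omega> = 0" "\<epsilon> * \<epsilon> * \<omega>' = 0"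
  "\<omega> * \<omega> = 0" "\<omega>' * \<omega>' = 0" "\<omega> * \<epsilon> = \<epsilon> * \<omega>" "\<omega>' * \<epsilon> = \<epsilon> * \<omega>'"
  "\<omega>' * \<omega> = - (\<omega> * \<omega>')"
  by (simp_all add: \<epsilon>_def \<omega>_def \<omega>'_def normalize)

lemma pure3: "x0 * (\<omega>' * \<epsilon>) + \<omega>' * \<omega> * y2 = y2 * (\<epsilon> * \<epsilon>) + x2 * (\<omega>' * \<epsilon>)"
   "x1 * (\<omega>' * \<epsilon>) + \<omega>' * \<omega> * y3 = y3 * (\<epsilon> * \<epsilon>) + x3 * (\<omega>' * \<epsilon>)"
  by (simp_all add: \<epsilon>_def \<omega>_def \<omega>'_def normalize)

lemma pure4: "\<omega> * \<epsilon> * y2 = y0 * (\<epsilon> * \<omega>')" "\<omega> * \<epsilon> * y3 = y1 * (\<epsilon> * \<omega>')"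
   "\<epsilon> * \<omega>' * y0 = y2 * (\<omega> * \<epsilon>)" "\<epsilon> * \<omega>' * y1 = y3 * (\<omega> * \<epsilon>)"
   "\<omega> * \<omega>' * y0 + x2 * (\<omega> * \<epsilon>) = x0 * (\<omega> * \<epsilon>) + y0 * (\<epsilon> * \<epsilon>)"
   "\<omega> * \<omega>' * y1 + x3 * (\<omega> * \<epsilon>) = x1 * (\<omega> * \<epsilon>) + y1 * (\<epsilon> * \<epsilon>)"
   "x0 * (\<epsilon> * \<omega>') + \<epsilon> * \<epsilon> * y2 = y2 * (\<omega> * \<omega>') + x2 * (\<epsilon> * \<omega>')"
   "x1 * (\<epsilon> * \<omega>') + \<epsilon> * \<epsilon> * y3 = y3 * (\<omega> * \<omega>') + x3 * (\<epsilon> * \<omega>')"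
  by (simp_all add: \<epsilon>_def \<omega>_def \<omega>'_def normalize)

end

text \<open>Being of class \<open>ring_1\<close>, this type admits \<open>commutator\<close>, powers
  and \<open>scalar_hom\<close> directly; \<open>to_mat\<close> leads back to the carrier of
  \<open>F_algebra\<close>.\<close>

datatype 'r mat2 = Mat2 (e11: 'r) (e12: 'r) (e21: 'r) (e22: 'r)

instantiation mat2 :: (ring_1) ring_1
begin

definition "0 = Mat2 0 0 0 0"
definition "1 = Mat2 1 0 0 1"
definition "A + B = Mat2 (e11 A + e11 B) (e12 A + e12 B) (e21 A + e21 B) (e22 A + e22 B)"
definition "A - B = Mat2 (e11 A - e11 B) (e12 A - e12 B) (e21 A - e21 B) (e22 A - e22 B)"
definition "- A = Mat2 (- e11 A) (- e12 A) (- e21 A) (- e22 A)"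
definition "A * B = Mat2 (e11 A * e11 B + e12 A * e21 B) (e11 A * e12 B + e12 A * e22 B)
  (e21 A * e11 B + e22 A * e21 B) (e21 A * e12 B + e22 A * e22 B)"

instance
  by standard
    (simp_all add: zero_mat2_def one_mat2_def plus_mat2_def minus_mat2_def uminus_mat2_def
      times_mat2_def algebra_simps)

end

lemmas mat2_defs = zero_mat2_def one_mat2_def plus_mat2_def minus_mat2_def uminus_mat2_def times_mat2_def

context generic_entries
begin

definition "g1 = Mat2 x0 y0 y2 x2"
definition "g2 = Mat2 x1 y1 y3 x3"
definition "g12 = commutator g1 g2"

lemma g12_eq: "g12 = Mat2 \<epsilon> \<omega> \<omega>' \<epsilon>"
  by (simp add: g12_def g1_def g2_def commutator_def mat2_defs \<epsilon>_def \<omega>_def \<omega>'_def xy anti algebra_simps)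

lemma g12_cube: "g12 * g12 * g12 = 0"
proof -
  have "\<omega>' * (\<epsilon> * \<omega>) = 0" "\<epsilon> * (\<omega> * \<omega>') = 0" "\<epsilon> * (\<epsilon> * \<omega>) = 0" "\<epsilon> * (\<epsilon> * \<omega>') = 0" "\<epsilon> * (\<epsilon> * \<epsilon>) = 0"
    "\<omega> * (\<epsilon> * \<omega>') = 0" "\<omega> * (\<omega>' * \<omega>) = 0" "\<omega>' * (\<omega> * \<omega>') = 0" "\<omega>' * (\<omega> * \<epsilon>) = 0" "\<omega> * (\<omega>' * \<epsilon>) = 0"
    "\<epsilon> * (\<omega>' * \<omega>) = 0"
    using cube by (simp_all flip: mult.assoc) (simp_all add: mult.assoc)
  then show ?thesis by (simp add: g12_eq mat2_defs cube algebra_simps)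
qed

lemma g2_power_g1: "g2 * g1 ^ a = g1 ^ a * g2 - (\<Sum>i<a. g1 ^ i * g12 * g1 ^ (a - Suc i))"
proof (induction a)
  case (Suc a)
  have g12: "g2 * g1 = g1 * g2 - g12" by (simp add: g12_def commutator_def)
  have "g2 * g1 ^ Suc a = (g2 * g1 ^ a) * g1" by (simp only: power_Suc2 mult.assoc)
  also have "\<dots> = g1 ^ a * (g2 * g1) - (\<Sum>i<a. g1 ^ i * g12 * g1 ^ (a - Suc i) * g1)"
    by (subst Suc.IH) (simp only: left_diff_distrib sum_distrib_right mult.assoc)
  also have "(\<Sum>i<a. g1 ^ i * g12 * g1 ^ (a - Suc i) * g1) = (\<Sum>i<a. g1 ^ i * g12 * g1 ^ (Suc a - Suc i))"
    by (rule sum.cong) (simp_all add: mult.assoc Suc_diff_Suc flip: power_Suc2)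
  finally show ?case by (simp add: g12 right_diff_distrib power_Suc2 mult.assoc del: power_Suc)
qed simp

lemma g12_E11_g12:
  "commutator (g12 * Mat2 1 0 0 0 * g12) g1 = 0" "commutator (g12 * Mat2 1 0 0 0 * g12) g2 = 0"
  by (simp_all add: g12_eq g1_def g2_def commutator_def mat2_defs pure1 pure2 pure3 x0 x1 x2 x3)

lemma g12_E22_g12:
  "commutator (g12 * Mat2 0 0 0 1 * g12) g1 = 0" "commutator (g12 * Mat2 0 0 0 1 * g12) g2 = 0"
  by (simp_all add: g12_eq g1_def g2_def commutator_def mat2_defs pure4 x0 x1 x2 x3)

end

section \<open>The algebra \<open>F\<close>\<close>

lemma even_central:
  assumes "gparity True f"
  shows "f * g = g * f"
proof -
  define g0 where "g0 = Grassmann (\<lambda>S. if even (card S) then gcoeff g S else 0)"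
  define g1 where "g1 = Grassmann (\<lambda>S. if even (card S) then 0 else gcoeff g S)"
  have "gparity True g0" "gparity False g1"
    by (simp_all add: gparity_def g0_def g1_def Grassmann_inverse)
  moreover have "g = g0 + g1"
    by (simp add: gcoeff_inject[symmetric] fun_eq_iff plus_grassmann.rep_eq g0_def g1_def Grassmann_inverse)
  ultimately show ?thesis
    using supercommute[OF assms, of True g0] supercommute[OF assms, of False g1]
    by (simp add: distrib_left distrib_right)
qed

lemma less_4: "(0::4) < 2" "\<not> (2::4) < 0"
  by (simp_all add: less_bit0_def bit0.Rep_0 bit0.Rep_numeral)

lemma odd_var_anti: "odd_var i * odd_var j = - (odd_var j * odd_var i)"
  by (simp add: odd_var_def godd_anticommute[of i j])

lemma even_var_central: "r * even_var i = even_var i * r"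
  by (simp add: even_var_def geven_central)

lemma odd_var_square: "odd_var i * odd_var i = 0"
  by (simp add: odd_var_def godd_square)

interpretation generic_entries
  "even_var 0 :: 'k::field supercomm" "even_var 1" "even_var 2" "even_var 3"
  "odd_var 0" "odd_var 1" "odd_var 2" "odd_var 3"
  by standard (rule even_var_central odd_var_square odd_var_anti)+

text \<open>Beyond parity, \<open>y_1'\<close> must not occur linearly in the upper right entry, nor
  \<open>y_1\<close> in the lower left one; this removes the negative term of
  \<open>gcoeff_times_02\<close> in the product formula for \<open>ent_t\<close>.\<close>

definition graded :: "'k::field supercomm mat2 \<Rightarrow> bool" where
  "graded A \<longleftrightarrow> gparity True (e11 A) \<and> gparity False (e12 A) \<and> gparity False (e21 A) \<and> gparity True (e22 A)
     \<and> gcoeff (e12 A) {2} = 0 \<and> gcoeff (e21 A) {0} = 0"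

lemma Pow_singleton: "Pow {a} = {{}, {a}}"
  by auto

lemma gcoeff_times_empty: "gcoeff (f * g) {} = gcoeff f {} * gcoeff g {}"
  by (simp add: gcoeff_times)

lemma gcoeff_times_singleton:
  "gcoeff (f * g) {i} = gcoeff f {} * gcoeff g {i} + gcoeff f {i} * gcoeff g {}"
  by (simp add: gcoeff_times Pow_singleton)

lemma gcoeff_times_02:
  fixes f g :: "(4, 'r::comm_ring_1) grassmann"
  shows "gcoeff (f * g) {0, 2} = gcoeff f {} * gcoeff g {0, 2} + gcoeff f {0} * gcoeff g {2}
    - gcoeff f {2} * gcoeff g {0} + gcoeff f {0, 2} * gcoeff g {}"
proof -
  have "Pow {0, 2 :: 4} = {{}, {0}, {2}, {0, 2}}" by auto
  moreover have "{0, 2} - {0} = {2 :: 4}" "{0, 2} - {2} = {0 :: 4}" "{0, 2} \<noteq> {0 :: 4}" "{0, 2} \<noteq> {2 :: 4}" by auto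
  ultimately show ?thesis
    by (simp add: gcoeff_times gsign_singletons less_4)
qed

lemma gparityD:
  "gparity False f \<Longrightarrow> gcoeff f {} = 0" "gparity True f \<Longrightarrow> gcoeff f {i} = 0"
  by (simp_all add: gparity_def)

lemma graded_one: "graded 1"
  by (simp add: graded_def mat2_defs zero_grassmann.rep_eq)

lemma graded_add: "graded A \<Longrightarrow> graded B \<Longrightarrow> graded (A + B)"
  by (simp add: graded_def mat2_defs gparity_add plus_grassmann.rep_eq)

lemma graded_mult: "graded A \<Longrightarrow> graded B \<Longrightarrow> graded (A * B)"
  by (auto simp: graded_def mat2_defs plus_grassmann.rep_eq gcoeff_times_singleton gparityD
      intro!: gparity_add intro: gparity_mults)

definition diag_const :: "'k::field \<Rightarrow> 'k supercomm mat2" where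
  "diag_const c = Mat2 (super_const c) 0 0 (super_const c)"

lemma graded_diag_const: "graded (diag_const c)"
  by (simp add: graded_def diag_const_def super_const_def zero_grassmann.rep_eq)

interpretation M: scalar_hom "diag_const :: 'k::field_char_0 \<Rightarrow> 'k supercomm mat2"
proof
  show "diag_const c * r = r * diag_const c" for c :: 'k and r
    by (simp add: diag_const_def mat2_defs super_const_def geven_central)
qed (simp_all add: diag_const_def mat2_defs super_const_hom)

inductive_set F_set :: "'k::field supercomm mat2 set" where
  one: "1 \<in> F_set"
| g1: "g1 \<in> F_set"
| g2: "g2 \<in> F_set"
| add: "A \<in> F_set \<Longrightarrow> B \<in> F_set \<Longrightarrow> A + B \<in> F_set"
| mult: "A \<in> F_set \<Longrightarrow> B \<in> F_set \<Longrightarrow> A * B \<in> F_set"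
| scale: "A \<in> F_set \<Longrightarrow> diag_const c * A \<in> F_set"

lemma graded_g: "graded g1" "graded g2"
  unfolding graded_def g1_def g2_def by (simp_all add: even_var_def odd_var_def godd.rep_eq)

lemma graded_F_set: "A \<in> F_set \<Longrightarrow> graded A"
  by (induction rule: F_set.induct)
    (auto intro: graded_one graded_g graded_add graded_mult graded_diag_const)

lemma gorder_\<epsilon>_\<omega>:
  "gorder 2 (\<epsilon> :: 'k::field supercomm)" "gorder 1 (\<omega> :: 'k supercomm)" "gorder 1 (\<omega>' :: 'k supercomm)"
  "gparity False (\<omega> :: 'k supercomm)" "gparity False (\<omega>' :: 'k supercomm)"
proof -
  have y: "gorder 1 (odd_var i :: 'k supercomm)" for i
    using gorder_odd[OF gparity_godd] by (simp add: odd_var_def)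
  have x: "gparity True (even_var i - even_var j :: 'k supercomm)" for i j
    by (simp add: even_var_def gparity_diff)
  have y': "gparity False (odd_var i :: 'k supercomm)" for i by (simp add: odd_var_def)
  show "gorder 2 (\<epsilon> :: 'k supercomm)"
    unfolding \<epsilon>_def using gorder_diff[OF gorder_mult[OF y y] gorder_mult[OF y y]]
    by (simp add: numeral_2_eq_2)
  show \<omega>: "gparity False (\<omega> :: 'k supercomm)" "gparity False (\<omega>' :: 'k supercomm)"
    unfolding \<omega>_def \<omega>'_def
    by (intro gparity_diff gparity_mults(2) x y')+
  show "gorder 1 (\<omega> :: 'k supercomm)" "gorder 1 (\<omega>' :: 'k supercomm)"
    using \<omega>[THEN gorder_odd] by simp_all
qed

text \<open>\<open>\<epsilon>\<close> has order \<open>2\<close>, the other factors order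
  \<open>1\<close>, so all but the last two products have order \<open>5\<close>. In the last two,
  \<open>b\<close> anticommutes with \<open>\<omega>\<close> and \<open>\<omega>'\<close>, whose
  squares vanish.\<close>

lemma gorder_products:
  fixes b y y' :: "'k::field supercomm"
  assumes b: "gparity False b" and y: "gparity False y"
  shows "\<epsilon> * b * \<epsilon> = 0" "\<epsilon> * b * \<omega>' * y = 0" "y * (\<omega>' * b * \<epsilon>) = 0" "\<omega>' * b * \<epsilon> * y = 0" "y * (\<epsilon> * b * \<omega>') = 0"
    "\<omega> * b * \<epsilon> * y = 0" "y * (\<epsilon> * b * \<omega>) = 0" "\<epsilon> * b * \<omega> * y = 0" "y * (\<omega> * b * \<epsilon>) = 0"
    "\<omega> * b * \<omega> = 0" "\<omega>' * b * \<omega>' = 0"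
proof -
  note o = gorder_\<epsilon>_\<omega>(1-3)[where 'k = 'k] gorder_odd[OF b] gorder_odd[OF y] 
  have *: "f * g * h * k = 0"
    if "gorder i f" "gorder j g" "gorder l h" "gorder m k" "i + j + l + m > 4" for i j l m and f g h k :: "'k supercomm"
    using gorder_vanish[OF gorder_mult[OF gorder_mult[OF gorder_mult[OF that(1,2)] that(3)] that(4)]] that(5)
    by simp
  show "\<epsilon> * b * \<epsilon> = 0"
    using *[OF o(1) o(4) o(1) gorder_0[of 1]] by simp
  show "\<epsilon> * b * \<omega>' * y = 0" "\<omega>' * b * \<epsilon> * y = 0" "\<omega> * b * \<epsilon> * y = 0" "\<epsilon> * b * \<omega> * y = 0"
    by (rule *[OF o(1) o(4) o(3) o(5)] *[OF o(3) o(4) o(1) o(5)] *[OF o(2) o(4) o(1) o(5)]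
        *[OF o(1) o(4) o(2) o(5)]; simp)+
  show "y * (\<omega>' * b * \<epsilon>) = 0" "y * (\<epsilon> * b * \<omega>') = 0" "y * (\<epsilon> * b * \<omega>) = 0" "y * (\<omega> * b * \<epsilon>) = 0"
    using *[OF o(5) o(3) o(4) o(1)] *[OF o(5) o(1) o(4) o(3)] *[OF o(5) o(1) o(4) o(2)] *[OF o(5) o(2) o(4) o(1)]
    by (simp_all add: mult.assoc)
  have "\<omega> * b = - (b * \<omega>)" "\<omega>' * b = - (b * \<omega>')"
    using supercommute[OF gorder_\<epsilon>_\<omega>(4) b] supercommute[OF gorder_\<epsilon>_\<omega>(5) b] by simp_all
  then show "\<omega> * b * \<omega> = 0" "\<omega>' * b * \<omega>' = 0"
    by (simp_all add: mult.assoc cube)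
qed

section \<open>Products of commutators in \<open>F\<close>\<close>

lemma g12_offdiag_g12:
  assumes b: "gparity False b"
  shows "commutator (g12 * Mat2 0 b 0 0 * g12) g1 = 0" "commutator (g12 * Mat2 0 b 0 0 * g12) g2 = 0"
    "commutator (g12 * Mat2 0 0 b 0 * g12) g1 = 0" "commutator (g12 * Mat2 0 0 b 0 * g12) g2 = 0"
proof -
  have y: "gparity False (odd_var i)" for i by (simp add: odd_var_def)
  show "commutator (g12 * Mat2 0 b 0 0 * g12) g1 = 0" "commutator (g12 * Mat2 0 b 0 0 * g12) g2 = 0"
    "commutator (g12 * Mat2 0 0 b 0 * g12) g1 = 0" "commutator (g12 * Mat2 0 0 b 0 * g12) g2 = 0"
    by (simp_all add: g12_eq g1_def g2_def commutator_def mat2_defs gorder_products[OF b y])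
      (intro conjI even_var_central)+
qed

text \<open>The even diagonal entries of \<open>q\<close> are central and factor out, leaving matrix
  units; the odd entries cannot be factored out and are handled by
  \<open>g12_offdiag_g12\<close>.\<close>

lemma g12_mid_g12_g:
  assumes "graded q"
  shows "commutator (g12 * q * g12) g1 = 0" "commutator (g12 * q * g12) g2 = 0"
proof -
  obtain a b c d where q: "q = Mat2 a b c d" by (cases q)
  let ?D = "\<lambda>a. Mat2 a 0 0 a"
  have D: "?D a * X = X * ?D a" if "gparity True a" for a X
    using even_central[OF that] by (simp add: mat2_defs)
  have split: "q = ?D a * Mat2 1 0 0 0 + Mat2 0 b 0 0 + Mat2 0 0 c 0 + ?D d * Mat2 0 0 0 1"
    by (simp add: q mat2_defs)
  have par: "gparity True a" "gparity False b" "gparity False c" "gparity True d"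
    using assms by (simp_all add: graded_def q)
  have shift: "g12 * (?D a * X) * g12 = ?D a * (g12 * X * g12)" if "gparity True a" for a X
  proof -
    have "g12 * (?D a * X) * g12 = (g12 * ?D a) * (X * g12)" by (simp only: mult.assoc)
    then show ?thesis by (simp only: D[OF that, of g12, symmetric] mult.assoc)
  qed
  have comm: "commutator (?D a * X) Y = ?D a * commutator X Y" if "gparity True a" for a X Y
    using D[OF that, of Y] by (simp add: commutator_mult_left commutator_def[of "?D a"])
  show "commutator (g12 * q * g12) g1 = 0" "commutator (g12 * q * g12) g2 = 0"
    unfolding split
    by (simp_all add: distrib_left distrib_right commutator_add_left shift comm par g12_E11_g12 g12_E22_g12
        g12_offdiag_g12)
qed

lemma commutator_F_set:
  assumes "A \<in> F_set" "commutator X g1 = 0" "commutator X g2 = 0"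
  shows "X * A = A * X"
  using assms(1)
proof (induction rule: F_set.induct)
  case (mult A B)
  have "X * (A * B) = (A * X) * B" by (simp flip: mult.assoc mult.IH(1))
  also have "\<dots> = A * B * X" by (simp add: mult.assoc mult.IH(2))
  finally show ?case .
next
  case (scale A c)
  have "diag_const c * X = X * diag_const c"
    by (simp add: diag_const_def mat2_defs super_const_def geven_central)
  then have "X * (diag_const c * A) = diag_const c * (X * A)" by (simp flip: mult.assoc)
  then show ?case by (simp add: scale.IH mult.assoc)
qed (use assms(2,3) in \<open>simp_all add: commutator_def distrib_left distrib_right\<close>)

lemma g12_mid_g12_central: "q \<in> F_set \<Longrightarrow> A \<in> F_set \<Longrightarrow> g12 * q * g12 * A = A * (g12 * q * g12)"
  by (intro commutator_F_set g12_mid_g12_g graded_F_set)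

text \<open>Centrality of \<open>g12 q g12\<close> brings \<open>q'\<close> to the front, centrality
  of \<open>g12 g12\<close> takes \<open>q\<close> to the end, and the cube of \<open>g12\<close> is
  \<open>0\<close>.\<close>

lemma g12_mid_g12_mid_g12:
  assumes "q \<in> F_set" "q' \<in> F_set"
  shows "g12 * q * g12 * q' * g12 = 0"
proof -
  have ww: "g12 * g12 * A = A * (g12 * g12)" if "A \<in> F_set" for A
    using g12_mid_g12_central[OF F_set.one that] by simp
  have "g12 * q * g12 * q' * g12 = q' * (g12 * (q * (g12 * g12)))"
    using g12_mid_g12_central[OF assms] by (simp add: mult.assoc)
  also have "q * (g12 * g12) = g12 * (g12 * q)" using ww[OF assms(1)] by (simp add: mult.assoc)
  also have "g12 * (g12 * (g12 * q)) = 0" by (simp add: g12_cube flip: mult.assoc)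
  finally show ?thesis by simp
qed

text \<open>With two generators the commutator ideal of \<open>F\<close> is generated by
  \<open>g12\<close> alone. Unlike in \<open>comm_ideal\<close>, the multipliers stay inside
  \<open>F\<close>.\<close>

inductive_set F_comm :: "'k::field supercomm mat2 set" where
  zero: "0 \<in> F_comm"
| add: "A \<in> F_comm \<Longrightarrow> B \<in> F_comm \<Longrightarrow> A + B \<in> F_comm"
| base: "p \<in> F_set \<Longrightarrow> q \<in> F_set \<Longrightarrow> p * g12 * q \<in> F_comm"

lemma F_comm_mult:
  assumes "A \<in> F_comm" and r: "r \<in> F_set"
  shows "r * A \<in> F_comm" "A * r \<in> F_comm"
  using assms(1)
proof (induction rule: F_comm.induct)
  case (base p q)
  show "r * (p * g12 * q) \<in> F_comm" "p * g12 * q * r \<in> F_comm"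
    using F_comm.base[OF F_set.mult[OF r base.hyps(1)] base.hyps(2)]
      F_comm.base[OF base.hyps(1) F_set.mult[OF base.hyps(2) r]] by (simp_all add: mult.assoc)
qed (auto simp: distrib_left distrib_right intro: F_comm.intros)

lemma commutator_F_comm:
  fixes A B :: "'k::field_char_0 supercomm mat2"
  assumes "A \<in> F_set" "B \<in> F_set"
  shows "commutator A B \<in> F_comm"
proof -
  have neg: "- X \<in> F_comm" if "X \<in> F_comm" for X :: "'k supercomm mat2"
    using F_comm_mult(1)[OF that F_set.scale[OF F_set.one, of "- 1"]]
    by (simp add: M.hom_uminus M.hom_one)
  have g12: "(g12 :: 'k supercomm mat2) \<in> F_comm"
    using F_comm.base[of "1 :: 'k supercomm mat2" 1] by (simp add: F_set.one)
  have step: "commutator A B \<in> F_comm"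
    if "A \<in> F_set" "commutator g1 B \<in> F_comm" "commutator g2 B \<in> F_comm" for A B :: "'k supercomm mat2"
    using that(1)
  proof (induction rule: F_set.induct)
    case one
    then show ?case by (simp add: commutator_def F_comm.zero)
  next
    case (mult A B')
    then show ?case by (simp add: commutator_mult_left F_comm.add F_comm_mult)
  next
    case (scale A c)
    then show ?case
      using F_comm_mult(1)[OF scale.IH F_set.scale[OF F_set.one, of c]] by (simp add: M.commutator_scalar_left)
  qed (use that in \<open>simp_all add: commutator_add_left F_comm.add\<close>)
  have gg: "commutator g1 g1 \<in> F_comm" "commutator g2 g2 \<in> F_comm"
    "commutator g1 (g2 :: 'k supercomm mat2) \<in> F_comm" "commutator g2 (g1 :: 'k supercomm mat2) \<in> F_comm"
    using F_comm.zero g12 neg[OF g12] by (simp_all add: g12_def commutator_def)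
  have swap: "commutator Y X \<in> F_comm" if "commutator X Y \<in> F_comm" for X Y :: "'k supercomm mat2"
    using neg[OF that] by (simp add: commutator_def)
  have "commutator g1 B \<in> F_comm" "commutator g2 B \<in> F_comm"
    by (rule swap, rule step[OF assms(2)], (rule gg)+)+
  then show ?thesis by (rule step[OF assms(1)])
qed

lemma F_comm_triple:
  assumes "A \<in> F_comm" "B \<in> F_comm" "C \<in> F_comm"
  shows "A * B * C = 0"
  using assms(1)
proof (induction rule: F_comm.induct)
  case (base p q)
  show ?case using assms(2)
  proof (induction rule: F_comm.induct)
    case (base p' q')
    show ?case using assms(3)
    proof (induction rule: F_comm.induct)
      case (base p'' q'')
      have "p * g12 * q * (p' * g12 * q') * (p'' * g12 * q'') = p * (g12 * (q * p') * g12 * (q' * p'') * g12) * q''"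
        by (simp add: mult.assoc)
      then show ?case using g12_mid_g12_mid_g12[of "q * p'" "q' * p''"] base \<open>p' \<in> F_set\<close> \<open>q' \<in> F_set\<close> \<open>q \<in> F_set\<close>
        by (simp add: F_set.mult)
    qed (simp_all add: distrib_left)
  qed (simp_all add: distrib_left distrib_right)
qed (simp_all add: distrib_right)

text \<open>\<open>W = g12 q p' g12\<close> is central, so the product is \<open>W (p q')\<close>,
  and its commutator with \<open>C\<close> is \<open>W [p q', C]\<close>, a product of three
  elements of the commutator ideal.\<close>

lemma F_comm_central:
  fixes A B C :: "'k::field_char_0 supercomm mat2"
  assumes "A \<in> F_comm" "B \<in> F_comm" "C \<in> F_set"
  shows "commutator (A * B) C = 0"
  using assms(1)
proof (induction rule: F_comm.induct)
  case (base p q)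
  show ?case using assms(2)
  proof (induction rule: F_comm.induct)
    case (base p' q')
    let ?W = "g12 * (q * p') * g12"
    have qp: "q * p' \<in> F_set" and pq: "p * q' \<in> F_set"
      using base \<open>p \<in> F_set\<close> \<open>q \<in> F_set\<close> by (auto intro: F_set.mult)
    have "p * g12 * q * (p' * g12 * q') = p * ?W * q'" by (simp add: mult.assoc)
    also have "p * ?W = ?W * p"
      by (rule g12_mid_g12_central[OF qp \<open>p \<in> F_set\<close>, symmetric])
    also have "?W * p * q' = ?W * (p * q')" by (simp only: mult.assoc)
    finally have eq: "p * g12 * q * (p' * g12 * q') = ?W * (p * q')" .
    have "commutator ?W C = 0"
      using g12_mid_g12_central[OF qp assms(3)] by (simp add: commutator_def)
    then have "commutator (p * g12 * q * (p' * g12 * q')) C = ?W * commutator (p * q') C"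
      unfolding eq commutator_mult_left[of ?W] by simp
    moreover have "g12 \<in> F_comm" "g12 * (q * p') \<in> F_comm"
      using F_comm.base[OF F_set.one F_set.one] F_comm.base[OF F_set.one qp] by simp_all
    ultimately show ?case
      using F_comm_triple[of "g12 * (q * p')" g12 "commutator (p * q') C"] commutator_F_comm[OF pq assms(3)] by simp
  qed (simp_all add: distrib_left commutator_add_left)
qed (simp_all add: distrib_right commutator_add_left)

section \<open>Evaluation of polynomials in \<open>F\<close>\<close>

definition F_eval :: "(nat \<Rightarrow> 'k supercomm mat2) \<Rightarrow> 'k::field_char_0 free_poly \<Rightarrow> 'k supercomm mat2" where
  "F_eval A = M.lin (\<lambda>v. prod_list (map A v))"

lemma F_eval_add: "F_eval A (f + g) = F_eval A f + F_eval A g"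
  and F_eval_diff: "F_eval A (f - g) = F_eval A f - F_eval A g"
  by (simp_all add: F_eval_def M.lin_add M.lin_diff)

lemma F_eval_mult: "F_eval A (f * g) = F_eval A f * F_eval A g"
  unfolding F_eval_def by (rule M.lin_times) (simp add: plus_list_def)

lemma F_eval_commutator: "F_eval A (commutator f g) = commutator (F_eval A f) (F_eval A g)"
  by (simp add: commutator_def F_eval_diff F_eval_mult)

lemma F_eval_mem:
  assumes "\<And>i. A i \<in> F_set"
  shows "F_eval A f \<in> F_set"
proof (induction f rule: free_poly_induct)
  case (single v c)
  have "prod_list (map A v) \<in> F_set" by (induction v) (auto intro: F_set.intros assms)
  then show ?case by (simp add: F_eval_def F_set.scale)
qed (simp add: F_eval_add F_set.add)

definition to_mat :: "'r::ring_1 mat2 \<Rightarrow> 'r mat" where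
  "to_mat A = m2 (e11 A) (e12 A) (e21 A) (e22 A)"

lemma to_mat_F_algebra:
  "to_mat A \<otimes>\<^bsub>F_algebra\<^esub> to_mat B = to_mat (A * B)"
  "to_mat A \<oplus>\<^bsub>F_algebra\<^esub> to_mat B = to_mat (A + B)"
  "c \<odot>\<^bsub>F_algebra\<^esub> to_mat A = to_mat (diag_const c * A)"
  "\<one>\<^bsub>F_algebra\<^esub> = to_mat 1" "\<zero>\<^bsub>F_algebra\<^esub> = to_mat 0"
  by (simp_all add: F_algebra_def subalgebra_generated_def mat_algebra_def to_mat_def m2_mult m2_add m2_smult
      m2_one m2_zero mat2_defs diag_const_def)

lemma carrier_F_algebra: "carrier F_algebra = to_mat ` (F_set :: 'k::field supercomm mat2 set)"
proof
  let ?A = "mat_algebra super_const 2 :: ('k, 'k supercomm mat) module"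
  have ops: "to_mat A \<otimes>\<^bsub>?A\<^esub> to_mat B = to_mat (A * B)" "to_mat A \<oplus>\<^bsub>?A\<^esub> to_mat B = to_mat (A + B)"
    "c \<odot>\<^bsub>?A\<^esub> to_mat A = to_mat (diag_const c * A)" "\<one>\<^bsub>?A\<^esub> = to_mat 1" for A B c
    by (simp_all add: mat_algebra_def to_mat_def m2_mult m2_add m2_smult m2_one mat2_defs diag_const_def)
  have gens: "C1 = to_mat g1" "C2 = to_mat g2"
    by (simp_all add: C1_def C2_def to_mat_def g1_def g2_def m2_def)
  have "M \<in> to_mat ` F_set" if "M \<in> generated_carrier ?A {C1, C2}" for M
    using that
  proof (induction rule: generated_carrier.induct)
    case (base M)
    then show ?case by (auto simp: gens intro: F_set.intros)
  qed (auto simp: ops intro: F_set.intros)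
  then have "generated_carrier ?A {C1, C2} \<subseteq> to_mat ` F_set" by blast
  then show "carrier F_algebra \<subseteq> to_mat ` (F_set :: 'k supercomm mat2 set)"
    by (simp add: F_algebra_def subalgebra_generated_def)
  have "to_mat A \<in> generated_carrier ?A {C1, C2}" if "A \<in> F_set" for A
    using that
  proof (induction rule: F_set.induct)
    case g1
    show ?case by (rule generated_carrier.base) (simp add: gens)
  next
    case g2
    show ?case by (rule generated_carrier.base) (simp add: gens)
  next
    case (scale A c)
    then show ?case using generated_carrier.smult[OF scale.IH, of c] by (simp add: ops)
  qed (auto simp flip: ops intro: generated_carrier.intros)
  then have "to_mat ` F_set \<subseteq> generated_carrier ?A {C1, C2}" by blast
  then show "to_mat ` (F_set :: 'k supercomm mat2 set) \<subseteq> carrier F_algebra"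
    by (simp add: F_algebra_def subalgebra_generated_def)
qed

lemma eval_poly_F:
  fixes f :: "'k::field_char_0 free_poly"
  assumes "\<And>i. A i \<in> F_set"
  shows "eval_poly F_algebra (\<lambda>i. to_mat (A i)) f = to_mat (F_eval A f)"
proof -
  interpret unital_algebra "F_algebra :: ('k, 'k supercomm mat) module" by (rule unital_algebra_F)
  let ?\<rho> = "\<lambda>i. to_mat (A i)"
  have \<rho>: "range ?\<rho> \<subseteq> carrier F_algebra" using assms by (auto simp: carrier_F_algebra)
  have word: "eval_word F_algebra ?\<rho> v = to_mat (prod_list (map A v))" for v
    by (induction v) (simp_all add: eval_word_def to_mat_F_algebra)
  show ?thesis
  proof (induction f rule: free_poly_induct)
    case (single v c)
    show ?case unfolding eval_poly_single[OF \<rho>] word by (simp add: F_eval_def to_mat_F_algebra)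
  next
    case (add f g)
    then show ?case unfolding eval_poly_add[OF \<rho>] by (simp add: F_eval_add to_mat_F_algebra)
  qed
qed

lemma identities_F_I:
  fixes f :: "'k::field_char_0 free_poly"
  assumes "\<And>A. (\<And>i. A i \<in> F_set) \<Longrightarrow> F_eval A f = 0"
  shows "f \<in> identities F_algebra"
proof -
  have "eval_poly F_algebra \<rho> f = \<zero>\<^bsub>F_algebra\<^esub>" if "range \<rho> \<subseteq> carrier F_algebra" for \<rho>
  proof -
    have "\<rho> i \<in> to_mat ` F_set" for i using that carrier_F_algebra by blast
    then have "\<forall>i. \<exists>A. A \<in> F_set \<and> \<rho> i = to_mat A" by blast
    then obtain A where A: "\<And>i. A i \<in> F_set" and "\<rho> = (\<lambda>i. to_mat (A i))" by metis
    then show ?thesis by (simp add: eval_poly_F[OF A] assms to_mat_F_algebra)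
  qed
  then show ?thesis by (simp add: identities_def)
qed

lemma mid_central_identities_F:
  fixes a b c d g h :: "'k::field_char_0 free_poly"
  shows "commutator a b * commutator c d * commutator g h \<in> identities F_algebra"
    and "commutator (commutator a b * commutator c d) g \<in> identities F_algebra"
  by (intro identities_F_I; simp add: F_eval_mult F_eval_commutator F_comm_triple F_comm_central
      commutator_F_comm F_eval_mem)+

section \<open>Separating the elements of \<open>F\<close>\<close>

definition monom2 :: "nat \<times> nat \<Rightarrow> 'k::field supercomm mat2" where
  "monom2 k = g1 ^ fst k * g2 ^ snd k"

definition basis1 :: "(nat \<times> nat) \<times> (nat \<times> nat) \<Rightarrow> 'k::field supercomm mat2" where
  "basis1 k = monom2 (fst k) * g12 * monom2 (snd k)"

text \<open>No third monomial occurs: it could be moved to the front past the central product of two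
  commutators.\<close>

definition basis2 :: "(nat \<times> nat) \<times> (nat \<times> nat) \<Rightarrow> 'k::field supercomm mat2" where
  "basis2 k = basis1 k * g12"

lemma power_F_set: "A \<in> F_set \<Longrightarrow> A ^ n \<in> F_set"
  by (induction n) (auto intro: F_set.intros)

lemma monom2_F_set: "monom2 k \<in> F_set"
  by (simp add: monom2_def F_set.intros power_F_set)

inductive_set F_span :: "'k::field supercomm mat2 set" where
  monom: "monom2 k \<in> F_span"
| basis1: "basis1 k \<in> F_span"
| basis2: "basis2 k \<in> F_span"
| add: "A \<in> F_span \<Longrightarrow> B \<in> F_span \<Longrightarrow> A + B \<in> F_span"
| scale: "A \<in> F_span \<Longrightarrow> diag_const c * A \<in> F_span"

lemma F_span_diff:
  fixes A B :: "'k::field_char_0 supercomm mat2"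
  assumes "A \<in> F_span" "B \<in> F_span"
  shows "A - B \<in> F_span"
  using F_span.add[OF assms(1) F_span.scale[OF assms(2), of "- 1"]]
  by (simp add: M.hom_uminus M.hom_one)

lemma F_span_zero: "(0 :: 'k::field_char_0 supercomm mat2) \<in> F_span"
  using F_span_diff[OF F_span.monom F_span.monom, of undefined undefined] by simp

lemma F_span_sum:
  fixes g :: "nat \<Rightarrow> 'k::field_char_0 supercomm mat2"
  shows "(\<And>i. g i \<in> F_span) \<Longrightarrow> sum g S \<in> F_span"
  by (induction S rule: infinite_finite_induct) (auto intro: F_span_zero F_span.add)

lemma g1_monom2: "g1 * monom2 (a, b) = monom2 (Suc a, b)"
  by (simp add: monom2_def mult.assoc)

lemma g2_monom2: "g2 * monom2 (a, b) = monom2 (a, Suc b) - (\<Sum>i<a. basis1 ((i, 0), (a - Suc i, b)))"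
proof -
  have "g2 * monom2 (a, b) = (g2 * g1 ^ a) * g2 ^ b" by (simp add: monom2_def mult.assoc)
  then show ?thesis
    by (simp add: g2_power_g1 left_diff_distrib sum_distrib_right monom2_def basis1_def mult.assoc)
qed

lemma F_span_g1:
  fixes A :: "'k::field_char_0 supercomm mat2"
  shows "A \<in> F_span \<Longrightarrow> g1 * A \<in> F_span"
proof (induction rule: F_span.induct)
  case (monom k)
  show ?case using F_span.monom by (cases k) (simp add: g1_monom2)
next
  case (basis1 k)
  obtain a b k' where k: "k = ((a, b), k')" by (metis surj_pair)
  have "g1 * basis1 k = (basis1 ((Suc a, b), k') :: 'k supercomm mat2)"
    by (simp add: k basis1_def flip: g1_monom2 mult.assoc)
  then show ?case by (simp add: F_span.basis1)
next
  case (basis2 k)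
  obtain a b k' where k: "k = ((a, b), k')" by (metis surj_pair)
  have "g1 * basis2 k = (basis2 ((Suc a, b), k') :: 'k supercomm mat2)"
    by (simp add: k basis2_def basis1_def flip: g1_monom2 mult.assoc)
  then show ?case by (simp add: F_span.basis2)
next
  case (scale A c)
  then show ?case by (simp add: M.hom_left_commute F_span.scale)
qed (simp add: distrib_left F_span.add)

text \<open>Reordering inserts a factor \<open>g12\<close>. Before \<open>basis1\<close> this gives
  \<open>basis2\<close>, once the trailing monomial has passed the central \<open>?W\<close>; before
  \<open>basis2\<close> it gives three such factors, hence \<open>0\<close>.\<close>

lemma F_span_g2:
  fixes A :: "'k::field_char_0 supercomm mat2"
  shows "A \<in> F_span \<Longrightarrow> g2 * A \<in> F_span"
proof (induction rule: F_span.induct)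
  case (monom k)
  show ?case
    by (cases k) (auto simp: g2_monom2 intro!: F_span_diff F_span_sum F_span.monom F_span.basis1)
next
  case (basis1 k)
  obtain a b k' where k: "k = ((a, b), k')" by (metis surj_pair)
  have "basis1 ((i, 0), (a - Suc i, b)) * g12 * monom2 k'
      = (basis2 ((i + fst k', snd k'), (a - Suc i, b)) :: 'k supercomm mat2)" for i
  proof -
    let ?W = "g12 * monom2 (a - Suc i, b) * g12 :: 'k supercomm mat2"
    have "basis1 ((i, 0), (a - Suc i, b)) * g12 * monom2 k' = g1 ^ i * (?W * monom2 k')"
      by (simp add: basis1_def monom2_def mult.assoc)
    also have "?W * monom2 k' = monom2 k' * ?W"
      by (rule g12_mid_g12_central) (rule monom2_F_set)+
    finally show ?thesis by (simp add: basis2_def basis1_def monom2_def power_add mult.assoc)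
  qed
  then have "g2 * basis1 k = basis1 ((a, Suc b), k') - (\<Sum>i<a. basis2 ((i + fst k', snd k'), (a - Suc i, b)) :: 'k supercomm mat2)"
    by (simp add: k basis1_def[of "((a, _), k')"] g2_monom2 left_diff_distrib sum_distrib_right flip: mult.assoc)
  then show ?case by (auto intro!: F_span_diff F_span_sum F_span.basis1 F_span.basis2)
next
  case (basis2 k)
  obtain a b k' where k: "k = ((a, b), k')" by (metis surj_pair)
  have "basis1 ((i, 0), (a - Suc i, b)) * g12 * monom2 k' * g12 = (0 :: 'k supercomm mat2)" for i
  proof -
    have "basis1 ((i, 0), (a - Suc i, b)) * g12 * monom2 k' * g12
        = monom2 (i, 0) * (g12 * monom2 (a - Suc i, b) * g12 * monom2 k' * g12 :: 'k supercomm mat2)"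
      by (simp add: basis1_def mult.assoc)
    then show ?thesis by (simp only: g12_mid_g12_mid_g12[OF monom2_F_set monom2_F_set] mult_zero_right)
  qed
  then have "g2 * basis2 k = (basis2 ((a, Suc b), k') :: 'k supercomm mat2)"
    by (simp add: k basis2_def basis1_def[of "((a, _), k')"] g2_monom2 left_diff_distrib sum_distrib_right
        flip: mult.assoc)
  then show ?case by (simp add: F_span.basis2)
next
  case (scale A c)
  then show ?case by (simp add: M.hom_left_commute F_span.scale)
qed (simp add: distrib_left F_span.add)

lemma F_set_F_span:
  fixes A :: "'k::field_char_0 supercomm mat2"
  assumes "A \<in> F_set"
  shows "A \<in> F_span"
proof -
  have "A * B \<in> F_span" if "B \<in> F_span" for B
    using assms that
    by (induction arbitrary: B rule: F_set.induct)
      (simp_all add: F_span_g1 F_span_g2 distrib_right F_span.add mult.assoc F_span.scale)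
  moreover have "(1 :: 'k supercomm mat2) \<in> F_span"
    using F_span.monom[of "(0, 0)"] by (simp add: monom2_def)
  ultimately show ?thesis by fastforce
qed

lemma M_scale_lin: "\<exists>P'. diag_const c * M.lin E P = M.lin E P'"
proof (induction P rule: free_poly_induct)
  case (single k d)
  show ?case by (rule exI[of _ "Poly_Mapping.single k (c * d)"]) (simp add: M.hom_mult mult.assoc)
next
  case (add P Q)
  then obtain P' Q' where "diag_const c * M.lin E P = M.lin E P'" "diag_const c * M.lin E Q = M.lin E Q'"
    by blast
  then have "diag_const c * M.lin E (P + Q) = M.lin E (P' + Q')"
    by (simp add: M.lin_add distrib_left)
  then show ?case by blast
qed

lemma F_span_lin:
  fixes A :: "'k::field_char_0 supercomm mat2"
  assumes "A \<in> F_span"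
  shows "\<exists>P Q R. A = M.lin monom2 P + M.lin basis1 Q + M.lin basis2 R"
  using assms
proof (induction rule: F_span.induct)
  case (monom k)
  show ?case by (rule exI[of _ "Poly_Mapping.single k 1"], rule exI[of _ 0], rule exI[of _ 0]) (simp add: M.hom_one)
next
  case (basis1 k)
  show ?case by (rule exI[of _ 0], rule exI[of _ "Poly_Mapping.single k 1"], rule exI[of _ 0]) (simp add: M.hom_one)
next
  case (basis2 k)
  show ?case by (rule exI[of _ 0], rule exI[of _ 0], rule exI[of _ "Poly_Mapping.single k 1"]) (simp add: M.hom_one)
next
  case (add A B)
  then obtain P Q R P' Q' R' where "A = M.lin monom2 P + M.lin basis1 Q + M.lin basis2 R"
    "B = M.lin monom2 P' + M.lin basis1 Q' + M.lin basis2 R'" by blast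
  then have "A + B = M.lin monom2 (P + P') + M.lin basis1 (Q + Q') + M.lin basis2 (R + R')"
    by (simp add: M.lin_add)
  then show ?case by blast
next
  case (scale A c)
  then obtain P Q R where "A = M.lin monom2 P + M.lin basis1 Q + M.lin basis2 R" by blast
  moreover obtain P' Q' R' where "diag_const c * M.lin monom2 P = M.lin monom2 P'"
    "diag_const c * M.lin basis1 Q = M.lin basis1 Q'" "diag_const c * M.lin basis2 R = M.lin basis2 R'"
    using M_scale_lin by metis
  ultimately have "diag_const c * A = M.lin monom2 P' + M.lin basis1 Q' + M.lin basis2 R'"
    by (simp add: distrib_left)
  then show ?case by blast
qed

type_synonym 'k coeff_poly = "(4 \<Rightarrow>\<^sub>0 nat) \<Rightarrow>\<^sub>0 'k"

text \<open>The following coefficients are the entries of the matrices \<open>((a, b, t), (0, d, c), (0, 0, a))\<close>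
  over \<open>K[X]\<close>, to which \<open>F\<close> maps homomorphically once \<open>y\<^sub>2\<close> and \<open>y\<^sub>2'\<close> are set to \<open>0\<close>.\<close>

definition "ent_a A = gcoeff (e11 A) {}"
definition "ent_d A = gcoeff (e22 A) {}"
definition "ent_b A = gcoeff (e12 A) {0}" for A :: "(4, _) grassmann mat2"
definition "ent_c A = gcoeff (e21 A) {2}" for A :: "(4, _) grassmann mat2"
definition "ent_t A = gcoeff (e11 A) {0, 2}" for A :: "(4, _) grassmann mat2"

lemmas ent_defs = ent_a_def ent_b_def ent_c_def ent_d_def ent_t_def

lemma ent_add:
  "ent_a (A + B) = ent_a A + ent_a B" "ent_b (A + B) = ent_b A + ent_b B"
  "ent_c (A + B) = ent_c A + ent_c B" "ent_d (A + B) = ent_d A + ent_d B"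
  "ent_t (A + B) = ent_t A + ent_t B"
  by (simp_all add: ent_defs mat2_defs plus_grassmann.rep_eq)

lemma ent_diff:
  "ent_a (A - B) = ent_a A - ent_a B" "ent_b (A - B) = ent_b A - ent_b B"
  "ent_c (A - B) = ent_c A - ent_c B" "ent_d (A - B) = ent_d A - ent_d B"
  by (simp_all add: ent_defs mat2_defs minus_grassmann.rep_eq)

lemma ent_scale:
  "ent_a (diag_const c * A) = Poly_Mapping.single 0 c * ent_a A"
  "ent_b (diag_const c * A) = Poly_Mapping.single 0 c * ent_b A"
  "ent_t (diag_const c * A) = Poly_Mapping.single 0 c * ent_t A"
  by (simp_all add: ent_defs mat2_defs diag_const_def super_const_def gcoeff_geven_times)

lemma ent_one: "ent_a 1 = 1" "ent_b 1 = 0" "ent_c 1 = 0" "ent_d 1 = 1" "ent_t 1 = 0"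
  by (simp_all add: ent_defs mat2_defs one_grassmann.rep_eq zero_grassmann.rep_eq)

lemma ent_mult:
  assumes "graded A" "graded B"
  shows "ent_a (A * B) = ent_a A * ent_a B" "ent_d (A * B) = ent_d A * ent_d B"
    "ent_b (A * B) = ent_a A * ent_b B + ent_b A * ent_d B"
    "ent_c (A * B) = ent_c A * ent_a B + ent_d A * ent_c B"
    "ent_t (A * B) = ent_a A * ent_t B + ent_b A * ent_c B + ent_t A * ent_a B"
proof -
  have z: "gcoeff (e12 X) {} = 0" "gcoeff (e21 X) {} = 0" "gcoeff (e11 X) {i} = 0" "gcoeff (e22 X) {i} = 0"
    "gcoeff (e12 X) {2} = 0" "gcoeff (e21 X) {0} = 0" if "graded X" for X i
    using that by (simp_all add: graded_def gparityD)
  show "ent_a (A * B) = ent_a A * ent_a B" "ent_d (A * B) = ent_d A * ent_d B"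
    "ent_b (A * B) = ent_a A * ent_b B + ent_b A * ent_d B"
    "ent_c (A * B) = ent_c A * ent_a B + ent_d A * ent_c B"
    "ent_t (A * B) = ent_a A * ent_t B + ent_b A * ent_c B + ent_t A * ent_a B"
    by (simp_all add: ent_defs mat2_defs plus_grassmann.rep_eq gcoeff_times_empty gcoeff_times_singleton
        gcoeff_times_02 z[OF assms(1)] z[OF assms(2)])
qed

definition xvar :: "4 \<Rightarrow> 'k::field coeff_poly" where
  "xvar i = Poly_Mapping.single (Poly_Mapping.single i 1) 1"

lemma ent_g: "ent_a g1 = xvar 0" "ent_a g2 = xvar 1" "ent_d g1 = xvar 2" "ent_d g2 = xvar 3"
  "ent_b g1 = 1" "ent_b g2 = 0" "ent_c g1 = 1" "ent_c g2 = 0"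
  unfolding ent_defs g1_def g2_def by (simp_all add: even_var_def odd_var_def geven.rep_eq godd.rep_eq xvar_def)

lemma xvar_power: "xvar i ^ n = Poly_Mapping.single (Poly_Mapping.single i n) 1"
  by (induction n) (simp_all add: xvar_def mult_single flip: single_add)

lemma graded_power: "graded A \<Longrightarrow> graded (A ^ n)"
  by (induction n) (simp_all add: graded_one graded_mult)

lemma graded_g12: "graded g12"
proof -
  have "graded (A - B)" if "graded A" "graded B" for A B :: "'a supercomm mat2"
    using that by (auto simp: graded_def mat2_defs minus_grassmann.rep_eq intro!: gparity_diff)
  then show ?thesis by (simp add: g12_def commutator_def graded_mult graded_g)
qed

lemma graded_monom2: "graded (monom2 k)"
  by (rule graded_F_set[OF monom2_F_set])

lemma graded_basis1: "graded (basis1 k)"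
  by (simp add: basis1_def graded_mult graded_monom2 graded_g12)

lemma ent_power:
  assumes "graded A"
  shows "ent_a (A ^ n) = ent_a A ^ n" "ent_d (A ^ n) = ent_d A ^ n"
  by (induction n) (simp_all add: ent_one ent_mult assms graded_power)

lemma ent_g12: "ent_a g12 = 0" "ent_d g12 = 0" "ent_b g12 = xvar 3 - xvar 1" "ent_c g12 = xvar 1 - xvar 3"
  by (simp_all add: g12_def commutator_def ent_diff ent_mult graded_g ent_g)

definition key1 :: "nat \<times> nat \<Rightarrow> 4 \<Rightarrow>\<^sub>0 nat" where
  "key1 k = Poly_Mapping.single 0 (fst k) + Poly_Mapping.single 1 (snd k)"

text \<open>The left monomial contributes \<open>x_1\<close>, \<open>x_2\<close> through
  \<open>ent_a\<close>, the right one \<open>x_1'\<close>, \<open>x_2'\<close> through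
  \<open>ent_d\<close>, so distinct basis elements have distinct exponents.\<close>

definition key2 :: "(nat \<times> nat) \<times> (nat \<times> nat) \<Rightarrow> 4 \<Rightarrow>\<^sub>0 nat" where
  "key2 k = key1 (fst k) + Poly_Mapping.single 2 (fst (snd k)) + Poly_Mapping.single 3 (snd (snd k))"

lemma inj_key1: "inj key1"
proof (rule injI)
  fix k k' assume "key1 k = key1 k'"
  then have "Poly_Mapping.lookup (key1 k) i = Poly_Mapping.lookup (key1 k') i" for i by simp
  from this[of 0] this[of 1] show "k = k'"
    by (auto simp: key1_def lookup_add lookup_single prod_eq_iff)
qed

lemma inj_key2: "inj key2"
proof (rule injI)
  fix k k' assume "key2 k = key2 k'"
  then have "Poly_Mapping.lookup (key2 k) i = Poly_Mapping.lookup (key2 k') i" for i by simp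
  from this[of 0] this[of 1] this[of 2] this[of 3] show "k = k'"
    by (auto simp: key2_def key1_def lookup_add lookup_single prod_eq_iff)
qed

lemma ent_a_monom2: "ent_a (monom2 k) = Poly_Mapping.single (key1 k) 1"
  by (simp add: monom2_def ent_mult graded_power graded_g ent_power ent_g xvar_power key1_def mult_single)

lemma ent_d_monom2:
  "ent_d (monom2 k) = Poly_Mapping.single (Poly_Mapping.single 2 (fst k) + Poly_Mapping.single 3 (snd k)) 1"
  by (simp add: monom2_def ent_mult graded_power graded_g ent_power ent_g xvar_power mult_single)

lemma ent_basis1:
  "ent_a (basis1 k) = 0" "ent_d (basis1 k) = 0"
  "ent_b (basis1 k) = (xvar 3 - xvar 1) * (Poly_Mapping.single (key2 k) 1 :: 'k::field coeff_poly)"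
proof -
  have "Poly_Mapping.single (key2 k) 1 = ent_a (monom2 (fst k)) * (ent_d (monom2 (snd k)) :: 'k coeff_poly)"
    by (simp add: ent_a_monom2 ent_d_monom2 mult_single key2_def add.assoc)
  then show "ent_b (basis1 k) = (xvar 3 - xvar 1) * (Poly_Mapping.single (key2 k) 1 :: 'k coeff_poly)"
    by (simp add: basis1_def ent_mult graded_mult graded_monom2 graded_g12 ent_g12 algebra_simps)
qed (simp_all add: basis1_def ent_mult graded_mult graded_monom2 graded_g12 ent_g12)

lemma ent_basis2: "ent_a (basis2 k) = 0" "ent_b (basis2 k) = 0"
  "ent_t (basis2 k) = - ((xvar 3 - xvar 1) * (xvar 3 - xvar 1) * Poly_Mapping.single (key2 k) 1)"
  by (simp_all add: basis2_def ent_mult graded_basis1 graded_g12 ent_g12 ent_basis1 algebra_simps)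

interpretation X: scalar_hom "Poly_Mapping.single 0 :: 'k::field_char_0 \<Rightarrow> 'k coeff_poly"
  by standard (simp_all add: single_add mult_single mult.commute)

lemma ent_lin:
  fixes P :: "'b \<Rightarrow>\<^sub>0 'k::field_char_0"
  shows "ent_a (M.lin E P) = X.lin (\<lambda>k. ent_a (E k)) P"
    and "ent_b (M.lin E P) = X.lin (\<lambda>k. ent_b (E k)) P"
    and "ent_t (M.lin E P) = X.lin (\<lambda>k. ent_t (E k)) P"
proof -
  have "ent_a (M.lin E P) = X.lin (\<lambda>k. ent_a (E k)) P \<and> ent_b (M.lin E P) = X.lin (\<lambda>k. ent_b (E k)) P
      \<and> ent_t (M.lin E P) = X.lin (\<lambda>k. ent_t (E k)) P"
    by (induction P rule: free_poly_induct) (simp_all add: ent_add ent_scale M.lin_add X.lin_add)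
  then show "ent_a (M.lin E P) = X.lin (\<lambda>k. ent_a (E k)) P" "ent_b (M.lin E P) = X.lin (\<lambda>k. ent_b (E k)) P"
    "ent_t (M.lin E P) = X.lin (\<lambda>k. ent_t (E k)) P" by blast+
qed

lemma X_lin_inj:
  assumes "X.lin (\<lambda>k. Poly_Mapping.single (key k) 1) P = 0" "inj key"
  shows "P = 0"
proof (rule poly_mapping_eqI)
  fix k0
  have "X.lin (\<lambda>k. Poly_Mapping.single (key k) 1) P = (\<Sum>k\<in>Poly_Mapping.keys P. Poly_Mapping.single (key k) (Poly_Mapping.lookup P k))"
    by (simp add: X.lin_def mult_single)
  then have "0 = (\<Sum>k\<in>Poly_Mapping.keys P. Poly_Mapping.lookup (Poly_Mapping.single (key k) (Poly_Mapping.lookup P k)) (key k0))"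
    using assms(1) by (simp flip: lookup_sum)
  also have "\<dots> = (\<Sum>k\<in>Poly_Mapping.keys P. if k = k0 then Poly_Mapping.lookup P k else 0)"
    using assms(2) by (intro sum.cong) (auto simp: lookup_single inj_eq)
  also have "\<dots> = Poly_Mapping.lookup P k0" by (simp add: in_keys_iff)
  finally show "Poly_Mapping.lookup P k0 = Poly_Mapping.lookup 0 k0" by simp
qed

lemma xvar_diff_nonzero: "xvar 3 - xvar 1 \<noteq> (0 :: 'k::field coeff_poly)"
proof
  assume "xvar 3 - xvar 1 = (0 :: 'k coeff_poly)"
  then have "Poly_Mapping.lookup (xvar 3 - xvar 1 :: 'k coeff_poly) (Poly_Mapping.single 3 1) = 0" by simp
  moreover have "Poly_Mapping.single 1 1 \<noteq> (Poly_Mapping.single 3 1 :: 4 \<Rightarrow>\<^sub>0 nat)"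
  proof
    assume "Poly_Mapping.single 1 1 = (Poly_Mapping.single 3 1 :: 4 \<Rightarrow>\<^sub>0 nat)"
    from arg_cong[OF this, of "\<lambda>p. Poly_Mapping.lookup p 1"] show False by (simp add: lookup_single)
  qed
  ultimately show False by (simp add: xvar_def lookup_minus lookup_single)
qed

text \<open>The system is triangular: \<open>ent_a\<close> determines the part without
  \<open>g12\<close>; once that vanishes, \<open>ent_b\<close> determines the part with one
  \<open>g12\<close>, and then \<open>ent_t\<close> the part with two. Up to a nonzero factor in a
  domain, each entry is a combination of distinct monomials.\<close>

lemma F_set_eq_0:
  fixes A :: "'k::field_char_0 supercomm mat2"
  assumes "A \<in> F_set" and zero: "ent_a A = 0" "ent_b A = 0" "ent_t A = 0"
  shows "A = 0"
proof -
  obtain P Q R where A: "A = M.lin monom2 P + M.lin basis1 Q + M.lin basis2 R"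
    using F_span_lin F_set_F_span[OF assms(1)] by blast
  have lin_0: "X.lin (\<lambda>_. 0) Z = 0" for Z :: "'b \<Rightarrow>\<^sub>0 'k" by (simp add: X.lin_def)
  have "X.lin (\<lambda>k. Poly_Mapping.single (key1 k) 1) P = 0"
    using zero(1) by (simp add: A ent_add ent_lin ent_a_monom2 ent_basis1 ent_basis2 lin_0)
  then have P: "P = 0" by (rule X_lin_inj) (rule inj_key1)
  have "(xvar 3 - xvar 1) * X.lin (\<lambda>k. Poly_Mapping.single (key2 k) 1) Q = 0"
    using zero(2) by (simp add: A P ent_add ent_lin ent_basis1 ent_basis2 lin_0 X.lin_mult_left)
  then have "X.lin (\<lambda>k. Poly_Mapping.single (key2 k) 1) Q = 0"
    using xvar_diff_nonzero[where 'k = 'k] by simp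
  then have Q: "Q = 0" by (rule X_lin_inj) (rule inj_key2)
  have "X.lin (\<lambda>k. - ((xvar 3 - xvar 1) * (xvar 3 - xvar 1) * Poly_Mapping.single (key2 k) 1)) R = 0"
    using zero(3) by (simp add: A P Q ent_lin ent_basis2)
  then have "- ((xvar 3 - xvar 1) * (xvar 3 - xvar 1)) * X.lin (\<lambda>k. Poly_Mapping.single (key2 k) 1) R = 0"
    by (simp only: X.lin_mult_left minus_mult_left)
  then have "X.lin (\<lambda>k. Poly_Mapping.single (key2 k) 1) R = 0"
    using xvar_diff_nonzero[where 'k = 'k] by simp
  then have R: "R = 0" by (rule X_lin_inj) (rule inj_key2)
  show ?thesis by (simp add: A P Q R)
qed

section \<open>Specialization of the polynomial variables\<close>

definition spec :: "(4 \<Rightarrow> 'k) \<Rightarrow> 'k::field_char_0 coeff_poly \<Rightarrow> 'k" where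
  "spec \<xi> = id_hom.lin (\<lambda>m. \<Prod>i\<in>UNIV. \<xi> i ^ Poly_Mapping.lookup m i)"

lemma spec_add: "spec \<xi> (p + q) = spec \<xi> p + spec \<xi> q"
  by (simp add: spec_def id_hom.lin_add)

lemma spec_mult: "spec \<xi> (p * q) = spec \<xi> p * spec \<xi> q"
  unfolding spec_def by (rule id_hom.lin_times) (simp add: lookup_add power_add prod.distrib)

lemma spec_0 [simp]: "spec \<xi> 0 = 0" and spec_1 [simp]: "spec \<xi> 1 = 1"
  by (simp_all add: spec_def id_hom.lin_one)

lemma spec_single_0: "spec \<xi> (Poly_Mapping.single 0 c) = c"
  by (simp add: spec_def)

lemma spec_lin: "spec \<xi> (X.lin E f) = id_hom.lin (\<lambda>v. spec \<xi> (E v)) f"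
  by (induction f rule: free_poly_induct)
    (simp_all add: X.lin_add id_hom.lin_add spec_add spec_mult spec_single_0)

lemma spec_prod_list: "spec \<xi> (prod_list (map x v)) = prod_list (map (\<lambda>j. spec \<xi> (x j)) v)"
  by (induction v) (simp_all add: spec_mult)

lemma spec_path1: "spec \<xi> (path1 a b d v) = path1 (\<lambda>j. spec \<xi> (a j)) (\<lambda>j. spec \<xi> (b j)) (\<lambda>j. spec \<xi> (d j)) v"
  by (induction v) (simp_all add: spec_add spec_mult spec_prod_list)

lemma spec_path2:
  "spec \<xi> (path2 a b d c e v) = path2 (\<lambda>j. spec \<xi> (a j)) (\<lambda>j. spec \<xi> (b j)) (\<lambda>j. spec \<xi> (d j))
     (\<lambda>j. spec \<xi> (c j)) (\<lambda>j. spec \<xi> (e j)) v"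
  by (induction v) (simp_all add: spec_add spec_mult spec_path1)

text \<open>At the points with coordinates \<open>q_i^t\<close>, the \<open>q_i\<close> being
  distinct primes, a monomial \<open>m\<close> takes the value \<open>N m ^ t\<close>. The
  \<open>N m\<close> are distinct, so the exponential sums isolate each coefficient.\<close>

lemma spec_nonzero:
  fixes p :: "'k::field_char_0 coeff_poly"
  assumes "p \<noteq> 0"
  shows "\<exists>\<xi>. spec \<xi> p \<noteq> 0"
proof (rule ccontr)
  assume "\<not> ?thesis"
  then have zero: "spec \<xi> p = 0" for \<xi> by simp
  obtain r :: "nat \<Rightarrow> nat" where r: "inj r" "\<And>i. prime (r i)" using ex_inj_primes by blast
  obtain n :: "4 \<Rightarrow> nat" where n: "inj n" using finite_imp_inj_to_nat_seg[of "UNIV :: 4 set"] by auto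
  define q where "q i = r (n i)" for i
  have q: "inj q" "\<And>i. prime (q i)" using r n by (auto simp: q_def inj_def)
  define N where "N m = (\<Prod>i\<in>UNIV. q i ^ Poly_Mapping.lookup m i)" for m :: "4 \<Rightarrow>\<^sub>0 nat"
  have "multiplicity (q i) (N m) = Poly_Mapping.lookup m i" for i m
  proof -
    have "N m = (\<Prod>x\<in>range q. x ^ Poly_Mapping.lookup m (inv_into UNIV q x))"
      using q(1) by (simp add: N_def prod.reindex)
    then show ?thesis
      using q by (simp only:) (subst multiplicity_prod_prime_powers, auto)
  qed
  then have inj: "N m = N m' \<Longrightarrow> m = m'" for m m' by (metis poly_mapping_eqI)
  obtain m0 where m0: "m0 \<in> Poly_Mapping.keys p" using assms by (auto simp flip: keys_eq_empty)
  have "(\<Sum>m\<in>Poly_Mapping.keys p. Poly_Mapping.lookup p m * of_nat (N m) ^ t) = 0" for t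
    using zero[of "\<lambda>i. of_nat (q i) ^ t"]
    by (simp add: spec_def id_hom.lin_def N_def prod_power_distrib mult.commute flip: power_mult)
  then have "(\<Sum>m | m \<in> Poly_Mapping.keys p \<and> of_nat (N m) = (of_nat (N m0) :: 'k). Poly_Mapping.lookup p m) = 0"
    by (intro exp_sum_eq_0) simp_all
  moreover have "{m. m \<in> Poly_Mapping.keys p \<and> of_nat (N m) = (of_nat (N m0) :: 'k)} = {m0}"
    using m0 inj by auto
  ultimately show False using m0 by (simp add: in_keys_iff)
qed

lemma ent_prod_list:
  assumes "\<And>i. graded (A i)"
  shows "ent_a (prod_list (map A v)) = prod_list (map (\<lambda>i. ent_a (A i)) v)"
    "ent_d (prod_list (map A v)) = prod_list (map (\<lambda>i. ent_d (A i)) v)"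
    "ent_b (prod_list (map A v)) = path1 (\<lambda>i. ent_a (A i)) (\<lambda>i. ent_b (A i)) (\<lambda>i. ent_d (A i)) v"
    "ent_c (prod_list (map A v)) = path1 (\<lambda>i. ent_d (A i)) (\<lambda>i. ent_c (A i)) (\<lambda>i. ent_a (A i)) v"
    "ent_t (prod_list (map A v))
      = path2 (\<lambda>i. ent_a (A i)) (\<lambda>i. ent_b (A i)) (\<lambda>i. ent_d (A i)) (\<lambda>i. ent_c (A i)) (\<lambda>i. ent_a (A i)) v
        + path1 (\<lambda>i. ent_a (A i)) (\<lambda>i. ent_t (A i)) (\<lambda>i. ent_a (A i)) v"
proof -
  have graded: "graded (prod_list (map A v))" for v
    by (induction v) (simp_all add: graded_one graded_mult assms)
  show a: "ent_a (prod_list (map A v)) = prod_list (map (\<lambda>i. ent_a (A i)) v)"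
    and d: "ent_d (prod_list (map A v)) = prod_list (map (\<lambda>i. ent_d (A i)) v)"
    and b: "ent_b (prod_list (map A v)) = path1 (\<lambda>i. ent_a (A i)) (\<lambda>i. ent_b (A i)) (\<lambda>i. ent_d (A i)) v"
    and c: "ent_c (prod_list (map A v)) = path1 (\<lambda>i. ent_d (A i)) (\<lambda>i. ent_c (A i)) (\<lambda>i. ent_a (A i)) v" for v
    by (induction v) (simp_all add: ent_one ent_mult assms graded)
  show "ent_t (prod_list (map A v))
      = path2 (\<lambda>i. ent_a (A i)) (\<lambda>i. ent_b (A i)) (\<lambda>i. ent_d (A i)) (\<lambda>i. ent_c (A i)) (\<lambda>i. ent_a (A i)) v
        + path1 (\<lambda>i. ent_a (A i)) (\<lambda>i. ent_t (A i)) (\<lambda>i. ent_a (A i)) v"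
    by (induction v) (simp_all add: ent_one ent_mult assms graded a c algebra_simps)
qed

text \<open>Some separating entry of a value of \<open>f\<close> is nonzero. The entries
  \<open>a\<close>, \<open>b\<close> and the \<open>path1\<close> part of \<open>ent_t\<close>
  already vanish for identities of \<open>UT2\<close>, so the \<open>path2\<close> part must be the
  nonzero one.\<close>

lemma not_F_identity:
  fixes f :: "'k::field_char_0 free_poly"
  assumes "f \<notin> identities F_algebra" and UT2: "f \<in> identities UT2"
  shows "\<exists>a b c d. id_hom.lin (path2 a b d c a) f \<noteq> 0"
proof -
  obtain A where A: "\<And>i. A i \<in> F_set" and "F_eval A f \<noteq> 0"
    using assms(1) identities_F_I by blast
  then consider "ent_a (F_eval A f) \<noteq> 0" | "ent_b (F_eval A f) \<noteq> 0" | "ent_t (F_eval A f) \<noteq> 0"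
    using F_set_eq_0[OF F_eval_mem[of A f, OF A]] by blast
  then obtain \<xi> where "spec \<xi> (ent_a (F_eval A f)) \<noteq> 0 \<or> spec \<xi> (ent_b (F_eval A f)) \<noteq> 0
      \<or> spec \<xi> (ent_t (F_eval A f)) \<noteq> 0"
    by cases (use spec_nonzero in blast)+
  moreover have "graded (A i)" for i by (rule graded_F_set[OF A])
  ultimately show ?thesis
    using UT2[unfolded identities_UT2_iff]
    by (auto simp: F_eval_def ent_lin spec_lin ent_prod_list spec_prod_list spec_path1 spec_path2 spec_add
        id_hom.lin_fun_add)
qed

section \<open>The varieties\<close>

lemma proper_ground_identity:
  fixes f :: "'k::field_char_0 free_poly"
  assumes f: "f \<in> proper_polys_deg n" and "n > 0"
  shows "f \<in> identities (ground_algebra :: ('k, 'k) module)"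
proof -
  let ?G = "ground_algebra :: ('k, 'k) module"
  interpret G: unital_algebra ?G by (rule unital_algebra_ground)
  interpret T: T_ideal "identities ?G" by (rule T_ideal_identities) (rule unital_algebra_ground)
  have c: "commutator a b \<in> identities ?G" for a b :: "'k free_poly"
  proof -
    have "eval_poly ?G \<rho> (commutator a b) = \<zero>\<^bsub>?G\<^esub>" if "range \<rho> \<subseteq> carrier ?G" for \<rho>
    proof -
      have "eval_poly ?G \<rho> (a * b) = eval_poly ?G \<rho> (b * a)"
        using that by (simp add: G.eval_poly_mult) (simp add: ground_algebra_def mult.commute)
      then show ?thesis using that
        by (simp add: commutator_def G.eval_poly_diff a_minus_def G.r_neg G.eval_poly_closed)
    qed
    then show ?thesis by (simp add: identities_def)
  qed
  have comm: "g \<in> identities ?G" if "g \<in> comm_ideal" for g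
    using that
    by (induction rule: comm_ideal.induct)
      (auto intro: c T.zero_mem T.add_mem T.mult_left_mem T.mult_right_mem)
  show ?thesis using f
  proof (induction rule: proper_polys_deg_induct)
    case (prod c ps)
    show ?case
    proof (cases "c = 0")
      case False
      then have "ps \<noteq> []" using prod \<open>n > 0\<close> by (auto simp: chain_degree_def)
      then obtain i js qs where ps: "ps = (i, js) # qs" by (metis neq_Nil_conv surj_pair)
      then have "chain_prod ps \<in> comm_ideal"
        using prod(1) by (simp add: CI.mult_right_mem chain_comm_ideal)
      then show ?thesis by (intro T.mult_left_mem comm)
    qed (simp add: T.zero_mem)
  qed (rule T.add_mem)
qed

text \<open>An infinite set is equipotent with its square; this codes the three entries of an
  element of \<open>UT2\<close> by one scalar.\<close>

lemma inj_triple: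
  assumes "infinite (UNIV :: 'k set)"
  shows "\<exists>h :: 'k \<times> 'k \<times> 'k \<Rightarrow> 'k. inj h"
proof -
  have "\<exists>h :: 'k \<times> 'k \<Rightarrow> 'k. bij_betw h (UNIV \<times> UNIV) UNIV"
    using card_of_Times_same_infinite[OF assms] card_of_ordIso by blast
  then obtain h :: "'k \<times> 'k \<Rightarrow> 'k" where h: "inj h" by (auto simp: bij_betw_def)
  have "inj (\<lambda>(a, p). h (a, h p))"
    by (auto intro!: injI dest!: injD[OF h])
  then show ?thesis by blast
qed

lemma (in unital_algebra) inj_scalars:
  assumes "\<one> \<noteq> \<zero>"
  shows "inj (\<lambda>c. c \<odot> \<one>)"
proof (rule injI)
  fix c d assume eq: "c \<odot> \<one> = d \<odot> \<one>"
  have "(c - d) \<odot> \<one> \<oplus> d \<odot> \<one> = d \<odot> \<one>"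
    using smult_add_left[of \<one> "c - d" d] eq by simp
  then have zero: "(c - d) \<odot> \<one> = \<zero>"
    using smult_closed[of \<one>] by (metis add.r_cancel_one one_closed)
  show "c = d"
  proof (rule ccontr)
    assume "c \<noteq> d"
    then have "\<one> = inverse (c - d) \<odot> ((c - d) \<odot> \<one>)"
      using smult_smult[of \<one> "inverse (c - d)" "c - d"] by (simp add: smult_one)
    then show False using assms by (simp add: zero smult_zero_right)
  qed
qed

text \<open>Any nonzero algebra in the universe contains a copy of the infinite field \<open>K\<close>, so that
  \<open>UT\<^sub>2(K)\<close> has a copy in the universe as well.\<close>

lemma variety_identities_UT2:
  fixes A :: "('k::field_char_0, 'a) module"
  assumes "unital_algebra A" "\<one>\<^bsub>A\<^esub> \<noteq> \<zero>\<^bsub>A\<^esub>"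
  shows "variety_identities (var_generated (UT2 :: ('k, 'k mat) module) :: ('k, 'a) module set) = identities UT2"
proof -
  interpret UT2: unital_algebra "UT2 :: ('k, 'k mat) module" by (rule unital_algebra_UT2)
  obtain h :: "'k \<times> 'k \<times> 'k \<Rightarrow> 'k" where h: "inj h"
    using inj_triple[OF infinite_UNIV_char_0] by blast
  have j: "inj (\<lambda>c. c \<odot>\<^bsub>A\<^esub> \<one>\<^bsub>A\<^esub>)" using unital_algebra.inj_scalars[OF assms] .
  define g where "g M = h (M $$ (0, 0), M $$ (0, Suc 0), M $$ (Suc 0, Suc 0)) \<odot>\<^bsub>A\<^esub> \<one>\<^bsub>A\<^esub>" for M
  have inj: "inj_on g (carrier UT2)"
    by (rule inj_onI) (auto simp: UT2_simps g_def dest!: injD[OF j] injD[OF h])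
  have "copy_algebra g UT2 \<in> (var_generated UT2 :: ('k, 'a) module set)"
    by (simp add: var_generated_def variety_def UT2.unital_algebra_copy[OF inj] UT2.identities_copy[OF inj])
  then have "variety_identities (var_generated UT2 :: ('k, 'a) module set) \<subseteq> identities (copy_algebra g UT2)"
    by (auto simp: variety_identities_def)
  moreover have "identities UT2 \<subseteq> variety_identities (var_generated UT2 :: ('k, 'a) module set)"
    by (auto simp: variety_identities_def var_generated_def variety_def)
  ultimately show ?thesis by (auto simp: UT2.identities_copy[OF inj])
qed

theorem corollary11:
  fixes U V :: "('k::field_char_0, 'a) module set"
  assumes "V = var_generated (F_algebra :: ('k, 'k supercomm mat) module)"
    and "is_variety U" and "U \<subset> V"
  shows "asymp_equiv_varieties U (var_generated (ground_algebra :: ('k, 'k) module))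
       \<or> asymp_equiv_varieties U (var_generated (UT2 :: ('k, 'k mat) module))"
proof -
  obtain S where U: "U = variety S" using assms(2) by (auto simp: is_variety_def)
  define I where "I = variety_identities U"
  \<comment> \<open>Otherwise every algebra of \<open>V\<close> would lie in
    \<open>U\<close>.\<close>
  have "\<not> S \<subseteq> identities (F_algebra :: ('k, 'k supercomm mat) module)"
    using assms(1,3) unfolding U var_generated_def variety_def by blast
  then obtain f where f: "f \<in> S" "f \<notin> identities (F_algebra :: ('k, 'k supercomm mat) module)" by blast
  then have fI: "f \<in> I" by (auto simp: I_def U variety_identities_def variety_def)
  have FI: "identities (F_algebra :: ('k, 'k supercomm mat) module) \<subseteq> I"
    using assms(1,3) by (auto simp: I_def var_generated_def variety_def variety_identities_def)
  interpret T_ideal I unfolding I_def by (rule T_ideal_variety_identities[OF U])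
  interpret mid_central_T_ideal I
    by standard (use FI mid_central_identities_F in blast)+
  show ?thesis
  proof (cases "I \<subseteq> identities (UT2 :: ('k, 'k mat) module)")
    case False
    then obtain N where N: "\<And>n. n \<ge> N \<Longrightarrow> proper_polys_deg n \<subseteq> I"
      using not_UT2_identity by blast
    let ?J = "variety_identities (var_generated (ground_algebra :: ('k, 'k) module) :: ('k, 'a) module set)"
    have "proper_polys_deg n \<subseteq> ?J" if "n > 0" for n
      using proper_ground_identity that
      by (auto simp: variety_identities_def var_generated_def variety_def)
    \<comment> \<open>Degree \<open>0\<close> is excluded because nonzero constants are not
      identities of \<open>K\<close>.\<close>
    moreover have "n \<ge> N" "n > 0" if "n \<ge> Suc N" for n using that by auto
    ultimately have "I \<inter> proper_polys_deg n = ?J \<inter> proper_polys_deg n" if "n \<ge> Suc N" for n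
      using N that by (metis Int_absorb1)
    then show ?thesis
      unfolding asymp_equiv_varieties_def T_ideals_asymp_equiv_def I_def by blast
  next
    case True
    obtain m where m: "long_products_vanish m"
      using not_F_identity[OF f(2)] True fI second_order_consequence[OF fI] by blast
    \<comment> \<open>This provides a nonzero algebra in the universe, hence room for a copy of
      \<open>UT2\<close>.\<close>
    have "1 \<notin> identities (UT2 :: ('k, 'k mat) module)"
      by (auto simp: identities_UT2_iff id_hom.lin_one zero_list_def)
    then have "1 \<notin> I" using True by blast
    then obtain A where A: "A \<in> U" "1 \<notin> identities A"
      by (auto simp: I_def variety_identities_def)
    then have unital: "unital_algebra A" by (simp add: U variety_def)
    then have "\<one>\<^bsub>A\<^esub> \<noteq> \<zero>\<^bsub>A\<^esub>"
      using A(2) by (auto simp: identities_def unital_algebra.eval_poly_one)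
    note UT2 = variety_identities_UT2[OF unital this]
    have "I \<inter> proper_polys_deg n = identities UT2 \<inter> proper_polys_deg n" if "n \<ge> m + 4" for n
      using True proper_UT2_identity_mem[OF m that] by blast
    then show ?thesis
      unfolding asymp_equiv_varieties_def T_ideals_asymp_equiv_def UT2 I_def by blast
  qed
qed

end
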